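(* Under the standing assumptions, let $\mathcal W=\{u=\sqrt z: z\in\mathcal S\}$. Then for every $u\in\mathcal W$ and every compact $A\subset\mathbb R^d$, $$\mathbf P\Big[\lim_{t\to\infty}\int_{X_t(A)}u(y)\,\mathrm{d}y=0\Big]=1.$$
   Context: Standing assumptions: $d\ge 2$; $b$ is a standard $d$-dimensional Brownian motion; $\sigma$ is a constant $d\times d$ positive-definite matrix and $a:=\sigma\sigma^{T}$; the drift $m:\mathbb R^d\to\mathbb R^d$ belongs to $C^{1,1}(\mathbb R^d)$; there is a potential $\psi:\mathbb R^d\to(0,\infty)$ with $m=-a\nabla\ln\psi$ and $\int_{\mathbb R^d}\psi^{-2}\,\mathrm{d}x=1$; and there is $\lambda_c>0$ with $\nabla\cdot m\le-\lambda_c$ everywhere. $X_t(x,b)$ is the stochastic flow of global diffeomorphisms solving $X_t=x+\sigma b(t)+\int_0^t m(X_s)\,\mathrm{d}s$, and $X_t(A)$ is the image of $A$ under it. The operator $\mathfrak L^\sharp$ acts on $f\in C^2$ by $\mathfrak L^\sharp f=\tfrac12\nabla\cdot(a\nabla f)+m\cdot\nabla f+(\nabla\cdot m)f$. The cone $\mathcal S$ consists of all $z\in C^{2,1}(\mathbb R^d)$ with $z>0$ such that $\mathfrak L^\sharp z\le0$, $\mathfrak L^\sharp z\in C^1_0(\mathbb R^d)$ (continuously differentiable with compact support), and $\mathfrak L^\sharp z$ is not identically zero. *)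

theory Defs
  imports "HOL-Analysis.Analysis" "HOL-Probability.Probability"
begin

definition grad :: "(real^'n \<Rightarrow> real) \<Rightarrow> real^'n \<Rightarrow> real^'n" where
  "grad f x = (\<chi> i. frechet_derivative f (at x) (axis i 1))"

definition divg :: "(real^'n \<Rightarrow> real^'n) \<Rightarrow> real^'n \<Rightarrow> real" where
  "divg F x = (\<Sum>i\<in>UNIV. frechet_derivative F (at x) (axis i 1) $ i)"

definition loc_lipschitz :: "('a::metric_space \<Rightarrow> 'b::metric_space) \<Rightarrow> bool" where
  "loc_lipschitz f \<longleftrightarrow> (\<forall>K. compact K \<longrightarrow> (\<exists>L. L-lipschitz_on K f))"

definition C11_field :: "(real^'n \<Rightarrow> real^'m) \<Rightarrow> bool" where
  "C11_field f \<longleftrightarrow> (\<exists>J :: real^'n \<Rightarrow> real^'n^'m.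
      (\<forall>x. (f has_derivative (\<lambda>h. J x *v h)) (at x)) \<and> loc_lipschitz J)"

definition C21_fun :: "(real^'n \<Rightarrow> real) \<Rightarrow> bool" where
  "C21_fun z \<longleftrightarrow> (\<forall>x. z differentiable (at x)) \<and> C11_field (grad z)"

definition C1_fun :: "(real^'n \<Rightarrow> real) \<Rightarrow> bool" where
  "C1_fun g \<longleftrightarrow> (\<forall>x. g differentiable (at x)) \<and> continuous_on UNIV (grad g)"

definition C1_0_fun :: "(real^'n \<Rightarrow> real) \<Rightarrow> bool" where
  "C1_0_fun g \<longleftrightarrow> C1_fun g \<and> compact (closure {x. g x \<noteq> 0})"

definition Lsharp :: "real^'n^'n \<Rightarrow> (real^'n \<Rightarrow> real^'n) \<Rightarrow> (real^'n \<Rightarrow> real) \<Rightarrow> real^'n \<Rightarrow> real" where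
  "Lsharp a m f x = 1/2 * divg (\<lambda>y. a *v grad f y) x + m x \<bullet> grad f x + divg m x * f x"

definition coneS :: "real^'n^'n \<Rightarrow> (real^'n \<Rightarrow> real^'n) \<Rightarrow> (real^'n \<Rightarrow> real) set" where
  "coneS a m = {z. C21_fun z \<and> (\<forall>x. z x > 0) \<and> (\<forall>x. Lsharp a m z x \<le> 0)
                 \<and> C1_0_fun (Lsharp a m z) \<and> (\<exists>x. Lsharp a m z x \<noteq> 0)}"

definition coneW :: "real^'n^'n \<Rightarrow> (real^'n \<Rightarrow> real^'n) \<Rightarrow> (real^'n \<Rightarrow> real) set" where
  "coneW a m = (\<lambda>z. \<lambda>x. sqrt (z x)) ` coneS a m"

definition std_brownian :: "'w measure \<Rightarrow> ('w \<Rightarrow> real \<Rightarrow> real^'n) \<Rightarrow> bool" where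
  "std_brownian M b \<longleftrightarrow> prob_space M
    \<and> (\<forall>t\<ge>0. (\<lambda>\<omega>. b \<omega> t) \<in> borel_measurable M)
    \<and> (AE \<omega> in M. b \<omega> 0 = 0 \<and> continuous_on {0..} (b \<omega>))
    \<and> (\<forall>s t. 0 \<le> s \<longrightarrow> s < t \<longrightarrow>
         distributed M lborel (\<lambda>\<omega>. b \<omega> t - b \<omega> s)
           (\<lambda>y. ennreal (\<Prod>i\<in>UNIV. normal_density 0 (sqrt (t - s)) (y $ i))))
    \<and> (\<forall>(ts :: nat \<Rightarrow> real) k. 0 \<le> ts 0 \<longrightarrow> (\<forall>j<k. ts j < ts (Suc j)) \<longrightarrow>
         prob_space.indep_vars M (\<lambda>_. borel)
           (\<lambda>j \<omega>. b \<omega> (ts (Suc j)) - b \<omega> (ts j)) {..<k})"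

end

theory Submission
  imports Defs
begin

text \<open>
  Let \<open>I\<^sub>t(x)\<close> be the integral of \<open>div m\<close> along the path \<open>s \<mapsto> X\<^sub>s(x)\<close>, \<open>s \<le> t\<close>. The noise is additive, so the
  flow is an ordinary differential equation path by path; it is differentiable in \<open>x\<close> with Jacobian
  \<open>exp I\<^sub>t\<close> (Liouville), and the integral of \<open>u = \<surd>z\<close> over \<open>X\<^sub>t(A)\<close> is at most that of
  \<open>exp (I\<^sub>t/2) \<surd>Z\<^sub>t \<le> exp (- lam_c t/2) \<surd>Z\<^sub>t\<close> over \<open>A\<close>, where \<open>Z\<^sub>t = z(X\<^sub>t) exp I\<^sub>t\<close>. By Ito's formula \<open>Z\<close> is a
  nonnegative supermartingale, hence \<open>\<surd>Z\<close> has an integrable maximal function, and Tonelli's theorem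
  shows that almost surely the integral of \<open>sup\<^sub>t \<surd>Z\<^sub>t\<close> over \<open>A\<close> is finite.

  Stochastic calculus is avoided by proving the maximal inequality for the Euler scheme killed on
  leaving a ball of radius \<open>r\<close>: there \<open>Z\<close> is a supermartingale up to an error \<open>O(h\<surd>h)\<close> per step, by a
  second-order Taylor expansion and the Gaussian moments of the increments. Pathwise convergence of
  the scheme and Fatou's lemma, first for \<open>h \<rightarrow> 0\<close> and then for \<open>r \<rightarrow> \<infinity>\<close>, give the bound for \<open>Z\<close> itself.
\<close>

section \<open>Integral equations and their flows\<close>

text \<open>The weight gives \<open>Z\<close> the drift \<open>exp I\<close> times
  \<open>Lsharp a m z\<close>, which is nonpositive; this is how the cone enters. The square root is
  forced twice: it leaves half of the Jacobian exponent for the decay, and the supremum of a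
  nonnegative supermartingale need not be integrable, while that of its square root is. The bound
  obtained, \<open>1 + 2 * z x\<close>, depends neither on \<open>h\<close> nor on \<open>r\<close>,
  which lets Fatou act in both limits. The constants of the per-step error do depend on the ball, as
  \<open>m\<close> and \<open>z\<close> are controlled only on compact sets; so \<open>h\<close>
  must tend to zero with \<open>r\<close> fixed. Killing is harmless because \<open>z\<close> is
  positive: it only lowers the next value. The maximal function is replaced by a liminf of chain
  maxima, an explicit function of the Brownian path and the starting point. It is jointly measurable
  by construction and dominates \<open>sqrt Z\<close> at all times and starting points of the same
  path, so no exceptional set depends on \<open>x\<close>.\<close>

lemma gronwall:
  fixes u :: "real \<Rightarrow> real"
  assumes cont: "continuous_on {0..T} u" and L: "0 \<le> L"
    and le: "\<And>t. t \<in> {0..T} \<Longrightarrow> u t \<le> a + L * integral {0..t} u"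
    and t: "t \<in> {0..T}"
  shows "u t \<le> a * exp (L * t)"
proof -
  define U where "U = (\<lambda>t. integral {0..t} u)"
  have dU: "(U has_real_derivative u s) (at s within {0..T})" if "s \<in> {0..T}" for s
    using integral_has_real_derivative[OF cont that] by (simp add: U_def)
  \<comment> \<open>The integrating factor turns the integral inequality into monotonicity of
    \<open>k\<close>.\<close>
  define k where "k = (\<lambda>s. exp (- L * s) * (a + L * U s))"
  have dk: "(k has_real_derivative exp (- L * s) * L * (u s - (a + L * U s))) (at s within {0..T})"
    if "s \<in> {0..T}" for s
    unfolding k_def
    by (auto intro!: derivative_eq_intros dU[OF that] simp: algebra_simps)
  have "k t \<le> k 0"
  proof (rule DERIV_nonpos_imp_decreasing_open[where f = k])
    show "0 \<le> t" using t by auto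
    show "continuous_on {0..t} k"
      by (rule continuous_on_subset[of "{0..T}"], rule DERIV_continuous_on, rule dk) (use t in auto)
    fix s assume s: "0 < s" "s < t"
    then have "(k has_real_derivative exp (- L * s) * L * (u s - (a + L * U s))) (at s)"
      using dk[of s] t at_within_Icc_at[of 0 s T] by auto
    moreover have "exp (- L * s) * L * (u s - (a + L * U s)) \<le> 0"
      using le[of s] s t L by (intro mult_nonneg_nonpos) (auto simp: U_def)
    ultimately show "\<exists>y. (k has_real_derivative y) (at s) \<and> y \<le> 0" by blast
  qed
  then have "exp (- L * t) * (a + L * U t) \<le> a"
    by (simp add: k_def U_def)
  then have "a + L * U t \<le> a * exp (L * t)"
    by (simp add: exp_minus field_simps)
  with le[OF t] show ?thesis by (simp add: U_def)
qed

text \<open>The form in which Gronwall is applied: the integrand is linear in \<open>v\<close> up to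
  a constant defect \<open>e\<close>. With \<open>c = 0\<close> the defect alone controls
  \<open>v\<close>; this yields both the Cauchy property of difference quotients and the
  linearisation error of the flow.\<close>

lemma gronwall_norm:
  fixes v G :: "real \<Rightarrow> 'a::euclidean_space"
  assumes v: "continuous_on {0..T} v" and G: "continuous_on {0..T} G"
    and eq: "\<And>t. t \<in> {0..T} \<Longrightarrow> v t = c + integral {0..t} G"
    and B: "0 \<le> B" and e: "0 \<le> e"
    and bound: "\<And>t. t \<in> {0..T} \<Longrightarrow> norm (G t) \<le> B * norm (v t) + e"
    and t: "t \<in> {0..T}"
  shows "norm (v t) \<le> (norm c + e * T) * exp (B * t)"
proof (rule gronwall[where u = "\<lambda>t. norm (v t)", OF _ B _ t])
  show "continuous_on {0..T} (\<lambda>t. norm (v t))" by (intro continuous_intros v)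
  fix t assume t: "t \<in> {0..T}"
  have vt: "continuous_on {0..t} v" and Gt: "continuous_on {0..t} G"
    using t v G by (auto intro: continuous_on_subset)
  have "norm (integral {0..t} G) \<le> integral {0..t} (\<lambda>s. B * norm (v s) + e)"
    using t bound
    by (intro integral_norm_bound_integral integrable_continuous_interval continuous_intros vt Gt) auto
  also have "\<dots> = B * integral {0..t} (\<lambda>s. norm (v s)) + e * t"
    using t by (subst integral_add)
      (auto intro!: integrable_continuous_interval continuous_intros vt)
  finally have "norm (v t) \<le> norm c + (B * integral {0..t} (\<lambda>s. norm (v s)) + e * t)"
    using eq[OF t] norm_triangle_ineq[of c "integral {0..t} G"] by simp
  also have "e * t \<le> e * T" using t e by (intro mult_left_mono) auto
  finally show "norm (v t) \<le> norm c + e * T + B * integral {0..t} (\<lambda>s. norm (v s))" by simp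
qed


section \<open>Stability of solutions with a common forcing path\<close>

text \<open>The equation is kept in integrated form because the forcing \<open>\<beta>\<close>, in
  the application \<open>\<sigma> *v b \<omega> t\<close>, has no derivative. Uniqueness is not
  built in; it follows from the stability estimate with equal starting points.\<close>

definition ode_path ::
    "('a::euclidean_space \<Rightarrow> 'a) \<Rightarrow> (real \<Rightarrow> 'a) \<Rightarrow> 'a \<Rightarrow> (real \<Rightarrow> 'a) \<Rightarrow> bool" where
  "ode_path F \<beta> x \<phi> \<longleftrightarrow> continuous_on {0..} \<phi> \<and>
     (\<forall>t\<ge>0. \<phi> t = x + \<beta> t + integral {0..t} (\<lambda>s. F (\<phi> s)))"

lemma loc_lipschitz_continuous_on:
  fixes f :: "'a::euclidean_space \<Rightarrow> 'b::metric_space"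
  assumes "loc_lipschitz f"
  shows "continuous_on S f"
proof -
  have "isCont f x" for x
  proof -
    obtain L where "L-lipschitz_on (cball x 1) f"
      using assms compact_cball unfolding loc_lipschitz_def by blast
    then have "continuous_on (cball x 1) f" by (rule lipschitz_on_continuous_on)
    then show ?thesis
      by (rule continuous_on_interior) simp
  qed
  then show ?thesis by (simp add: continuous_at_imp_continuous_on)
qed

lemma ode_path_bounded:
  assumes "ode_path F \<beta> x \<phi>"
  obtains R where "R > 0" "\<And>t. t \<in> {0..T} \<Longrightarrow> norm (\<phi> t) \<le> R"
proof -
  have "continuous_on {0..T} \<phi>"
    using assms by (auto simp: ode_path_def intro: continuous_on_subset)
  then have "bounded (\<phi> ` {0..T})"
    by (intro compact_imp_bounded compact_continuous_image) auto
  then show ?thesis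
    unfolding bounded_pos using that by fastforce
qed

text \<open>The forcing cancels because the noise is additive, so the difference solves an equation
  without a rough term.\<close>

lemma ode_path_diff:
  assumes F: "loc_lipschitz F" and \<phi>: "ode_path F \<beta> x \<phi>" and \<psi>: "ode_path F \<beta> y \<psi>" and t: "0 \<le> t"
  shows "\<psi> t - \<phi> t = (y - x) + integral {0..t} (\<lambda>s. F (\<psi> s) - F (\<phi> s))"
proof -
  have cont: "continuous_on {0..t} \<psi>" "continuous_on {0..t} \<phi>"
    using \<phi> \<psi> by (auto simp: ode_path_def intro: continuous_on_subset)
  have contF: "continuous_on {0..t} (\<lambda>t. F (\<psi> t))" "continuous_on {0..t} (\<lambda>t. F (\<phi> t))"
    by (auto intro!: continuous_on_compose2[OF loc_lipschitz_continuous_on[OF F, of UNIV]] cont)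
  have "\<psi> t = y + \<beta> t + integral {0..t} (\<lambda>s. F (\<psi> s))"
    "\<phi> t = x + \<beta> t + integral {0..t} (\<lambda>s. F (\<phi> s))"
    using \<phi> \<psi> t by (auto simp: ode_path_def)
  then show ?thesis
    by (subst integral_diff) (auto intro!: integrable_continuous_interval contF)
qed

text \<open>\<open>F\<close> is Lipschitz only on compact sets, so \<open>L\<close> is taken on the
  ball of radius \<open>R + 1\<close>, which contains the unit neighbourhood of the path. A solution
  starting within \<open>exp (- L * T) / 2\<close> cannot leave that neighbourhood: while its
  distance to \<open>\<phi>\<close> is at most 1, Gronwall already bounds it by 1/2.\<close>

lemma ode_path_stability:
  fixes F :: "'a::euclidean_space \<Rightarrow> 'a"
  assumes F: "loc_lipschitz F" and \<phi>: "ode_path F \<beta> x \<phi>" and T: "0 \<le> T"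
  obtains C \<delta> where "C > 0" "\<delta> > 0"
    "\<And>y \<psi> t. ode_path F \<beta> y \<psi> \<Longrightarrow> dist y x \<le> \<delta> \<Longrightarrow> t \<in> {0..T} \<Longrightarrow>
      dist (\<psi> t) (\<phi> t) \<le> C * dist y x"
proof -
  obtain R where R: "R > 0" "\<And>t. t \<in> {0..T} \<Longrightarrow> norm (\<phi> t) \<le> R"
    using ode_path_bounded[OF \<phi>] by blast
  obtain L where L: "L-lipschitz_on (cball 0 (R + 1)) F"
    using F compact_cball unfolding loc_lipschitz_def by blast
  have L0: "0 \<le> L" using L by (rule lipschitz_on_nonneg)
  have main: "dist (\<psi> t) (\<phi> t) \<le> exp (L * T) * dist y x"
    if \<psi>: "ode_path F \<beta> y \<psi>" and d: "dist y x \<le> exp (- L * T) / 2" and t: "t \<in> {0..T}" for y \<psi> t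
  proof -
    define v where "v = (\<lambda>t. \<psi> t - \<phi> t)"
    have cont: "continuous_on {0..S} \<psi>" "continuous_on {0..S} \<phi>" for S
      using \<phi> \<psi> by (auto simp: ode_path_def intro: continuous_on_subset)
    have contF: "continuous_on {0..S} (\<lambda>t. F (\<psi> t))" "continuous_on {0..S} (\<lambda>t. F (\<phi> t))" for S
      by (auto intro!: continuous_on_compose2[OF loc_lipschitz_continuous_on[OF F, of UNIV]] cont)
    have veq: "v t = (y - x) + integral {0..t} (\<lambda>s. F (\<psi> s) - F (\<phi> s))" if "t \<ge> 0" for t
      using ode_path_diff[OF F \<phi> \<psi> that] by (simp add: v_def)
    have upto: "norm (v r) \<le> dist y x * exp (L * T)"
      if r: "r \<in> {0..T}" and small: "\<And>s. s \<in> {0..r} \<Longrightarrow> norm (v s) \<le> 1" for r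
    proof -
      have "norm (v r) \<le> (norm (y - x) + 0 * r) * exp (L * r)"
      proof (rule gronwall_norm[where G = "\<lambda>s. F (\<psi> s) - F (\<phi> s)"])
        show "continuous_on {0..r} v" unfolding v_def by (intro continuous_intros cont)
        show "continuous_on {0..r} (\<lambda>s. F (\<psi> s) - F (\<phi> s))" by (intro continuous_intros contF)
        fix s assume s: "s \<in> {0..r}"
        have "norm (\<phi> s) \<le> R" using R s r by auto
        moreover have "norm (\<psi> s) \<le> norm (\<phi> s) + norm (v s)"
          unfolding v_def by (metis add_diff_cancel_left' add.commute norm_triangle_sub)
        ultimately have "\<phi> s \<in> cball 0 (R + 1)" "\<psi> s \<in> cball 0 (R + 1)"
          using small[OF s] by auto
        then show "norm (F (\<psi> s) - F (\<phi> s)) \<le> L * norm (v s) + 0"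
          using lipschitz_onD[OF L] by (simp add: v_def dist_norm)
      qed (use r L0 veq in auto)
      also have "\<dots> \<le> dist y x * exp (L * T)"
        using r L0 by (auto simp: dist_norm intro!: mult_left_mono)
      finally show ?thesis .
    qed
    have half: "dist y x * exp (L * T) \<le> 1/2"
      using d by (simp add: exp_minus field_simps)
    have "norm (v s) \<le> 1" if s: "s \<in> {0..T}" for s
    proof (rule ccontr)
      assume "\<not> norm (v s) \<le> 1"
      \<comment> \<open>Times at which distance 1 is reached. At the first of them the distance is
        exactly 1 by the intermediate value theorem, so \<open>upto\<close> applies up to and
        including that time and contradicts \<open>half\<close>.\<close>
      define E where "E = {0..T} \<inter> (\<lambda>r. norm (v r)) -` {1..}"
      have contv: "continuous_on {0..T} (\<lambda>t. norm (v t))"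
        unfolding v_def by (intro continuous_intros cont)
      have "compact E"
        unfolding compact_eq_bounded_closed E_def
        by (auto intro!: continuous_closed_preimage contv bounded_Int)
      moreover have "s \<in> E" using s \<open>\<not> norm (v s) \<le> 1\<close> by (auto simp: E_def)
      ultimately obtain r where r: "r \<in> E" "\<And>q. q \<in> E \<Longrightarrow> r \<le> q"
        using compact_attains_inf[of E] by blast
      have v0: "norm (v 0) \<le> 1/2"
      proof -
        have "exp (- L * T) \<le> 1" using L0 T by (simp)
        moreover have "norm (v 0) = dist y x" using veq[of 0] by (simp add: dist_norm)
        ultimately show ?thesis using d by linarith
      qed
      have "\<exists>q\<ge>0. q \<le> r \<and> norm (v q) = 1"
        using v0 r(1) by (intro IVT') (auto simp: E_def intro: continuous_on_subset[OF contv])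
      then obtain q where q: "0 \<le> q" "q \<le> r" "norm (v q) = 1" by auto
      then have "r \<le> q" using r by (auto simp: E_def)
      then have vr: "norm (v r) = 1" using q by simp
      have "norm (v r) \<le> dist y x * exp (L * T)"
      proof (rule upto)
        fix s assume "s \<in> {0..r}"
        then have "1 \<le> norm (v s) \<Longrightarrow> s = r"
          using r(2)[of s] r(1) by (auto simp: E_def)
        then show "norm (v s) \<le> 1" using vr by fastforce
      qed (use r in \<open>auto simp: E_def\<close>)
      then show False using half vr by simp
    qed
    then show ?thesis using upto[OF t] t by (auto simp: v_def dist_norm mult.commute)
  qed
  show ?thesis by (rule that[of "exp (L * T)" "exp (- L * T) / 2"]) (use main in auto)
qed

section \<open>Linearisation of the field and differentiability of the flow\<close>

lemma norm_matrix_vector_mult_le: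
  fixes A :: "real^'n^'m"
  shows "norm (A *v h) \<le> real CARD('m) * norm A * norm h"
proof -
  have "norm (A *v h) \<le> (\<Sum>i\<in>UNIV. \<bar>(A *v h) $ i\<bar>)" by (rule norm_le_l1_cart)
  also have "\<dots> \<le> (\<Sum>i\<in>(UNIV::'m set). norm A * norm h)"
  proof (rule sum_mono)
    fix i
    have "\<bar>(A *v h) $ i\<bar> = \<bar>(A $ i) \<bullet> h\<bar>" by (simp add: matrix_vector_mult_def inner_vec_def)
    also have "\<dots> \<le> norm (A $ i) * norm h" by (rule Cauchy_Schwarz_ineq2)
    also have "\<dots> \<le> norm A * norm h" by (intro mult_right_mono Finite_Cartesian_Product.norm_nth_le) auto
    finally show "\<bar>(A *v h) $ i\<bar> \<le> norm A * norm h" .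
  qed
  finally show ?thesis by simp
qed

lemma continuous_on_matrix_vector_mult [continuous_intros]:
  fixes A :: "'a::topological_space \<Rightarrow> real^'n^'m"
  assumes "continuous_on S A" "continuous_on S v"
  shows "continuous_on S (\<lambda>x. A x *v v x)"
  unfolding matrix_vector_mult_def
  using assms by (intro continuous_on_vec_lambda continuous_intros) auto

text \<open>Segments stay inside the ball, where \<open>J\<close> varies by at most a multiple of
  the distance; the mean value inequality turns this into a quadratic remainder. The quadratic
  order, rather than a little-o, gives the difference quotients of the flow a rate of
  convergence.\<close>

lemma C11_linearization:
  fixes F :: "real^'n \<Rightarrow> real^'m"
  assumes der: "\<And>x. (F has_derivative (\<lambda>h. J x *v h)) (at x)" and J: "loc_lipschitz J"
  obtains B \<kappa> where "0 \<le> B" "0 \<le> \<kappa>"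
    "\<And>p h. norm p \<le> R \<Longrightarrow> norm (J p *v h) \<le> B * norm h"
    "\<And>p q. norm p \<le> R \<Longrightarrow> norm q \<le> R \<Longrightarrow> norm (F q - F p - J p *v (q - p)) \<le> \<kappa> * (norm (q - p))\<^sup>2"
proof -
  obtain L where L: "L-lipschitz_on (cball 0 R) J"
    using J compact_cball unfolding loc_lipschitz_def by blast
  have L0: "0 \<le> L" using L by (rule lipschitz_on_nonneg)
  have "compact (J ` cball 0 R)"
    by (intro compact_continuous_image loc_lipschitz_continuous_on J) simp
  then have "bounded (J ` cball 0 R)" by (rule compact_imp_bounded)
  then obtain b where b: "b > 0" "\<And>p. p \<in> cball 0 R \<Longrightarrow> norm (J p) \<le> b"
    unfolding bounded_pos by blast
  define N where "N = real CARD('m)"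
  have N0: "0 \<le> N" by (simp add: N_def)
  have "norm (J p *v h) \<le> (N * b) * norm h" if "norm p \<le> R" for p h
  proof -
    have "norm (J p *v h) \<le> N * norm (J p) * norm h"
      unfolding N_def by (rule norm_matrix_vector_mult_le)
    also have "\<dots> \<le> N * b * norm h"
      using b that N0 by (intro mult_mono) auto
    finally show ?thesis .
  qed
  moreover have "norm (F q - F p - J p *v (q - p)) \<le> (N * L) * (norm (q - p))\<^sup>2"
    if p: "norm p \<le> R" and q: "norm q \<le> R" for p q
  proof -
    have seg: "norm y \<le> R" "norm (y - p) \<le> norm (q - p)" if "y \<in> closed_segment p q" for y
    proof -
      have "closed_segment p q \<subseteq> cball 0 R"
        using p q by (intro closed_segment_subset) auto
      then show "norm y \<le> R" using that by auto
      show "norm (y - p) \<le> norm (q - p)"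
        using segment_bound(1)[OF that] by (simp add: norm_minus_commute)
    qed
    have "norm (F q - F p - J p *v (q - p)) \<le> norm (q - p) * (N * L * norm (q - p))"
    proof (rule differentiable_bound_linearization[where S = "closed_segment p q" and f' = "\<lambda>y h. J y *v h"])
      fix t :: real assume "t \<in> {0..1}"
      then show "p + t *\<^sub>R (q - p) \<in> closed_segment p q"
        by (auto simp: in_segment algebra_simps intro!: exI[of _ t])
    next
      fix y assume y: "y \<in> closed_segment p q"
      show "(F has_derivative (*v) (J y)) (at y within closed_segment p q)"
        using der[of y] by (simp add: has_derivative_at_withinI)
      show "onorm ((*v) (J y) - (*v) (J p)) \<le> N * L * norm (q - p)"
      proof (rule onorm_bound)
        show "0 \<le> N * L * norm (q - p)" using N0 L0 by simp
        fix h
        have "norm (((*v) (J y) - (*v) (J p)) h) = norm ((J y - J p) *v h)"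
          by (simp add: matrix_vector_mult_diff_rdistrib)
        also have "\<dots> \<le> N * norm (J y - J p) * norm h"
          unfolding N_def by (rule norm_matrix_vector_mult_le)
        also have "\<dots> \<le> N * (L * norm (q - p)) * norm h"
        proof (intro mult_mono)
          have "norm (J y - J p) \<le> L * norm (y - p)"
            using lipschitz_onD[OF L, of y p] seg(1)[OF y] p by (simp add: dist_norm)
          also have "\<dots> \<le> L * norm (q - p)" using seg(2)[OF y] L0 by (intro mult_left_mono)
          finally show "norm (J y - J p) \<le> L * norm (q - p)" .
        qed (use N0 L0 in auto)
        finally show "norm (((*v) (J y) - (*v) (J p)) h) \<le> N * L * norm (q - p) * norm h"
          by (simp add: mult.assoc)
      qed
    qed simp
    then show ?thesis by (simp add: power2_eq_square algebra_simps)
  qed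
  ultimately show ?thesis using that[of "N * b" "N * L"] N0 L0 b(1) by simp
qed

lemma C11_loc_lipschitz:
  fixes F :: "real^'n \<Rightarrow> real^'m"
  assumes der: "\<And>x. (F has_derivative (\<lambda>h. J x *v h)) (at x)" and J: "loc_lipschitz J"
  shows "loc_lipschitz F"
  unfolding loc_lipschitz_def
proof (intro allI impI)
  fix K :: "(real^'n) set" assume "compact K"
  then have "bounded K" by (rule compact_imp_bounded)
  then obtain R where R: "\<And>x. x \<in> K \<Longrightarrow> norm x \<le> R"
    unfolding bounded_iff by blast
  obtain B where B: "0 \<le> B" "\<And>p h. norm p \<le> R \<Longrightarrow> norm (J p *v h) \<le> B * norm h"
    by (rule C11_linearization[OF der J, of R]) blast
  \<comment> \<open>The compact set is enlarged to a ball, since the mean value bound asks for a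
    convex domain.\<close>
  have "B-lipschitz_on (cball 0 R) F"
  proof (rule lipschitz_onI)
    fix x y :: "real^'n" assume xy: "x \<in> cball 0 R" "y \<in> cball 0 R"
    have "norm (F x - F y) \<le> B * norm (x - y)"
    proof (rule differentiable_bound[OF convex_cball[of 0 R]])
      fix p assume p: "p \<in> cball (0::real^'n) R"
      show "(F has_derivative (*v) (J p)) (at p within cball 0 R)"
        using der[of p] by (simp add: has_derivative_at_withinI)
      show "onorm ((*v) (J p)) \<le> B" by (rule onorm_bound[OF B]) (use p in simp)
    qed (rule xy)+
    then show "dist (F x) (F y) \<le> B * dist x y" by (simp add: dist_norm)
  qed (rule B(1))
  moreover have "K \<subseteq> cball 0 R" using R by auto
  ultimately show "\<exists>L. L-lipschitz_on K F"
    using lipschitz_on_subset by blast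
qed

text \<open>Stability keeps every solution started within \<open>\<delta>\<close> inside the ball of
  radius \<open>R + C * \<delta>\<close> up to time \<open>T\<close>, where the constants of
  \<open>C11_linearization\<close> are uniform. It also converts a remainder quadratic in
  \<open>\<phi> t y - \<phi> t x\<close> into one quadratic in \<open>y - x\<close>.\<close>

lemma flow_linearization:
  fixes F :: "real^'n \<Rightarrow> real^'n"
  assumes der: "\<And>x. (F has_derivative (\<lambda>h. J x *v h)) (at x)" and J: "loc_lipschitz J"
    and \<phi>: "\<And>x. ode_path F \<beta> x (\<lambda>t. \<phi> t x)" and T: "0 \<le> T"
  obtains B \<kappa> \<delta> where "0 \<le> B" "0 \<le> \<kappa>" "0 < \<delta>"
    "\<And>t h. t \<in> {0..T} \<Longrightarrow> norm (J (\<phi> t x) *v h) \<le> B * norm h"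
    "\<And>t y. t \<in> {0..T} \<Longrightarrow> dist y x \<le> \<delta> \<Longrightarrow>
       norm (F (\<phi> t y) - F (\<phi> t x) - J (\<phi> t x) *v (\<phi> t y - \<phi> t x)) \<le> \<kappa> * (dist y x)\<^sup>2"
proof -
  obtain C \<delta> where C: "C > 0" "\<delta> > 0"
    "\<And>y \<psi> t. ode_path F \<beta> y \<psi> \<Longrightarrow> dist y x \<le> \<delta> \<Longrightarrow> t \<in> {0..T} \<Longrightarrow>
      dist (\<psi> t) (\<phi> t x) \<le> C * dist y x"
    using ode_path_stability[OF C11_loc_lipschitz[OF der J] \<phi>[of x] T] by blast
  obtain R where R: "R > 0" "\<And>t. t \<in> {0..T} \<Longrightarrow> norm (\<phi> t x) \<le> R"
    using ode_path_bounded[OF \<phi>[of x], of T] by blast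
  obtain B \<kappa> where B: "0 \<le> B" "0 \<le> \<kappa>"
    "\<And>p h. norm p \<le> R + C * \<delta> \<Longrightarrow> norm (J p *v h) \<le> B * norm h"
    "\<And>p q. norm p \<le> R + C * \<delta> \<Longrightarrow> norm q \<le> R + C * \<delta> \<Longrightarrow>
       norm (F q - F p - J p *v (q - p)) \<le> \<kappa> * (norm (q - p))\<^sup>2"
    by (rule C11_linearization[OF der J, of "R + C * \<delta>"]) blast
  have Cd: "0 \<le> C * \<delta>" using C by simp
  show ?thesis
  proof (rule that[of B "\<kappa> * C\<^sup>2" \<delta>])
    fix t h assume "t \<in> {0..T}"
    then have "norm (\<phi> t x) \<le> R + C * \<delta>" using R(2)[of t] Cd by linarith
    then show "norm (J (\<phi> t x) *v h) \<le> B * norm h" by (rule B)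
  next
    fix t y assume t: "t \<in> {0..T}" and y: "dist y x \<le> \<delta>"
    have 1: "norm (\<phi> t x) \<le> R + C * \<delta>" using R(2)[of t] Cd t by linarith
    have d: "norm (\<phi> t y - \<phi> t x) \<le> C * dist y x"
      using C(3)[OF \<phi>[of y] y t] by (simp add: dist_norm)
    also have "\<dots> \<le> C * \<delta>" using C y by simp
    finally have 2: "norm (\<phi> t y) \<le> R + C * \<delta>"
      using R(2)[OF t] norm_triangle_sub[of "\<phi> t y" "\<phi> t x"] by linarith
    have "norm (F (\<phi> t y) - F (\<phi> t x) - J (\<phi> t x) *v (\<phi> t y - \<phi> t x))
        \<le> \<kappa> * (norm (\<phi> t y - \<phi> t x))\<^sup>2" using 1 2 by (rule B)
    also have "\<dots> \<le> \<kappa> * (C * dist y x)\<^sup>2"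
      using d B(2) by (intro mult_left_mono power_mono) auto
    finally show "norm (F (\<phi> t y) - F (\<phi> t x) - J (\<phi> t x) *v (\<phi> t y - \<phi> t x))
        \<le> \<kappa> * C\<^sup>2 * (dist y x)\<^sup>2" by (simp add: power_mult_distrib mult.assoc)
  qed (use B C in auto)
qed

text \<open>Difference quotients of the flow form a Cauchy sequence by Gronwall, so that no existence
  theorem for linear differential equations is needed.\<close>
lemma variational_equation_solution:
  fixes F :: "real^'n \<Rightarrow> real^'n"
  assumes der: "\<And>x. (F has_derivative (\<lambda>h. J x *v h)) (at x)" and J: "loc_lipschitz J"
    and \<phi>: "\<And>x. ode_path F \<beta> x (\<lambda>t. \<phi> t x)" and T: "0 \<le> T"
  obtains w where "continuous_on {0..T} w"
    "\<And>t. t \<in> {0..T} \<Longrightarrow> w t = h + integral {0..t} (\<lambda>s. J (\<phi> s x) *v w s)"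
proof -
  have F: "loc_lipschitz F" by (rule C11_loc_lipschitz[OF der J])
  obtain B \<kappa> \<delta> where B: "0 \<le> B" "0 \<le> \<kappa>" "0 < \<delta>"
    "\<And>t h. t \<in> {0..T} \<Longrightarrow> norm (J (\<phi> t x) *v h) \<le> B * norm h"
    "\<And>t y. t \<in> {0..T} \<Longrightarrow> dist y x \<le> \<delta> \<Longrightarrow>
       norm (F (\<phi> t y) - F (\<phi> t x) - J (\<phi> t x) *v (\<phi> t y - \<phi> t x)) \<le> \<kappa> * (dist y x)\<^sup>2"
    by (rule flow_linearization[OF der J \<phi> T, of x]) blast
  \<comment> \<open>Reciprocal step lengths: the factor \<open>norm h / \<delta> + 1\<close> puts
    every \<open>y n\<close> within \<open>\<delta>\<close> of \<open>x\<close>, and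
    \<open>2 ^ n\<close> makes the defect of the quotient \<open>q n\<close> in the linearised
    equation at most a constant times \<open>1 / 2 ^ n\<close>.\<close>
  define a where "a n = (norm h / \<delta> + 1) * 2 ^ n" for n :: nat
  have a1: "a n \<ge> 2 ^ n" for n
    using B(3) by (simp add: a_def)
  have a0: "a n > 0" for n using a1[of n] by (smt (verit) zero_less_power)
  define y where "y n = x + h /\<^sub>R a n" for n
  have dy: "dist (y n) x = norm h / a n" for n
    using a0[of n] by (simp add: y_def dist_norm divide_inverse_commute)
  have dyd: "dist (y n) x \<le> \<delta>" for n
  proof -
    have "norm h / \<delta> \<le> a n"
      unfolding a_def using B(3) mult_left_mono[of 1 "2^n" "norm h / \<delta> + 1"] by simp
    then show ?thesis unfolding dy using a0[of n] B(3) by (simp add: field_simps)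
  qed
  define q where "q n t = a n *\<^sub>R (\<phi> t (y n) - \<phi> t x)" for n t
  define G where "G n = (\<lambda>t. a n *\<^sub>R (F (\<phi> t (y n)) - F (\<phi> t x)))" for n
  have c\<phi>: "continuous_on {0..T} (\<lambda>t. \<phi> t z)" for z
    using \<phi>[of z] by (auto simp: ode_path_def intro: continuous_on_subset)
  have cF: "continuous_on {0..T} (\<lambda>t. F (\<phi> t z))" for z
    by (auto intro!: continuous_on_compose2[OF loc_lipschitz_continuous_on[OF F, of UNIV]] c\<phi>)
  have cJ: "continuous_on {0..T} (\<lambda>t. J (\<phi> t x))"
    by (auto intro!: continuous_on_compose2[OF loc_lipschitz_continuous_on[OF J, of UNIV]] c\<phi>)
  have cq: "continuous_on {0..T} (q n)" and cG: "continuous_on {0..T} (G n)" for n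
    unfolding q_def G_def by (intro continuous_intros c\<phi> cF)+
  have sub: "continuous_on {0..t} f" if "t \<in> {0..T}" "continuous_on {0..T} f" for t and f :: "real \<Rightarrow> real^'n"
    using that by (auto intro: continuous_on_subset)
  have qeq: "q n t = h + integral {0..t} (G n)" if "t \<in> {0..T}" for n t
    using that a0[of n] ode_path_diff[OF F \<phi>[of x] \<phi>[of "y n"], of t]
    by (simp add: q_def G_def y_def scaleR_add_right)
  have err: "norm (G n t - J (\<phi> t x) *v q n t) \<le> \<kappa> * (norm h)\<^sup>2 / 2 ^ n" if t: "t \<in> {0..T}" for n t
  proof -
    have "G n t - J (\<phi> t x) *v q n t
        = a n *\<^sub>R (F (\<phi> t (y n)) - F (\<phi> t x) - J (\<phi> t x) *v (\<phi> t (y n) - \<phi> t x))"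
      by (simp add: G_def q_def matrix_vector_mult_scaleR matrix_vector_mult_diff_distrib scaleR_diff_right)
    then have "norm (G n t - J (\<phi> t x) *v q n t) \<le> a n * (\<kappa> * (norm h / a n)\<^sup>2)"
      using B(5)[OF t dyd[of n]] a0[of n] by (simp add: dy)
    also have "\<dots> = \<kappa> * (norm h)\<^sup>2 / a n" using a0[of n] by (simp add: power2_eq_square field_simps)
    also have "\<dots> \<le> \<kappa> * (norm h)\<^sup>2 / 2 ^ n" using a1[of n] a0[of n] B by (intro divide_left_mono) auto
    finally show ?thesis .
  qed
  define D where "D = \<kappa> * (norm h)\<^sup>2 * T * exp (B * T)"
  have D0: "0 \<le> D" unfolding D_def using B T by auto
  have cauchy: "norm (q k t - q l t) \<le> D * (1 / 2 ^ k + 1 / 2 ^ l)" if t: "t \<in> {0..T}" for k l t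
  proof -
    define e where "e = \<kappa> * (norm h)\<^sup>2 * (1 / 2 ^ k + 1 / 2 ^ l)"
    have e0: "0 \<le> e" using B by (auto simp: e_def)
    have "norm (q k t - q l t) \<le> (norm (0::real^'n) + e * T) * exp (B * t)"
    proof (rule gronwall_norm[where v = "\<lambda>t. q k t - q l t" and G = "\<lambda>t. G k t - G l t", OF _ _ _ B(1) e0 _ t])
      fix s assume s: "s \<in> {0..T}"
      show "q k s - q l s = 0 + integral {0..s} (\<lambda>t. G k t - G l t)"
        unfolding qeq[OF s]
        by (subst integral_diff) (auto intro!: integrable_continuous_interval sub[OF s] cG)
      have "G k s - G l s = J (\<phi> s x) *v (q k s - q l s)
          + ((G k s - J (\<phi> s x) *v q k s) - (G l s - J (\<phi> s x) *v q l s))"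
        by (simp add: matrix_vector_mult_diff_distrib)
      also have "norm \<dots> \<le> B * norm (q k s - q l s) + (\<kappa> * (norm h)\<^sup>2 / 2 ^ k + \<kappa> * (norm h)\<^sup>2 / 2 ^ l)"
        by (rule norm_triangle_mono[OF B(4)[OF s]], rule norm_triangle_le_diff, rule add_mono) (rule err[OF s])+
      finally show "norm (G k s - G l s) \<le> B * norm (q k s - q l s) + e"
        by (simp add: e_def field_simps)
    qed (intro continuous_intros cq cG)+
    also have "\<dots> \<le> (e * T) * exp (B * T)"
      using t B e0 T by (auto intro!: mult_left_mono)
    finally show ?thesis by (simp add: D_def e_def mult_ac)
  qed
  have "uniformly_Cauchy_on {0..T} q"
  proof (rule uniformly_Cauchy_onI)
    fix \<epsilon> :: real assume \<epsilon>: "0 < \<epsilon>"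
    obtain N where N: "(2 * D + 1) / \<epsilon> < 2 ^ N"
      using real_arch_pow[of 2 "(2 * D + 1) / \<epsilon>"] by auto
    have "dist (q k t) (q l t) < \<epsilon>" if "t \<in> {0..T}" "k \<ge> N" "l \<ge> N" for t k l
    proof -
      have "norm (q k t - q l t) \<le> D * (1 / 2 ^ k + 1 / 2 ^ l)" using cauchy that by simp
      also have "\<dots> \<le> D * (1 / 2 ^ N + 1 / 2 ^ N)"
        using D0 that by (intro mult_left_mono add_mono divide_left_mono) (auto intro: power_increasing)
      also have "\<dots> < \<epsilon>" using N \<epsilon> D0 by (simp add: field_simps)
      finally show ?thesis by (simp add: dist_norm)
    qed
    then show "\<exists>M. \<forall>x\<in>{0..T}. \<forall>m\<ge>M. \<forall>n\<ge>M. dist (q m x) (q n x) < \<epsilon>" by blast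
  qed
  then obtain w where w: "uniform_limit {0..T} q w sequentially"
    using Cauchy_uniformly_convergent uniformly_convergent_on_def by blast
  have cw: "continuous_on {0..T} w"
    by (rule uniform_limit_theorem[OF _ w]) (auto simp: cq)
  have "w t = h + integral {0..t} (\<lambda>s. J (\<phi> s x) *v w s)" if t: "t \<in> {0..T}" for t
  proof -
    \<comment> \<open>Uniform convergence of the integrands carries the integral equation of
      \<open>q n\<close> over to the limit, where the scaled drift increment becomes the linearised
      drift.\<close>
    have "uniform_limit {0..t} G (\<lambda>s. J (\<phi> s x) *v w s) sequentially"
    proof (rule uniform_limitI)
      fix \<epsilon> :: real assume \<epsilon>: "0 < \<epsilon>"
      have "(\<lambda>n. \<kappa> * (norm h)\<^sup>2 / 2 ^ n) \<longlonglongrightarrow> 0"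
        by (intro LIMSEQ_divide_realpow_zero) auto
      then have "\<forall>\<^sub>F n in sequentially. \<kappa> * (norm h)\<^sup>2 / 2 ^ n < \<epsilon> / 2"
        using \<epsilon> by (intro order_tendstoD) auto
      moreover have "\<forall>\<^sub>F n in sequentially. \<forall>s\<in>{0..T}. dist (q n s) (w s) < \<epsilon> / (2 * (B + 1))"
        using \<epsilon> B by (intro uniform_limitD[OF w]) auto
      ultimately show "\<forall>\<^sub>F n in sequentially. \<forall>s\<in>{0..t}. dist (G n s) (J (\<phi> s x) *v w s) < \<epsilon>"
      proof eventually_elim
        case (elim n)
        show ?case
        proof
          fix s assume "s \<in> {0..t}"
          then have s: "s \<in> {0..T}" using t by auto
          have "G n s - J (\<phi> s x) *v w s = J (\<phi> s x) *v (q n s - w s) + (G n s - J (\<phi> s x) *v q n s)"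
            by (simp add: matrix_vector_mult_diff_distrib)
          also have "norm \<dots> \<le> B * norm (q n s - w s) + \<kappa> * (norm h)\<^sup>2 / 2 ^ n"
            by (intro norm_triangle_mono B(4)[OF s] err[OF s])
          also have "\<dots> < \<epsilon> / 2 + \<epsilon> / 2"
          proof (rule add_le_less_mono)
            have "norm (q n s - w s) \<le> \<epsilon> / (2 * (B + 1))"
              using elim(2) s by (auto simp: dist_norm intro: less_imp_le)
            then have "B * norm (q n s - w s) \<le> (B + 1) * (\<epsilon> / (2 * (B + 1)))"
              using B(1) by (intro mult_mono) auto
            also have "\<dots> = \<epsilon> / 2" using B(1) by (simp add: divide_simps)
            finally show "B * norm (q n s - w s) \<le> \<epsilon> / 2" .
          qed (rule elim)
          finally show "dist (G n s) (J (\<phi> s x) *v w s) < \<epsilon>" by (simp add: dist_norm)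
        qed
      qed
    qed
    then obtain I K where I: "\<And>n. (G n has_integral I n) {0..t}"
      and K: "((\<lambda>s. J (\<phi> s x) *v w s) has_integral K) {0..t}" and lim: "I \<longlonglongrightarrow> K"
      by (rule uniform_limit_integral) (auto intro: sub[OF t] cG)
    have "I n = q n t - h" for n using qeq[OF t, of n] integral_unique[OF I[of n]] by simp
    then have "(\<lambda>n. q n t - h) \<longlonglongrightarrow> K" using lim by presburger
    moreover have "(\<lambda>n. q n t - h) \<longlonglongrightarrow> w t - h"
      using tendsto_uniform_limitI[OF w t] by (intro tendsto_intros)
    ultimately have "K = w t - h" by (rule LIMSEQ_unique)
    then show ?thesis using K by (simp add: integral_unique)
  qed
  then show ?thesis using that cw by blast
qed

text \<open>The remainder \<open>\<phi> t y - \<phi> t x - W t *v (y - x)\<close> starts at zero and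
  solves the variational equation up to a defect of order \<open>(dist y x)\<^sup>2\<close>, so
  Gronwall makes it quadratic. The variational equation is returned as well, as input for
  Liouville's formula.\<close>

lemma flow_has_derivative:
  fixes F :: "real^'n \<Rightarrow> real^'n"
  assumes der: "\<And>x. (F has_derivative (\<lambda>h. J x *v h)) (at x)" and J: "loc_lipschitz J"
    and \<phi>: "\<And>x. ode_path F \<beta> x (\<lambda>t. \<phi> t x)" and T: "0 \<le> T"
  obtains W :: "real \<Rightarrow> real^'n^'n" where "\<And>h. continuous_on {0..T} (\<lambda>t. W t *v h)"
    "\<And>t. t \<in> {0..T} \<Longrightarrow> (\<phi> t has_derivative (\<lambda>h. W t *v h)) (at x)"
    "\<And>t h. t \<in> {0..T} \<Longrightarrow> W t *v h = h + integral {0..t} (\<lambda>s. J (\<phi> s x) *v (W s *v h))"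
proof -
  have F: "loc_lipschitz F" by (rule C11_loc_lipschitz[OF der J])
  obtain B \<kappa> \<delta> where B: "0 \<le> B" "0 \<le> \<kappa>" "0 < \<delta>"
    "\<And>t h. t \<in> {0..T} \<Longrightarrow> norm (J (\<phi> t x) *v h) \<le> B * norm h"
    "\<And>t y. t \<in> {0..T} \<Longrightarrow> dist y x \<le> \<delta> \<Longrightarrow>
       norm (F (\<phi> t y) - F (\<phi> t x) - J (\<phi> t x) *v (\<phi> t y - \<phi> t x)) \<le> \<kappa> * (dist y x)\<^sup>2"
    by (rule flow_linearization[OF der J \<phi> T, of x]) blast
  have "\<exists>w. continuous_on {0..T} w \<and> (\<forall>t\<in>{0..T}. w t = h + integral {0..t} (\<lambda>s. J (\<phi> s x) *v w s))" for h
    by (rule variational_equation_solution[OF der J \<phi> T, of h x]) blast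
  then obtain w where cw: "\<And>h. continuous_on {0..T} (w h)"
    and w: "\<And>h t. t \<in> {0..T} \<Longrightarrow> w h t = h + integral {0..t} (\<lambda>s. J (\<phi> s x) *v w h s)"
    by metis
  \<comment> \<open>Only the solutions in the coordinate directions are used, as columns; linearity
    of the equation then covers every \<open>h\<close>.\<close>
  define W where "W t = (\<chi> i j. w (axis j 1) t $ i)" for t
  have W: "W t *v h = (\<Sum>j\<in>UNIV. (h $ j) *\<^sub>R w (axis j 1) t)" for t h
    by (simp add: vec_eq_iff W_def matrix_vector_mult_def sum_component mult.commute)
  have c\<phi>: "continuous_on {0..T} (\<lambda>t. \<phi> t z)" for z
    using \<phi>[of z] by (auto simp: ode_path_def intro: continuous_on_subset)
  have cF: "continuous_on {0..T} (\<lambda>t. F (\<phi> t z))" for z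
    by (auto intro!: continuous_on_compose2[OF loc_lipschitz_continuous_on[OF F, of UNIV]] c\<phi>)
  have cJ: "continuous_on {0..T} (\<lambda>t. J (\<phi> t x))"
    by (auto intro!: continuous_on_compose2[OF loc_lipschitz_continuous_on[OF J, of UNIV]] c\<phi>)
  have cW: "continuous_on {0..T} (\<lambda>t. W t *v h)" for h
    unfolding W by (intro continuous_intros cw)
  have sub: "continuous_on {0..t} f" if "t \<in> {0..T}" "continuous_on {0..T} f" for t and f :: "real \<Rightarrow> real^'n"
    using that by (auto intro: continuous_on_subset)
  have Weq: "W t *v h = h + integral {0..t} (\<lambda>s. J (\<phi> s x) *v (W s *v h))" if t: "t \<in> {0..T}" for t h
  proof -
    have int: "(\<lambda>s. (h $ j) *\<^sub>R (J (\<phi> s x) *v w (axis j 1) s)) integrable_on {0..t}" for j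
      by (intro integrable_continuous_interval sub[OF t] continuous_intros cJ cw)
    have "W t *v h = (\<Sum>j\<in>UNIV. (h $ j) *\<^sub>R axis j 1
        + integral {0..t} (\<lambda>s. (h $ j) *\<^sub>R (J (\<phi> s x) *v w (axis j 1) s)))"
      unfolding W by (intro sum.cong refl, subst w[OF t]) (simp add: scaleR_add_right)
    also have "\<dots> = h + integral {0..t} (\<lambda>s. \<Sum>j\<in>UNIV. (h $ j) *\<^sub>R (J (\<phi> s x) *v w (axis j 1) s))"
      using int by (simp add: sum.distrib integral_sum vec_eq_iff sum_component axis_def if_distrib[of "(*) _"] cong: if_cong)
    also have "(\<lambda>s. \<Sum>j\<in>UNIV. (h $ j) *\<^sub>R (J (\<phi> s x) *v w (axis j 1) s)) = (\<lambda>s. J (\<phi> s x) *v (W s *v h))"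
      unfolding W by (simp add: linear_sum[OF matrix_vector_mul_linear] matrix_vector_mult_scaleR)
    finally show ?thesis .
  qed
  have "(\<phi> t has_derivative (\<lambda>h. W t *v h)) (at x)" if t: "t \<in> {0..T}" for t
  proof -
    define D where "D = \<kappa> * T * exp (B * T)"
    have D0: "0 \<le> D" using B T by (simp add: D_def)
    have bound: "norm (\<phi> t y - \<phi> t x - W t *v (y - x)) \<le> D * (norm (y - x))\<^sup>2" if y: "dist y x \<le> \<delta>" for y
    proof -
      define v where "v = (\<lambda>s. \<phi> s y - \<phi> s x - W s *v (y - x))"
      define G where "G = (\<lambda>s. F (\<phi> s y) - F (\<phi> s x) - J (\<phi> s x) *v (W s *v (y - x)))"
      define e where "e = \<kappa> * (dist y x)\<^sup>2"
      have e0: "0 \<le> e" using B by (simp add: e_def)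
      have "norm (v t) \<le> (norm (0::real^'n) + e * T) * exp (B * t)"
      proof (rule gronwall_norm[where G = G, OF _ _ _ B(1) e0 _ t])
        show "continuous_on {0..T} v" unfolding v_def by (intro continuous_intros c\<phi> cW)
        show "continuous_on {0..T} G" unfolding G_def by (intro continuous_intros cF cJ cW)
        fix s assume s: "s \<in> {0..T}"
        have "v s = integral {0..s} (\<lambda>s. F (\<phi> s y) - F (\<phi> s x)) - integral {0..s} (\<lambda>s. J (\<phi> s x) *v (W s *v (y - x)))"
          using ode_path_diff[OF F \<phi>[of x] \<phi>[of y], of s] Weq[OF s, of "y - x"] s by (simp add: v_def)
        also have "\<dots> = integral {0..s} G"
          unfolding G_def by (rule integral_diff[symmetric])
            (intro integrable_continuous_interval sub[OF s] continuous_intros cF cJ cW)+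
        finally show "v s = 0 + integral {0..s} G" by simp
        have "G s = J (\<phi> s x) *v v s + (F (\<phi> s y) - F (\<phi> s x) - J (\<phi> s x) *v (\<phi> s y - \<phi> s x))"
          by (simp add: G_def v_def matrix_vector_mult_diff_distrib)
        also have "norm \<dots> \<le> B * norm (v s) + e"
          unfolding e_def by (intro norm_triangle_mono B(4,5) s y)
        finally show "norm (G s) \<le> B * norm (v s) + e" .
      qed
      also have "\<dots> \<le> (e * T) * exp (B * T)"
        using t B e0 T by (auto intro!: mult_left_mono)
      finally show ?thesis by (simp add: v_def D_def e_def mult_ac dist_norm)
    qed
    show ?thesis
    proof (rule has_derivativeI_sandwich[where e = \<delta> and H = "\<lambda>y. D * norm (y - x)"])
      show "((\<lambda>y. D * norm (y - x)) \<longlongrightarrow> 0) (at x)"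
        by (auto intro!: tendsto_eq_intros)
      fix y assume "y \<noteq> x" "dist y x < \<delta>"
      then show "norm (\<phi> t y - \<phi> t x - W t *v (y - x)) / norm (y - x) \<le> D * norm (y - x)"
        using bound[of y] by (simp add: field_simps power2_eq_square)
    qed (use B in \<open>auto intro: matrix_vector_mul_bounded_linear\<close>)
  qed
  then show ?thesis using that[of W] cW Weq by blast
qed

section \<open>Volume distortion along the flow\<close>

text \<open>Row \<open>i\<close> of the product is a combination of the rows of \<open>W\<close>. By
  multilinearity the determinant splits accordingly, and every summand with \<open>l\<close> other
  than \<open>i\<close> has a repeated row.\<close>

lemma det_replace_row_matrix_mult:
  fixes A W :: "real^'n^'n"
  shows "det (\<chi> k. if k = i then (A ** W) $ i else W $ k) = A $ i $ i * det W"
proof -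
  have row: "(A ** W) $ i = (\<Sum>l\<in>UNIV. (A $ i $ l) *s (W $ l))"
    by (simp add: vec_eq_iff matrix_matrix_mult_def sum_component)
  have "det (\<chi> k. if k = i then (A ** W) $ i else W $ k)
      = (\<Sum>l\<in>UNIV. det (\<chi> k. if k = i then (A $ i $ l) *s (W $ l) else W $ k))"
    unfolding row using det_linear_row_sum[of UNIV i "\<lambda>k l. (A $ i $ l) *s (W $ l)" "\<lambda>k. W $ k"] by simp
  also have "\<dots> = (\<Sum>l\<in>UNIV. A $ i $ l * det (\<chi> k. if k = i then W $ l else W $ k))"
    using det_row_mul[of i _ "\<lambda>_. W $ _" "\<lambda>k. W $ k"] by (intro sum.cong refl) blast
  also have "\<dots> = (\<Sum>l\<in>UNIV. if l = i then A $ i $ i * det W else 0)"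
  proof (intro sum.cong refl)
    fix l
    show "A $ i $ l * det (\<chi> k. if k = i then W $ l else W $ k) = (if l = i then A $ i $ i * det W else 0)"
    proof (cases "l = i")
      case True
      have "(\<chi> k. if k = i then W $ i else W $ k) = W" by (simp add: vec_eq_iff)
      then show ?thesis unfolding True by simp
    next
      case False
      have "det (\<chi> k. if k = i then W $ l else W $ k) = 0"
        by (rule det_identical_rows[of i l]) (use False in \<open>auto simp: row_def\<close>)
      then show ?thesis using False by simp
    qed
  qed
  finally show ?thesis by simp
qed

text \<open>Jacobi's formula from the Leibniz expansion: the product rule differentiates one row at
  a time, and each differentiated row contributes one diagonal entry of \<open>A\<close>. Here
  \<open>A\<close> is the coefficient matrix frozen at the single time \<open>t\<close>.\<close>

lemma det_has_derivative_Jacobi: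
  fixes W :: "real \<Rightarrow> real^'n^'n"
  assumes W: "\<And>i j. ((\<lambda>t. W t $ i $ j) has_real_derivative (A ** W t) $ i $ j) (at t within S)"
  shows "((\<lambda>t. det (W t)) has_real_derivative trace A * det (W t)) (at t within S)"
proof -
  let ?d = "\<lambda>p i. (A ** W t) $ i $ p i * (\<Prod>j\<in>UNIV-{i}. W t $ j $ p j)"
  have "((\<lambda>t. \<Prod>i\<in>UNIV. W t $ i $ p i) has_real_derivative (\<Sum>i\<in>UNIV. ?d p i)) (at t within S)" for p
  proof -
    have "((\<lambda>t. \<Prod>i\<in>UNIV. W t $ i $ p i) has_derivative
        (\<lambda>y. \<Sum>i\<in>UNIV. (A ** W t) $ i $ p i * y * (\<Prod>j\<in>UNIV-{i}. W t $ j $ p j))) (at t within S)"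
      by (rule has_derivative_prod) (rule W[unfolded has_field_derivative_def])
    also have "(\<lambda>y. \<Sum>i\<in>UNIV. (A ** W t) $ i $ p i * y * (\<Prod>j\<in>UNIV-{i}. W t $ j $ p j))
        = (*) (\<Sum>i\<in>UNIV. ?d p i)"
      by (simp add: fun_eq_iff sum_distrib_left sum_distrib_right mult_ac)
    finally show ?thesis unfolding has_field_derivative_def .
  qed
  then have "((\<lambda>t. det (W t)) has_real_derivative
      (\<Sum>p | p permutes UNIV. of_int (sign p) * (\<Sum>i\<in>UNIV. ?d p i))) (at t within S)"
    unfolding det_def by (intro DERIV_sum DERIV_cmult)
  also have "(\<Sum>p | p permutes UNIV. of_int (sign p) * (\<Sum>i\<in>UNIV. ?d p i))
      = (\<Sum>i\<in>UNIV. \<Sum>p | p permutes UNIV. of_int (sign p) * ?d p i)"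
    by (subst sum.swap) (simp add: sum_distrib_left)
  also have "\<dots> = (\<Sum>i\<in>UNIV. det (\<chi> k. if k = i then (A ** W t) $ i else W t $ k))"
  proof (rule sum.cong[OF refl])
    fix i
    have "(\<Prod>k\<in>UNIV. (\<chi> k. if k = i then (A ** W t) $ i else W t $ k) $ k $ p k) = ?d p i" for p
      by (subst prod.remove[of _ i]) auto
    then show "(\<Sum>p | p permutes UNIV. of_int (sign p) * ?d p i)
        = det (\<chi> k. if k = i then (A ** W t) $ i else W t $ k)"
      unfolding det_def by simp
  qed
  also have "\<dots> = trace A * det (W t)"
    by (simp add: det_replace_row_matrix_mult trace_def sum_distrib_right)
  finally show ?thesis .
qed

text \<open>The determinant divided by its claimed value has zero derivative by Jacobi's formula and
  equals 1 at time zero. The resulting positivity removes the absolute value in the change of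
  variables.\<close>

lemma Liouville_formula:
  fixes A W :: "real \<Rightarrow> real^'n^'n"
  assumes cA: "continuous_on {0..T} A" and cW: "\<And>h. continuous_on {0..T} (\<lambda>t. W t *v h)"
    and eq: "\<And>t h. t \<in> {0..T} \<Longrightarrow> W t *v h = h + integral {0..t} (\<lambda>s. A s *v (W s *v h))"
    and t: "t \<in> {0..T}"
  shows "det (W t) = exp (integral {0..t} (\<lambda>s. trace (A s)))"
proof -
  have ent: "W s $ i $ j = (W s *v axis j 1) $ i" for s i j
    by (simp add: matrix_vector_mult_basis column_def)
  have dW: "((\<lambda>t. W t $ i $ j) has_real_derivative (A s ** W s) $ i $ j) (at s within {0..T})"
    if s: "s \<in> {0..T}" for s i j
  proof -
    have "((\<lambda>t. integral {0..t} (\<lambda>s. A s *v (W s *v axis j 1)))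
        has_vector_derivative A s *v (W s *v axis j 1)) (at s within {0..T})"
      by (intro integral_has_vector_derivative[OF _ s] continuous_intros cA cW)
    then have "((\<lambda>t. axis j 1 + integral {0..t} (\<lambda>s. A s *v (W s *v axis j 1)))
        has_vector_derivative A s *v (W s *v axis j 1)) (at s within {0..T})"
      by (auto intro!: derivative_eq_intros)
    then have "((\<lambda>t. W t *v axis j 1) has_vector_derivative A s *v (W s *v axis j 1)) (at s within {0..T})"
      by (rule has_vector_derivative_transform[OF s, rotated]) (rule eq)
    then have "((\<lambda>t. (W t *v axis j 1) $ i) has_vector_derivative (A s *v (W s *v axis j 1)) $ i) (at s within {0..T})"
      by (rule bounded_linear.has_vector_derivative[OF bounded_linear_vec_nth])
    moreover have "(A s *v (W s *v axis j 1)) $ i = (A s ** W s) $ i $ j"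
      by (simp only: matrix_vector_mult_basis column_def)
        (simp add: matrix_vector_mult_def matrix_matrix_mult_def)
    ultimately show ?thesis
      by (simp only: ent[symmetric] has_real_derivative_iff_has_vector_derivative)
  qed
  define E where "E s = det (W s) * exp (- integral {0..s} (\<lambda>s. trace (A s)))" for s
  have ctr: "continuous_on {0..T} (\<lambda>s. trace (A s))"
    unfolding trace_def by (intro continuous_intros cA)
  have "(E has_real_derivative 0) (at s within {0..T})" if s: "s \<in> {0..T}" for s
    unfolding E_def
    by (rule derivative_eq_intros det_has_derivative_Jacobi dW[OF s] integral_has_real_derivative[OF ctr s] refl)+
      (simp add: algebra_simps)
  then have "\<exists>c. \<forall>s\<in>{0..T}. E s = c"
    by (intro has_field_derivative_zero_constant) auto
  then have "E t = E 0" using t by fastforce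
  moreover have "W 0 = mat 1"
    using eq[of 0] t by (simp add: matrix_eq)
  ultimately show ?thesis
    by (simp add: E_def exp_minus field_simps)
qed

section \<open>Joint continuity of the flow and change of variables\<close>

text \<open>The stability constant is uniform in time, so continuity in \<open>t\<close> of a single
  path and continuity in \<open>x\<close> combine. Joint continuity makes path integrals such as
  that of \<open>div m\<close> continuous in the starting point.\<close>

lemma flow_continuous:
  fixes F :: "'a::euclidean_space \<Rightarrow> 'a"
  assumes F: "loc_lipschitz F" and \<phi>: "\<And>x. ode_path F \<beta> x (\<lambda>t. \<phi> t x)"
  shows "continuous_on (UNIV \<times> {0..T}) (\<lambda>(x, t). \<phi> t x)"
  unfolding continuous_on_iff
proof (intro ballI allI impI)
  fix z :: "'a \<times> real" and e :: real assume z: "z \<in> UNIV \<times> {0..T}" and e: "0 < e"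
  obtain x t where xt: "z = (x, t)" and t: "0 \<le> t" "t \<le> T" using z by auto
  obtain C \<delta> where C: "C > 0" "\<delta> > 0"
    "\<And>y \<psi> t. ode_path F \<beta> y \<psi> \<Longrightarrow> dist y x \<le> \<delta> \<Longrightarrow> t \<in> {0..T} \<Longrightarrow>
      dist (\<psi> t) (\<phi> t x) \<le> C * dist y x"
    using ode_path_stability[OF F \<phi>[of x] order_trans[OF t]] by blast
  have "continuous_on {0..T} (\<lambda>t. \<phi> t x)"
    using \<phi>[of x] by (auto simp: ode_path_def intro: continuous_on_subset)
  then have "\<exists>d>0. \<forall>s\<in>{0..T}. dist s t < d \<longrightarrow> dist (\<phi> s x) (\<phi> t x) < e / 2"
    unfolding continuous_on_iff using t e
    by (metis (no_types, lifting) atLeastAtMost_iff half_gt_zero)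
  then obtain d where d: "d > 0" "\<And>s. s \<in> {0..T} \<Longrightarrow> dist s t < d \<Longrightarrow> dist (\<phi> s x) (\<phi> t x) < e / 2"
    by blast
  have "dist (\<phi> s y) (\<phi> t x) < e"
    if s: "0 \<le> s" "s \<le> T" and near: "dist (y, s) (x, t) < min d (min \<delta> (e / (2 * C)))" for y s
  proof -
    have "dist y x \<le> dist (y, s) (x, t)" "dist s t \<le> dist (y, s) (x, t)"
      using dist_fst_le[of "(y, s)" "(x, t)"] dist_snd_le[of "(y, s)" "(x, t)"] by auto
    then have ds: "dist s t < d" and dy: "dist y x \<le> \<delta>" "dist y x < e / (2 * C)" using near by auto
    have "dist (\<phi> s y) (\<phi> s x) \<le> C * dist y x" using C(3)[OF \<phi>[of y] dy(1), of s] s by simp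
    also have "\<dots> < e / 2" using dy(2) C(1) by (simp add: field_simps)
    finally show ?thesis
      using d(2)[of s] ds s dist_triangle[of "\<phi> s y" "\<phi> t x" "\<phi> s x"] by auto
  qed
  then show "\<exists>d>0. \<forall>z'\<in>UNIV \<times> {0..T}. dist z' z < d \<longrightarrow>
      dist (case z' of (x, t) \<Rightarrow> \<phi> t x) (case z of (x, t) \<Rightarrow> \<phi> t x) < e"
    using d(1) C(1,2) e unfolding xt by (intro exI[of _ "min d (min \<delta> (e / (2 * C)))"]) auto
qed

lemma flow_continuous_initial:
  fixes F :: "'a::euclidean_space \<Rightarrow> 'a"
  assumes "loc_lipschitz F" "\<And>x. ode_path F \<beta> x (\<lambda>t. \<phi> t x)" "0 \<le> t"
  shows "continuous_on S (\<phi> t)"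
proof -
  have "continuous_on S (\<lambda>x. (x, t))" "(\<lambda>x. (x, t)) ` S \<subseteq> UNIV \<times> {0..t}"
    using assms(3) by (auto intro!: continuous_intros)
  from continuous_on_compose2[OF flow_continuous[OF assms(1,2)] this] show ?thesis by simp
qed

lemma flow_integral_continuous:
  fixes F :: "'a::euclidean_space \<Rightarrow> 'a" and g :: "'a \<Rightarrow> real"
  assumes "loc_lipschitz F" "\<And>x. ode_path F \<beta> x (\<lambda>t. \<phi> t x)" and g: "continuous_on UNIV g"
  shows "continuous_on S (\<lambda>x. integral {0..t} (\<lambda>s. g (\<phi> s x)))"
proof -
  have "continuous_on (S \<times> {0..t}) (\<lambda>(x, s). \<phi> s x)"
    by (rule continuous_on_subset[OF flow_continuous[OF assms(1,2), of t]]) auto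
  then have "continuous_on (S \<times> cbox 0 t) (\<lambda>(x, s). g (\<phi> s x))"
    using continuous_on_compose2[OF g, of _ "\<lambda>(x, s). \<phi> s x"] by (simp add: case_prod_beta')
  then show ?thesis using integral_continuous_on_param by fastforce
qed

text \<open>Bridge between the gauge integral over a set, in which the theorem is stated, and the
  Lebesgue integral, on which Tonelli's theorem acts.\<close>

lemma compact_continuous_has_integral:
  fixes f :: "'a::euclidean_space \<Rightarrow> real"
  assumes "compact S" "continuous_on S f"
  shows "(f has_integral (LINT x|lborel. indicator S x *\<^sub>R f x)) S"
proof -
  have "((\<lambda>x. indicator S x *\<^sub>R f x) has_integral (LINT x|lborel. indicator S x *\<^sub>R f x)) UNIV"
    using borel_integrable_compact[OF assms] by (rule has_integral_integral_lborel)
  moreover have "(\<lambda>x. indicator S x *\<^sub>R f x) = (\<lambda>x. if x \<in> S then f x else 0)" by auto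
  ultimately show ?thesis by (simp only: has_integral_restrict_UNIV)
qed

text \<open>An upper bound is all that is wanted, so the one-sided change of variables, valid also
  for maps that are not injective, suffices. The Jacobian is supplied by
  \<open>flow_has_derivative\<close> and \<open>Liouville_formula\<close>.\<close>

lemma flow_integral_image_le_wellorder:
  fixes F :: "real^'n::{finite,wellorder} \<Rightarrow> real^'n::_" and u :: "real^'n::_ \<Rightarrow> real"
  assumes der: "\<And>x. (F has_derivative (\<lambda>h. J x *v h)) (at x)" and J: "loc_lipschitz J"
    and \<phi>: "\<And>x. ode_path F \<beta> x (\<lambda>t. \<phi> t x)" and t: "0 \<le> t"
    and A: "compact A" and u: "continuous_on UNIV u" "\<And>x. 0 \<le> u x"
  shows "integral (\<phi> t ` A) u \<le> integral A (\<lambda>x. exp (integral {0..t} (\<lambda>s. trace (J (\<phi> s x)))) * u (\<phi> t x))"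
proof -
  have F: "loc_lipschitz F" by (rule C11_loc_lipschitz[OF der J])
  have "\<exists>W. (\<phi> t has_derivative (\<lambda>h. W *v h)) (at x) \<and> det W = exp (integral {0..t} (\<lambda>s. trace (J (\<phi> s x))))" for x
  proof -
    obtain W where W: "\<And>h. continuous_on {0..t} (\<lambda>t. W t *v h)"
      "\<And>s. s \<in> {0..t} \<Longrightarrow> (\<phi> s has_derivative (\<lambda>h. W s *v h)) (at x)"
      "\<And>s h. s \<in> {0..t} \<Longrightarrow> W s *v h = h + integral {0..s} (\<lambda>s. J (\<phi> s x) *v (W s *v h))"
      using flow_has_derivative[OF der J \<phi> t, of x] by blast
    have "continuous_on {0..t} (\<lambda>t. \<phi> t x)"
      using \<phi>[of x] by (auto simp: ode_path_def intro: continuous_on_subset)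
    then have "continuous_on {0..t} (\<lambda>t. J (\<phi> t x))"
      by (auto intro!: continuous_on_compose2[OF loc_lipschitz_continuous_on[OF J, of UNIV]])
    then have "det (W t) = exp (integral {0..t} (\<lambda>s. trace (J (\<phi> s x))))"
      using t by (intro Liouville_formula[OF _ W(1,3)]) auto
    then show ?thesis using W(2)[of t] t by auto
  qed
  then have "\<forall>x. \<exists>W. (\<phi> t has_derivative (\<lambda>h. W *v h)) (at x) \<and> det W = exp (integral {0..t} (\<lambda>s. trace (J (\<phi> s x))))"
    by blast
  from choice[OF this] obtain W where W: "\<And>x. (\<phi> t has_derivative (\<lambda>h. W x *v h)) (at x)"
    and det: "\<And>x. det (W x) = exp (integral {0..t} (\<lambda>s. trace (J (\<phi> s x))))"
    by blast
  have ctr: "continuous_on UNIV (\<lambda>y. trace (J y))"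
    unfolding trace_def by (intro continuous_intros loc_lipschitz_continuous_on[OF J])
  have cont: "continuous_on A (\<lambda>x. exp (integral {0..t} (\<lambda>s. trace (J (\<phi> s x)))) * u (\<phi> t x))"
    by (intro continuous_intros flow_integral_continuous[OF F \<phi> ctr]
        continuous_on_compose2[OF u(1) flow_continuous_initial[OF F \<phi> t]]) auto
  have "integral (\<phi> t ` A) u \<le> integral A (\<lambda>x. \<bar>det (matrix (\<lambda>h. W x *v h))\<bar> * u (\<phi> t x))"
  proof (rule integral_on_image_ubound)
    show "(\<lambda>x. \<bar>det (matrix (\<lambda>h. W x *v h))\<bar> * u (\<phi> t x)) integrable_on A"
      using compact_continuous_has_integral[OF A cont] by (auto simp: det integrable_on_def)
  qed (use u W in \<open>auto intro: has_derivative_at_withinI\<close>)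
  then show ?thesis by (simp add: det)
qed

text \<open>The change of variables theorem of the library requires a well-ordered index type.\<close>
typedef ('n::finite) ordix = "{..<CARD('n)}"
  by (auto intro!: exI[of _ 0])

instantiation ordix :: (finite) linorder
begin
definition less_eq_ordix :: "'a ordix \<Rightarrow> 'a ordix \<Rightarrow> bool" where
  "x \<le> y \<longleftrightarrow> Rep_ordix x \<le> Rep_ordix y"
definition less_ordix :: "'a ordix \<Rightarrow> 'a ordix \<Rightarrow> bool" where
  "x < y \<longleftrightarrow> Rep_ordix x < Rep_ordix y"
instance
  by standard (auto simp: less_eq_ordix_def less_ordix_def Rep_ordix_inject)
end

instance ordix :: (finite) finite
proof
  have "range (Rep_ordix :: 'a ordix \<Rightarrow> nat) \<subseteq> {..<CARD('a)}" using Rep_ordix by auto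
  then show "finite (UNIV :: 'a ordix set)"
    by (metis finite_lessThan finite_subset finite_imageD Rep_ordix_inject injI)
qed

instance ordix :: (finite) wellorder
proof
  fix P :: "'a ordix \<Rightarrow> bool" and a
  assume step: "\<And>x. (\<And>y. y < x \<Longrightarrow> P y) \<Longrightarrow> P x"
  show "P a"
    by (induction a rule: measure_induct_rule[of Rep_ordix]) (auto intro: step simp: less_ordix_def)
qed

lemma card_ordix: "CARD('n ordix) = CARD('n::finite)"
  using type_definition.card[OF type_definition_ordix[where 'n = 'n]] by simp

lemma ex_ordix_bij: "\<exists>f :: 'n::finite ordix \<Rightarrow> 'n. bij f"
  using finite_same_card_bij[of "UNIV :: 'n ordix set" "UNIV :: 'n set"] card_ordix by auto

section \<open>Transfer between index types by relabelling coordinates\<close>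

lemma reindex_image_cbox:
  fixes g :: "'k::finite \<Rightarrow> 'l::finite"
  assumes "bij g"
  shows "(\<lambda>x::real^'l. \<chi> i. x $ g i) ` cbox a b = cbox (\<chi> i. a $ g i) (\<chi> i. b $ g i)"
proof -
  have inv: "inv g (g k) = k" "g (inv g l) = l" for k l
    using assms by (auto simp: bij_def surj_f_inv_f)
  show ?thesis
  proof (intro equalityI subsetI)
    fix y assume y: "y \<in> cbox (\<chi> i. a $ g i) (\<chi> i. b $ g i)"
    have "(\<chi> l. y $ inv g l) \<in> cbox a b"
      unfolding mem_box_cart
    proof
      fix l show "a $ l \<le> (\<chi> l. y $ inv g l) $ l \<and> (\<chi> l. y $ inv g l) $ l \<le> b $ l"
        using y[unfolded mem_box_cart, rule_format, of "inv g l"] by (simp add: inv)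
    qed
    then show "y \<in> (\<lambda>x. \<chi> i. x $ g i) ` cbox a b"
      by (intro image_eqI[of _ _ "\<chi> l. y $ inv g l"]) (simp_all add: inv vec_eq_iff)
  qed (auto simp: mem_box_cart)
qed

lemma content_reindex_cbox:
  fixes g :: "'k::finite \<Rightarrow> 'l::finite" and a b :: "real^'l"
  assumes "bij g"
  shows "measure lborel (cbox (\<chi> i. a $ g i) (\<chi> i. b $ g i)) = measure lborel (cbox a b)"
proof -
  have "(\<Prod>i\<in>UNIV. b $ g i - a $ g i) = (\<Prod>i\<in>UNIV. b $ i - a $ i)"
    using assms by (rule prod.reindex_bij_betw)
  moreover have "cbox (\<chi> i. a $ g i) (\<chi> i. b $ g i) = {} \<longleftrightarrow> cbox a b = {}"
    using reindex_image_cbox[OF assms, of a b] by (metis image_is_empty)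
  ultimately show ?thesis by (simp add: content_cbox_if_cart)
qed

text \<open>Relabelling maps boxes to boxes of equal content in both directions, so gauge integrals
  transform with factor 1. The transformation rule works on a box; hence the bounded set is enclosed
  in one and the integrand extended by zero.\<close>

lemma has_integral_reindex:
  fixes g :: "'k::finite \<Rightarrow> 'l::finite" and f :: "real^'l \<Rightarrow> real"
  assumes g: "bij g" and S: "bounded S" and f: "(f has_integral i) S"
  shows "((\<lambda>y. f (\<chi> l. y $ inv g l)) has_integral i) ((\<lambda>x. \<chi> k. x $ g k) ` S)"
proof -
  define P where "P = (\<lambda>x::real^'l. \<chi> k. x $ g k)"
  define Q where "Q = (\<lambda>y::real^'k. \<chi> l. y $ inv g l)"
  have inv: "inv g (g k) = k" "g (inv g l) = l" for k l
    using g by (auto simp: bij_def surj_f_inv_f)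
  have PQ: "P (Q y) = y" "Q (P x) = x" for x y by (simp_all add: P_def Q_def inv)
  have Q: "bounded_linear Q"
    unfolding linear_conv_bounded_linear[symmetric] by (rule linearI) (simp_all add: Q_def vec_eq_iff)
  have g': "bij (inv g)" using g by (rule bij_imp_bij_inv)
  obtain a where a: "S \<subseteq> cbox (- a) a"
    using bounded_subset_cbox_symmetric[OF S] by blast
  have "((\<lambda>x. if x \<in> S then f x else 0) has_integral i) (cbox (- a) a)"
    using f a has_integral_restrict by blast
  then have "((\<lambda>y. if Q y \<in> S then f (Q y) else 0) has_integral (1/1) *\<^sub>R i) (P ` cbox (- a) a)"
  proof (rule has_integral_twiddle[where g = Q and h = P and r = 1 and f = "\<lambda>x. if x \<in> S then f x else 0", rotated -1])
    fix u v
    show "\<exists>w z. Q ` cbox u v = cbox w z" "\<exists>w z. P ` cbox u' v' = cbox w z" for u' v'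
      unfolding P_def Q_def reindex_image_cbox[OF g] reindex_image_cbox[OF g'] by blast+
    show "measure lborel (Q ` cbox u v) = 1 * measure lborel (cbox u v)"
      unfolding Q_def reindex_image_cbox[OF g'] content_reindex_cbox[OF g'] by simp
    show "isCont Q x" for x
      by (rule linear_continuous_at[OF Q])
  qed (simp_all add: PQ)
  moreover have "Q y \<in> S \<longleftrightarrow> y \<in> P ` S" for y by (auto simp: PQ intro!: image_eqI[of y P "Q y"])
  ultimately have "((\<lambda>y. if y \<in> P ` S then f (Q y) else 0) has_integral i) (P ` cbox (- a) a)"
    by simp
  then have "((\<lambda>y. f (Q y)) has_integral i) (P ` S)"
    by (simp only: has_integral_restrict[OF image_mono[OF a]])
  then show ?thesis by (simp add: P_def Q_def)
qed

text \<open>Field, Jacobian, forcing and flow are conjugated by a relabelling of coordinates, the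
  estimate is applied over the well-ordered index type, and the result is carried back. Relabelling
  rows and columns simultaneously preserves the trace, hence the exponent.\<close>

lemma flow_integral_image_le:
  fixes F :: "real^'n \<Rightarrow> real^'n" and u :: "real^'n \<Rightarrow> real"
  assumes der: "\<And>x. (F has_derivative (\<lambda>h. J x *v h)) (at x)" and J: "loc_lipschitz J"
    and \<phi>: "\<And>x. ode_path F \<beta> x (\<lambda>t. \<phi> t x)" and t: "0 \<le> t"
    and A: "compact A" and u: "continuous_on UNIV u" "\<And>x. 0 \<le> u x"
  shows "integral (\<phi> t ` A) u \<le> integral A (\<lambda>x. exp (integral {0..t} (\<lambda>s. trace (J (\<phi> s x)))) * u (\<phi> t x))"
proof -
  obtain g :: "'n ordix \<Rightarrow> 'n" where g: "bij g" using ex_ordix_bij by blast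
  have inv: "inv g (g k) = k" "g (inv g l) = l" for k l
    using g by (auto simp: bij_def surj_f_inv_f)
  define P where "P = (\<lambda>x::real^'n. \<chi> k. x $ g k)"
  define Q where "Q = (\<lambda>y::real^'n ordix. \<chi> l. y $ inv g l)"
  define P2 where "P2 = (\<lambda>B::real^'n^'n. \<chi> k l. B $ g k $ g l)"
  have PQ: "P (Q y) = y" "Q (P x) = x" for x y by (simp_all add: P_def Q_def inv)
  have P: "bounded_linear P"
    unfolding linear_conv_bounded_linear[symmetric] by (rule linearI) (simp_all add: P_def vec_eq_iff)
  have Q: "bounded_linear Q"
    unfolding linear_conv_bounded_linear[symmetric] by (rule linearI) (simp_all add: Q_def vec_eq_iff)
  have P2: "bounded_linear P2"
    unfolding linear_conv_bounded_linear[symmetric] by (rule linearI) (simp_all add: P2_def vec_eq_iff)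
  define F' where "F' = (\<lambda>y. P (F (Q y)))"
  define J' where "J' = (\<lambda>y. P2 (J (Q y)))"
  define \<phi>' where "\<phi>' = (\<lambda>t y. P (\<phi> t (Q y)))"
  have F: "loc_lipschitz F" by (rule C11_loc_lipschitz[OF der J])
  have P2v: "P2 B *v h = P (B *v Q h)" for B h
    using g by (auto simp: vec_eq_iff P2_def P_def Q_def matrix_vector_mult_def inv
      intro!: sum.reindex_bij_witness[of _ "inv g" g])
  have der': "(F' has_derivative (\<lambda>h. J' y *v h)) (at y)" for y
  proof -
    have "((\<lambda>y. P (F (Q y))) has_derivative (\<lambda>h. P (J (Q y) *v Q h))) (at y)"
      by (intro bounded_linear.has_derivative[OF P] has_derivative_compose[OF _ der]
          bounded_linear_imp_has_derivative[OF Q])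
    then show ?thesis by (simp add: F'_def J'_def P2v)
  qed
  have "loc_lipschitz J'"
    unfolding loc_lipschitz_def
  proof (intro allI impI)
    fix K :: "(real^'n ordix) set" assume "compact K"
    then have "compact (Q ` K)"
      by (intro compact_continuous_image bounded_linear.continuous_on[OF Q] continuous_intros)
    then obtain L where L: "L-lipschitz_on (Q ` K) J" using J by (auto simp: loc_lipschitz_def)
    obtain k1 where k1: "k1-lipschitz_on K Q" using bounded_linear.lipschitz_boundE[OF Q] by blast
    obtain k2 where k2: "k2-lipschitz_on (J ` Q ` K) P2" using bounded_linear.lipschitz_boundE[OF P2] by blast
    have "(k2 * (L * k1))-lipschitz_on K (\<lambda>y. P2 (J (Q y)))"
      by (intro lipschitz_on_compose2[of "L * k1" K "\<lambda>y. J (Q y)"] lipschitz_on_compose2[of k1 K Q] k1 L k2[unfolded image_image])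
    then show "\<exists>L. L-lipschitz_on K J'" unfolding J'_def by blast
  qed
  moreover have "ode_path F' (\<lambda>t. P (\<beta> t)) y (\<lambda>t. \<phi>' t y)" for y
    unfolding ode_path_def
  proof (intro conjI allI impI)
    have cont: "continuous_on {0..} (\<lambda>t. \<phi> t (Q y))" using \<phi>[of "Q y"] by (simp add: ode_path_def)
    then show "continuous_on {0..} (\<lambda>t. \<phi>' t y)"
      unfolding \<phi>'_def by (rule bounded_linear.continuous_on[OF P])
    fix t :: real assume t: "0 \<le> t"
    have "continuous_on {0..t} (\<lambda>s. F (\<phi> s (Q y)))"
      by (intro continuous_on_compose2[OF loc_lipschitz_continuous_on[OF F, of UNIV]] continuous_on_subset[OF cont]) auto
    then have "integral {0..t} (\<lambda>s. P (F (\<phi> s (Q y)))) = P (integral {0..t} (\<lambda>s. F (\<phi> s (Q y))))"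
      using integral_linear[OF integrable_continuous_interval P] by (simp add: o_def)
    moreover have "\<phi> t (Q y) = Q y + \<beta> t + integral {0..t} (\<lambda>s. F (\<phi> s (Q y)))"
      using \<phi>[of "Q y"] t by (simp add: ode_path_def)
    ultimately show "\<phi>' t y = y + P (\<beta> t) + integral {0..t} (\<lambda>s. F' (\<phi>' s y))"
      by (simp add: \<phi>'_def F'_def PQ bounded_linear.linear[OF P, THEN linear_add])
  qed
  moreover have "compact (P ` A)"
    using A by (intro compact_continuous_image bounded_linear.continuous_on[OF P] continuous_intros)
  moreover have "continuous_on UNIV (\<lambda>y. u (Q y))"
    by (intro continuous_on_compose2[OF u(1)] bounded_linear.continuous_on[OF Q] continuous_intros) auto
  ultimately have main: "integral (\<phi>' t ` P ` A) (\<lambda>y. u (Q y))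
      \<le> integral (P ` A) (\<lambda>y. exp (integral {0..t} (\<lambda>s. trace (J' (\<phi>' s y)))) * u (Q (\<phi>' t y)))"
    using flow_integral_image_le_wellorder[OF der', of "\<lambda>t. P (\<beta> t)" \<phi>' t "P ` A" "\<lambda>y. u (Q y)"] t u by blast
  have tr: "trace (P2 B) = trace B" for B
    unfolding trace_def P2_def using g by (simp add: sum.reindex_bij_betw[of g UNIV UNIV "\<lambda>i. B $ i $ i"])
  define v where "v = (\<lambda>x. exp (integral {0..t} (\<lambda>s. trace (J (\<phi> s x)))) * u (\<phi> t x))"
  have ctr: "continuous_on UNIV (\<lambda>y. trace (J y))"
    unfolding trace_def by (intro continuous_intros loc_lipschitz_continuous_on[OF J])
  have c\<phi>: "continuous_on A (\<phi> t)" by (rule flow_continuous_initial[OF F \<phi> t])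
  have cv: "continuous_on A v" unfolding v_def
    by (intro continuous_intros flow_integral_continuous[OF F \<phi> ctr]
        continuous_on_compose2[OF u(1) c\<phi>]) auto
  have tra: "integral (P ` S) (\<lambda>y. f (Q y)) = integral S f" if "compact S" "continuous_on S f"
    for S and f :: "real^'n \<Rightarrow> real"
    using integral_unique[OF has_integral_reindex[OF g compact_imp_bounded[OF that(1)]
        compact_continuous_has_integral[OF that]]]
      integral_unique[OF compact_continuous_has_integral[OF that]]
    by (simp only: P_def Q_def)
  have "integral (P ` \<phi> t ` A) (\<lambda>y. u (Q y)) = integral (\<phi> t ` A) u"
    by (intro tra compact_continuous_image c\<phi> A continuous_on_subset[OF u(1)]) auto
  moreover have "\<phi>' t ` P ` A = P ` \<phi> t ` A" by (simp add: image_image \<phi>'_def PQ)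
  moreover have "(\<lambda>y. exp (integral {0..t} (\<lambda>s. trace (J' (\<phi>' s y)))) * u (Q (\<phi>' t y))) = (\<lambda>y. v (Q y))"
    by (simp add: v_def J'_def \<phi>'_def PQ tr)
  moreover have "integral (P ` A) (\<lambda>y. v (Q y)) = integral A v" by (rule tra[OF A cv])
  ultimately show ?thesis using main unfolding v_def by simp
qed

section \<open>Euler scheme and Taylor expansion\<close>

text \<open>\<open>y k\<close> is the noise increment of the step. The state space is abstract so
  that the scheme also runs on pairs of position and logarithmic weight.\<close>

primrec euler :: "('a::real_vector \<Rightarrow> 'a) \<Rightarrow> real \<Rightarrow> 'a \<Rightarrow> (nat \<Rightarrow> 'a) \<Rightarrow> nat \<Rightarrow> 'a" where
  "euler F h x y 0 = x"
| "euler F h x y (Suc k) = euler F h x y k + h *\<^sub>R F (euler F h x y k) + y k"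

lemma ode_path_increment:
  assumes F: "loc_lipschitz F" and \<phi>: "ode_path F \<beta> x \<phi>" and s: "0 \<le> s" "s \<le> t"
  shows "\<phi> t - \<phi> s = \<beta> t - \<beta> s + integral {s..t} (\<lambda>r. F (\<phi> r))"
proof -
  have "continuous_on {0..t} \<phi>" using \<phi> by (auto simp: ode_path_def intro: continuous_on_subset)
  then have "continuous_on {0..t} (\<lambda>r. F (\<phi> r))"
    by (auto intro!: continuous_on_compose2[OF loc_lipschitz_continuous_on[OF F, of UNIV]])
  then have "integral {0..s} (\<lambda>r. F (\<phi> r)) + integral {s..t} (\<lambda>r. F (\<phi> r)) = integral {0..t} (\<lambda>r. F (\<phi> r))"
    using s by (intro Henstock_Kurzweil_Integration.integral_combine integrable_continuous_interval) auto
  moreover have "\<phi> t = x + \<beta> t + integral {0..t} (\<lambda>s. F (\<phi> s))" "\<phi> s = x + \<beta> s + integral {0..s} (\<lambda>s. F (\<phi> s))"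
    using \<phi> s unfolding ode_path_def by auto
  ultimately show ?thesis by (simp add: algebra_simps)
qed

text \<open>The noise increments of scheme and path agree and cancel in the error; only the drift is
  discretised. Each step contributes at most \<open>h * L\<close> times the oscillation of
  \<open>\<phi>\<close> over one step, which is small by uniform continuity. No rate results, but
  the bound is uniform over the grid points up to \<open>T\<close>.\<close>

lemma euler_converges:
  fixes F :: "'a::euclidean_space \<Rightarrow> 'a"
  assumes F: "loc_lipschitz F" and \<phi>: "ode_path F \<beta> x \<phi>" and \<beta>: "\<beta> 0 = 0"
    and T: "0 \<le> T" and \<epsilon>: "0 < \<epsilon>"
  obtains \<delta> where "\<delta> > 0"
    "\<And>h k. 0 < h \<Longrightarrow> h \<le> \<delta> \<Longrightarrow> real k * h \<le> T \<Longrightarrow>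
       dist (euler F h x (\<lambda>j. \<beta> (real (Suc j) * h) - \<beta> (real j * h)) k) (\<phi> (real k * h)) \<le> \<epsilon>"
proof -
  obtain R where R: "R > 0" "\<And>t. t \<in> {0..T} \<Longrightarrow> norm (\<phi> t) \<le> R"
    using ode_path_bounded[OF \<phi>] by blast
  obtain L where L: "L-lipschitz_on (cball 0 (R + 1)) F"
    using F compact_cball unfolding loc_lipschitz_def by blast
  have L0: "0 \<le> L" using L by (rule lipschitz_on_nonneg)
  define D where "D = (L * T + 1) * exp (L * T)"
  have D0: "0 < D" using L0 T by (simp add: D_def add_nonneg_pos)
  \<comment> \<open>The error accumulated up to time \<open>T\<close> is at most
    \<open>D * \<eta>\<close>. The minimum with 1 keeps the scheme within distance 1 of the path,
    where \<open>L\<close> is valid; the \<open>+ 1\<close> in \<open>D\<close> makes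
    \<open>D\<close> positive even if \<open>L * T = 0\<close>.\<close>
  define \<eta> where "\<eta> = min \<epsilon> 1 / D"
  have \<eta>: "0 < \<eta>" using \<epsilon> D0 by (simp add: \<eta>_def)
  have "uniformly_continuous_on {0..T} \<phi>"
    using \<phi> by (intro compact_uniformly_continuous) (auto simp: ode_path_def intro: continuous_on_subset)
  then obtain \<delta> where \<delta>: "\<delta> > 0" "\<And>s t. s \<in> {0..T} \<Longrightarrow> t \<in> {0..T} \<Longrightarrow> dist s t < \<delta> \<Longrightarrow> dist (\<phi> s) (\<phi> t) < \<eta>"
    unfolding uniformly_continuous_on_def using \<eta> by (metis dist_commute)
  have main: "dist (euler F h x (\<lambda>j. \<beta> (real (Suc j) * h) - \<beta> (real j * h)) k) (\<phi> (real k * h)) \<le> min \<epsilon> 1"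
    if h: "0 < h" "h \<le> \<delta> / 2" and k: "real k * h \<le> T" for h k
  proof -
    define e where "e = euler F h x (\<lambda>j. \<beta> (real (Suc j) * h) - \<beta> (real j * h))"
    define q where "q = 1 + h * L"
    have q1: "1 \<le> q" using h L0 by (simp add: q_def)
    have c0: "0 \<le> h * L * \<eta>" using h L0 \<eta> by simp
    have fin: "real k * (h * L * \<eta>) * q ^ k \<le> min \<epsilon> 1" if k: "real k * h \<le> T" for k
    proof -
      have "q \<le> exp (h * L)" unfolding q_def by (rule exp_ge_add_one_self)
      then have "q ^ k \<le> exp (h * L) ^ k" using q1 by (intro power_mono) auto
      also have "\<dots> = exp ((real k * h) * L)" by (simp add: exp_of_nat_mult[symmetric] mult_ac)
      also have "\<dots> \<le> exp (T * L)" using k L0 by (auto intro: mult_right_mono)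
      finally have qk: "q ^ k \<le> exp (L * T)" by (simp add: mult.commute)
      have kh: "real k * (h * L * \<eta>) \<le> (L * T + 1) * \<eta>"
      proof -
        have "real k * (h * L * \<eta>) = (real k * h) * L * \<eta>" by simp
        also have "\<dots> \<le> T * L * \<eta>" using k L0 \<eta> by (intro mult_right_mono) auto
        also have "\<dots> \<le> (L * T + 1) * \<eta>" using \<eta> by (intro mult_right_mono) (auto simp: mult.commute)
        finally show ?thesis .
      qed
      have "real k * (h * L * \<eta>) * q ^ k \<le> ((L * T + 1) * \<eta>) * exp (L * T)"
        by (rule mult_mono[OF kh qk]) (use q1 L0 T \<eta> in auto)
      also have "\<dots> = D * \<eta>" by (simp add: D_def)
      also have "\<dots> = min \<epsilon> 1" using D0 by (simp add: \<eta>_def)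
      finally show ?thesis .
    qed
    \<comment> \<open>The geometric sum of a discrete Gronwall argument is replaced by
      \<open>k\<close> equal terms with the power \<open>q ^ k\<close>; the induction closes because
      \<open>q\<close> is at least 1.\<close>
    have "norm (e k - \<phi> (real k * h)) \<le> real k * (h * L * \<eta>) * q ^ k" using k
    proof (induction k)
      case 0
      have "\<phi> 0 = x" using \<phi> \<beta> by (auto simp: ode_path_def)
      then show ?case by (simp add: e_def)
    next
      case (Suc k)
      define s t where "s = real k * h" and "t = real (Suc k) * h"
      have st: "0 \<le> s" "s \<le> t" "t \<le> T" "t = s + h" using h Suc.prems by (auto simp: s_def t_def algebra_simps)
      have IH: "norm (e k - \<phi> s) \<le> real k * (h * L * \<eta>) * q ^ k"
        using Suc.IH st by (simp add: s_def)
      also have "\<dots> \<le> 1" using fin[of k] st by (simp add: s_def)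
      finally have le1: "norm (e k - \<phi> s) \<le> 1" .
      have inb: "\<phi> r \<in> cball 0 (R + 1)" if "r \<in> {s..t}" for r
        using R(2)[of r] st that by auto
      have "norm (e k) \<le> R + 1"
        using le1 R(2)[of s] st norm_triangle_sub[of "e k" "\<phi> s"] by auto
      then have eb: "e k \<in> cball 0 (R + 1)" by simp
      have cont: "continuous_on {s..t} (\<lambda>r. F (\<phi> r))"
      proof -
        have "continuous_on {s..t} \<phi>" using \<phi> st by (auto simp: ode_path_def intro: continuous_on_subset)
        then show ?thesis by (auto intro!: continuous_on_compose2[OF loc_lipschitz_continuous_on[OF F, of UNIV]])
      qed
      have "integral {s..t} (\<lambda>r. F (\<phi> s) - F (\<phi> r)) = h *\<^sub>R F (\<phi> s) - integral {s..t} (\<lambda>r. F (\<phi> r))"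
        using st h integral_diff[OF integrable_const_ivl integrable_continuous_interval[OF cont], of "F (\<phi> s)"]
        by simp
      then have "e (Suc k) - \<phi> t = (e k - \<phi> s) + h *\<^sub>R (F (e k) - F (\<phi> s)) + integral {s..t} (\<lambda>r. F (\<phi> s) - F (\<phi> r))"
        using ode_path_increment[OF F \<phi> st(1,2)]
        by (simp add: e_def s_def t_def algebra_simps)
      also have "norm \<dots> \<le> (norm (e k - \<phi> s) + h * (L * norm (e k - \<phi> s))) + h * L * \<eta>"
      proof (intro norm_triangle_mono order_refl)
        show "norm (h *\<^sub>R (F (e k) - F (\<phi> s))) \<le> h * (L * norm (e k - \<phi> s))"
          using lipschitz_onD[OF L eb inb[of s]] st h by (simp add: dist_norm)
        have "norm (integral {s..t} (\<lambda>r. F (\<phi> s) - F (\<phi> r))) \<le> (L * \<eta>) * (t - s)"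
        proof (rule integral_bound)
          fix r assume r: "r \<in> {s..t}"
          have "norm (F (\<phi> s) - F (\<phi> r)) \<le> L * dist (\<phi> s) (\<phi> r)"
            using lipschitz_onD[OF L inb[of s] inb[OF r]] st by (simp add: dist_norm)
          also have "dist (\<phi> s) (\<phi> r) \<le> \<eta>"
            using \<delta>(2)[of s r] r st h \<delta>(1) by (auto simp: dist_real_def intro: less_imp_le)
          finally show "norm (F (\<phi> s) - F (\<phi> r)) \<le> L * \<eta>" using L0 by (simp add: mult_left_mono)
        qed (rule st(2), intro continuous_intros cont)
        then show "norm (integral {s..t} (\<lambda>r. F (\<phi> s) - F (\<phi> r))) \<le> h * L * \<eta>"
          using st by (simp add: mult_ac)
      qed
      also have "\<dots> = norm (e k - \<phi> s) * q + h * L * \<eta>" by (simp add: q_def algebra_simps)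
      also have "\<dots> \<le> (real k * (h * L * \<eta>) * q ^ k) * q + h * L * \<eta> * q ^ Suc k"
      proof (rule add_mono)
        show "norm (e k - \<phi> s) * q \<le> (real k * (h * L * \<eta>) * q ^ k) * q"
          using IH q1 by (intro mult_right_mono) auto
        show "h * L * \<eta> \<le> h * L * \<eta> * q ^ Suc k"
          using mult_left_mono[OF one_le_power[OF q1, of "Suc k"] c0] by simp
      qed
      also have "\<dots> = real (Suc k) * (h * L * \<eta>) * q ^ Suc k" by (simp add: algebra_simps)
      finally show ?case by (simp add: t_def)
    qed
    also have "\<dots> \<le> min \<epsilon> 1" by (rule fin[OF k])
    finally show ?thesis by (simp add: e_def dist_norm)
  qed
  show ?thesis
    by (rule that[of "\<delta> / 2"]) (use main \<delta> in auto)
qed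

section \<open>Taylor expansion with cubic remainder\<close>

lemma has_derivative_grad:
  fixes z :: "real^'n \<Rightarrow> real"
  assumes "z differentiable (at p)"
  shows "(z has_derivative (\<lambda>v. grad z p \<bullet> v)) (at p)"
proof -
  have D: "(z has_derivative frechet_derivative z (at p)) (at p)"
    using assms frechet_derivative_works by blast
  then have lin: "linear (frechet_derivative z (at p))" by (rule has_derivative_linear)
  have "frechet_derivative z (at p) v = grad z p \<bullet> v" for v
  proof -
    have "frechet_derivative z (at p) v = frechet_derivative z (at p) (\<Sum>i\<in>UNIV. (v $ i) *\<^sub>R axis i 1)"
    proof -
      have "(\<Sum>i\<in>UNIV. (v $ i) *\<^sub>R axis i 1) = v"
        by (simp add: vec_eq_iff sum_component axis_def if_distrib[of "(*) _"] cong: if_cong)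
      then show ?thesis by simp
    qed
    also have "\<dots> = grad z p \<bullet> v"
      by (simp add: linear_sum[OF lin] linear_scale[OF lin] grad_def inner_vec_def mult.commute)
    finally show ?thesis .
  qed
  then have "frechet_derivative z (at p) = (\<lambda>v. grad z p \<bullet> v)" by (rule ext)
  then show ?thesis using D by simp
qed

text \<open>Maclaurin's formula along the segment ends at order two with an intermediate point; the
  Lipschitz Hessian moves that point back to \<open>p\<close> at a cost of order
  \<open>norm v ^ 3\<close>. With increments of size \<open>sqrt h\<close>, this is the source of
  the one-step error \<open>h * sqrt h\<close>.\<close>

lemma C21_Taylor:
  fixes z :: "real^'n \<Rightarrow> real"
  assumes z: "\<And>x. z differentiable (at x)"
    and der: "\<And>x. (grad z has_derivative (\<lambda>h. H x *v h)) (at x)" and H: "loc_lipschitz H"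
  obtains C where "0 \<le> C"
    "\<And>p v. norm p \<le> R \<Longrightarrow> norm v \<le> 1 \<Longrightarrow>
      \<bar>z (p + v) - (z p + grad z p \<bullet> v + (v \<bullet> (H p *v v)) / 2)\<bar> \<le> C * norm v ^ 3"
proof -
  obtain L where L: "L-lipschitz_on (cball 0 (R + 1)) H"
    using H compact_cball unfolding loc_lipschitz_def by blast
  have L0: "0 \<le> L" using L by (rule lipschitz_on_nonneg)
  define C where "C = real CARD('n) * L"
  have C0: "0 \<le> C" using L0 by (simp add: C_def)
  have "\<bar>z (p + v) - (z p + grad z p \<bullet> v + (v \<bullet> (H p *v v)) / 2)\<bar> \<le> C * norm v ^ 3"
    if p: "norm p \<le> R" and v: "norm v \<le> 1" for p v
  proof -
    define f0 where "f0 s = z (p + s *\<^sub>R v)" for s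
    define f1 where "f1 s = grad z (p + s *\<^sub>R v) \<bullet> v" for s
    define f2 where "f2 s = (H (p + s *\<^sub>R v) *v v) \<bullet> v" for s
    have d0: "(f0 has_real_derivative f1 s) (at s)" for s
    proof -
      have "((\<lambda>s. z (p + s *\<^sub>R v)) has_derivative (\<lambda>r. grad z (p + s *\<^sub>R v) \<bullet> (r *\<^sub>R v))) (at s)"
        by (rule has_derivative_compose[OF _ has_derivative_grad[OF z]]) (auto intro!: derivative_eq_intros)
      then show ?thesis unfolding f0_def f1_def has_field_derivative_def
        by (rule has_derivative_eq_rhs) (simp add: fun_eq_iff)
    qed
    have d1: "(f1 has_real_derivative f2 s) (at s)" for s
    proof -
      have "((\<lambda>s. grad z (p + s *\<^sub>R v)) has_derivative (\<lambda>r. H (p + s *\<^sub>R v) *v (r *\<^sub>R v))) (at s)"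
        by (rule has_derivative_compose[OF _ der]) (auto intro!: derivative_eq_intros)
      then have "((\<lambda>s. grad z (p + s *\<^sub>R v) \<bullet> v) has_derivative (\<lambda>r. (H (p + s *\<^sub>R v) *v (r *\<^sub>R v)) \<bullet> v)) (at s)"
        by (rule has_derivative_inner_left)
      then show ?thesis unfolding f1_def f2_def has_field_derivative_def
        by (rule has_derivative_eq_rhs) (simp add: fun_eq_iff matrix_vector_mult_scaleR)
    qed
    \<comment> \<open>Maclaurin's formula asks for a sequence of derivatives; the entries past index
      2 merely repeat \<open>f2\<close> and are never reached.\<close>
    define df where "df = (\<lambda>n::nat. if n = 0 then f0 else if n = 1 then f1 else f2)"
    have "\<exists>t>0. t < 1 \<and> f0 1 = (\<Sum>m<2. df m 0 / fact m * 1 ^ m) + df 2 t / fact 2 * 1 ^ 2"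
      by (rule Maclaurin) (auto simp: df_def d0 d1 less_2_cases_iff)
    then obtain t where t: "0 < t" "t < 1" "f0 1 = f0 0 + f1 0 + f2 t / 2"
      by (auto simp: df_def numeral_2_eq_2)
    have "\<bar>f2 t - f2 0\<bar> = \<bar>((H (p + t *\<^sub>R v) - H p) *v v) \<bullet> v\<bar>"
      by (simp add: f2_def matrix_vector_mult_diff_rdistrib inner_diff_left)
    also have "\<dots> \<le> norm ((H (p + t *\<^sub>R v) - H p) *v v) * norm v" by (rule Cauchy_Schwarz_ineq2)
    also have "\<dots> \<le> (C * norm v * norm v) * norm v"
    proof (rule mult_right_mono)
      have "norm ((H (p + t *\<^sub>R v) - H p) *v v) \<le> real CARD('n) * norm (H (p + t *\<^sub>R v) - H p) * norm v"
        by (rule norm_matrix_vector_mult_le)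
      also have "norm (H (p + t *\<^sub>R v) - H p) \<le> L * norm v"
      proof -
        have tv: "norm (t *\<^sub>R v) \<le> norm v" using t mult_right_mono[of t 1 "norm v"] by simp
        have "p + t *\<^sub>R v \<in> cball 0 (R + 1)" "p \<in> cball 0 (R + 1)"
          unfolding mem_cball_0 using norm_triangle_ineq[of p "t *\<^sub>R v"] p v tv by linarith+
        then have "norm (H (p + t *\<^sub>R v) - H p) \<le> L * norm (t *\<^sub>R v)"
          using lipschitz_onD[OF L, of "p + t *\<^sub>R v" p] by (simp add: dist_norm)
        also have "\<dots> \<le> L * norm v" using tv L0 by (rule mult_left_mono)
        finally show ?thesis .
      qed
      finally show "norm ((H (p + t *\<^sub>R v) - H p) *v v) \<le> C * norm v * norm v"
        by (simp add: C_def mult_right_mono mult_left_mono mult.assoc)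
    qed simp
    finally have "\<bar>f2 t - f2 0\<bar> \<le> C * norm v ^ 3" by (simp add: power3_eq_cube mult.assoc)
    moreover have "z (p + v) - (z p + grad z p \<bullet> v + (v \<bullet> (H p *v v)) / 2) = (f2 t - f2 0) / 2"
      using t(3) by (simp add: f0_def f1_def f2_def inner_commute[of _ v] field_simps)
    moreover have "0 \<le> C * norm v ^ 3" using C0 by simp
    ultimately show ?thesis by simp
  qed
  then show ?thesis using that C0 by blast
qed

text \<open>For large increments the cubic term dominates every other one; for increments that leave the
  ball it makes the right-hand side nonnegative.\<close>
lemma C21_Taylor_killed:
  fixes z :: "real^'n \<Rightarrow> real"
  assumes z: "\<And>x. z differentiable (at x)" and pos: "\<And>x. 0 \<le> z x"
    and der: "\<And>x. (grad z has_derivative (\<lambda>h. H x *v h)) (at x)" and H: "loc_lipschitz H"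
  obtains C where "0 \<le> C"
    "\<And>p v. norm p \<le> R \<Longrightarrow> z (p + v) * indicator (ball 0 R) (p + v)
      \<le> z p + grad z p \<bullet> v + (v \<bullet> (H p *v v)) / 2 + C * norm v ^ 3"
proof -
  obtain C1 where C1: "0 \<le> C1"
    "\<And>p v. norm p \<le> R \<Longrightarrow> norm v \<le> 1 \<Longrightarrow>
      \<bar>z (p + v) - (z p + grad z p \<bullet> v + (v \<bullet> (H p *v v)) / 2)\<bar> \<le> C1 * norm v ^ 3"
    using C21_Taylor[OF z der H, of R] by blast
  have ctz: "continuous_on UNIV z"
    by (intro continuous_at_imp_continuous_on ballI differentiable_imp_continuous_within z)
  have ctg: "continuous_on UNIV (grad z)"
    by (intro continuous_at_imp_continuous_on ballI has_derivative_continuous[OF der])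
  have bdd: "\<exists>b\<ge>0. \<forall>p\<in>cball 0 R. norm (f p) \<le> b" if "continuous_on UNIV f" for f :: "real^'n \<Rightarrow> 'b::real_normed_vector"
  proof -
    have "compact (f ` cball 0 R)"
      by (intro compact_continuous_image continuous_on_subset[OF that]) auto
    then have "bounded (f ` cball 0 R)" by (rule compact_imp_bounded)
    then obtain b where "b > 0" "\<forall>p\<in>cball 0 R. norm (f p) \<le> b" unfolding bounded_pos by blast
    then show ?thesis by (intro exI[of _ b]) auto
  qed
  obtain bz where bz: "bz \<ge> 0" "\<And>p. p \<in> cball 0 R \<Longrightarrow> norm (z p) \<le> bz" using bdd[OF ctz] by blast
  obtain bg where bg: "bg \<ge> 0" "\<And>p. p \<in> cball 0 R \<Longrightarrow> norm (grad z p) \<le> bg" using bdd[OF ctg] by blast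
  obtain bH where bH: "bH \<ge> 0" "\<And>p. p \<in> cball 0 R \<Longrightarrow> norm (H p) \<le> bH"
    using bdd[OF loc_lipschitz_continuous_on[OF H]] by blast
  \<comment> \<open>\<open>C1\<close> serves increments of norm at most 1. For longer ones each
    other term is at most its bound on the ball times \<open>norm v ^ 3\<close>; points outside the
    ball contribute zero on the left, so \<open>bz\<close> suffices for \<open>z\<close>.\<close>
  define C where "C = C1 + (bz + bg + real CARD('n) * bH)"
  have C0: "0 \<le> C" "C1 \<le> C" "bz + bg + real CARD('n) * bH \<le> C"
    using C1(1) bz(1) bg(1) bH(1) by (auto simp: C_def)
  have "z (p + v) * indicator (ball 0 R) (p + v)
      \<le> z p + grad z p \<bullet> v + (v \<bullet> (H p *v v)) / 2 + C * norm v ^ 3" if p: "norm p \<le> R" for p v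
  proof (cases "norm v \<le> 1")
    case True
    have "z (p + v) * indicator (ball 0 R) (p + v) \<le> z (p + v)"
      using pos[of "p + v"] by (auto split: split_indicator)
    also have "\<dots> \<le> z p + grad z p \<bullet> v + (v \<bullet> (H p *v v)) / 2 + C1 * norm v ^ 3"
      using C1(2)[OF p True] by (auto simp: abs_le_iff)
    also have "C1 * norm v ^ 3 \<le> C * norm v ^ 3" using C0 by (intro mult_right_mono) auto
    finally show ?thesis by simp
  next
    case False
    define r where "r = norm v"
    have r: "1 \<le> r" using False by (simp add: r_def)
    have pc: "p \<in> cball 0 R" using p by simp
    have r3: "1 \<le> r ^ 3" "r \<le> r ^ 3" "r ^ 2 \<le> r ^ 3"
      using r power_increasing[of 1 3 r] by (auto intro: power_increasing)
    have 1: "z (p + v) * indicator (ball 0 R) (p + v) \<le> bz * r ^ 3"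
    proof -
      have "z (p + v) * indicator (ball 0 R) (p + v) \<le> bz"
        using bz(2)[of "p + v"] bz(1) by (auto split: split_indicator)
      also have "\<dots> \<le> bz * r ^ 3" using mult_left_mono[OF r3(1) bz(1)] by simp
      finally show ?thesis .
    qed
    have 2: "- (bg * r ^ 3) \<le> grad z p \<bullet> v"
    proof -
      have "\<bar>grad z p \<bullet> v\<bar> \<le> norm (grad z p) * r" unfolding r_def by (rule Cauchy_Schwarz_ineq2)
      also have "\<dots> \<le> bg * r ^ 3" using bg(2)[OF pc] r3 r by (intro mult_mono) (auto simp: bg)
      finally show ?thesis by simp
    qed
    have 3: "- (real CARD('n) * bH * r ^ 3) \<le> (v \<bullet> (H p *v v)) / 2"
    proof -
      have "\<bar>v \<bullet> (H p *v v)\<bar> \<le> r * norm (H p *v v)" unfolding r_def by (rule Cauchy_Schwarz_ineq2)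
      also have "\<dots> \<le> r * (real CARD('n) * norm (H p) * r)"
        using norm_matrix_vector_mult_le[of "H p" v] r unfolding r_def by (intro mult_left_mono) auto
      also have "\<dots> = real CARD('n) * norm (H p) * r ^ 2" by (simp add: power2_eq_square)
      also have "\<dots> \<le> real CARD('n) * bH * r ^ 3"
        using bH(2)[OF pc] r3 by (intro mult_mono) (auto simp: bH)
      finally have "\<bar>v \<bullet> (H p *v v)\<bar> \<le> real CARD('n) * bH * r ^ 3" .
      moreover have "0 \<le> real CARD('n) * bH * r ^ 3" using bH r by simp
      ultimately show ?thesis by (auto simp: abs_le_iff)
    qed
    have "(bz + bg + real CARD('n) * bH) * r ^ 3 \<le> C * r ^ 3" using C0 r by (intro mult_right_mono) auto
    then show ?thesis using 1 2 3 pos[of p] unfolding r_def by (simp add: algebra_simps)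
  qed
  then show ?thesis using that C0 by blast
qed

section \<open>Gaussian moments\<close>

text \<open>Lebesgue measure on \<open>real^'n\<close> is the image of the product measure indexed
  by the basis vectors, and \<open>idx\<close> translates a basis vector back into its coordinate.
  Fubini on the product then factors the integral.\<close>

lemma integral_lborel_prod_cart:
  fixes f :: "'n::finite \<Rightarrow> real \<Rightarrow> real"
  assumes f: "\<And>i. integrable lborel (f i)"
  shows "has_bochner_integral lborel (\<lambda>y::real^'n. \<Prod>i\<in>UNIV. f i (y $ i)) (\<Prod>i\<in>UNIV. integral\<^sup>L lborel (f i))"
proof -
  interpret product_sigma_finite "\<lambda>_. lborel :: real measure" by standard
  define idx where "idx = inv (\<lambda>i::'n. axis i (1::real))"
  have inj: "inj (\<lambda>i::'n. axis i (1::real))" by (auto simp: inj_def axis_eq_axis)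
  have idx: "idx (axis i 1) = i" for i unfolding idx_def by (rule inv_f_f[OF inj])
  have Basis: "(Basis :: (real^'n) set) = range (\<lambda>i. axis i 1)" by (auto simp: Basis_vec_def)
  have toB: "(\<Prod>b\<in>Basis. g (idx b) b) = (\<Prod>i\<in>UNIV. g i (axis i (1::real)))" for g :: "'n \<Rightarrow> real^'n \<Rightarrow> real"
    unfolding Basis by (subst prod.reindex[OF inj]) (simp add: idx)
  let ?g = "\<lambda>x::real^'n \<Rightarrow> real. \<Sum>b\<in>Basis. x b *\<^sub>R b"
  have g: "?g \<in> measurable (\<Pi>\<^sub>M b\<in>Basis. lborel) borel" by measurable
  have comp: "(\<Prod>i\<in>UNIV. f i (?g x $ i)) = (\<Prod>b\<in>Basis. f (idx b) (x b))" for x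
  proof -
    have "?g x $ i = x (axis i 1)" for i
    proof -
      have "?g x $ i = ?g x \<bullet> axis i 1" by (simp add: inner_axis)
      also have "\<dots> = x (axis i 1)" by (rule inner_sum_left_Basis) (simp add: Basis)
      finally show ?thesis .
    qed
    then show ?thesis using toB[of "\<lambda>i b. f i (x b)"] by simp
  qed
  have int: "integrable (\<Pi>\<^sub>M b\<in>Basis. lborel) (\<lambda>x. \<Prod>b\<in>(Basis::(real^'n) set). f (idx b) (x b))"
    by (intro product_integrable_prod f) auto
  have meas: "(\<lambda>y::real^'n. \<Prod>i\<in>UNIV. f i (y $ i)) \<in> borel_measurable borel"
    using f by (intro borel_measurable_prod measurable_compose[OF borel_measurable_nth])
      (auto dest: borel_measurable_integrable)
  have "integrable lborel (\<lambda>y::real^'n. \<Prod>i\<in>UNIV. f i (y $ i))"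
    unfolding lborel_eq[where 'a = "real^'n"] by (subst integrable_distr_eq[OF g meas]) (simp only: comp int)
  moreover have "(LINT y|lborel. (\<Prod>i\<in>UNIV. f i ((y::real^'n) $ i))) = (\<Prod>i\<in>UNIV. integral\<^sup>L lborel (f i))"
  proof -
    have "(LINT y|lborel. (\<Prod>i\<in>UNIV. f i ((y::real^'n) $ i)))
        = (LINT x|(\<Pi>\<^sub>M b\<in>Basis. lborel). (\<Prod>b\<in>(Basis::(real^'n) set). f (idx b) (x b)))"
      unfolding lborel_eq[where 'a = "real^'n"] by (subst integral_distr[OF g meas]) (simp only: comp)
    also have "\<dots> = (\<Prod>b\<in>(Basis::(real^'n) set). integral\<^sup>L lborel (f (idx b)))"
      by (intro product_integral_prod f) auto
    also have "\<dots> = (\<Prod>i\<in>UNIV. integral\<^sup>L lborel (f i))" by (rule toB)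
    finally show ?thesis .
  qed
  ultimately show ?thesis by (simp add: has_bochner_integral_iff)
qed

text \<open>The centred normal law with covariance \<open>h\<close> times the identity, its density
  written as in \<open>std_brownian\<close> so that the increment laws match directly.\<close>

definition gauss :: "real \<Rightarrow> (real^'n) measure" where
  "gauss h = density lborel (\<lambda>y. ennreal (\<Prod>i\<in>UNIV. normal_density 0 (sqrt h) (y $ i)))"

lemma sets_gauss [simp, measurable_cong]: "sets (gauss h) = sets borel"
  and space_gauss [simp]: "space (gauss h) = UNIV"
  by (simp_all add: gauss_def)

text \<open>Every mixed moment reduces to one-dimensional ones. The exponent function selects the
  moment: zero gives the total mass, one or two marked indices give the moments below.\<close>

lemma gauss_monomial:
  fixes k :: "'n::finite \<Rightarrow> nat"
  assumes h: "0 < h"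
  shows "has_bochner_integral (gauss h) (\<lambda>y::real^'n. \<Prod>i\<in>UNIV. (y $ i) ^ k i)
    (\<Prod>i\<in>UNIV. LINT t|lborel. normal_density 0 (sqrt h) t * t ^ k i)"
proof -
  have "has_bochner_integral lborel (\<lambda>y::real^'n. \<Prod>i\<in>UNIV. normal_density 0 (sqrt h) (y $ i) * (y $ i) ^ k i)
    (\<Prod>i\<in>UNIV. LINT t|lborel. normal_density 0 (sqrt h) t * t ^ k i)"
    using integrable_normal_moment[of "sqrt h" 0] h by (intro integral_lborel_prod_cart) auto
  then show ?thesis
    unfolding gauss_def
    by (intro has_bochner_integral_density)
      (auto simp: prod.distrib intro!: prod_nonneg measurable_compose[OF borel_measurable_nth])
qed

lemma prob_space_gauss:
  assumes h: "0 < h"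
  shows "prob_space (gauss h :: (real^'n) measure)"
proof
  have "has_bochner_integral (gauss h) (\<lambda>y::real^'n. 1::real) 1"
    using gauss_monomial[OF h, of "\<lambda>_. 0"] h by simp
  then have "(\<integral>\<^sup>+y. ennreal 1 \<partial>(gauss h :: (real^'n) measure)) = ennreal 1"
    by (subst nn_integral_eq_integral) (auto simp: has_bochner_integral_iff)
  then show "emeasure (gauss h :: (real^'n) measure) (space (gauss h)) = 1" by simp
qed

lemma gauss_first_moment:
  assumes h: "0 < h"
  shows "has_bochner_integral (gauss h) (\<lambda>y::real^'n. y $ i) 0"
proof -
  have a: "(\<Prod>j\<in>UNIV. LINT t|lborel. normal_density 0 (sqrt h) t * t ^ (if j = i then 1 else 0)) = 0"
    using h integral_normal_moment_odd[of "sqrt h" 0 0] by (intro prod_zero bexI[of _ i]) auto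
  have b: "(\<Prod>j\<in>UNIV. (y $ j) ^ (if j = i then 1 else 0)) = y $ i" for y :: "real^'n"
    by (simp add: if_distrib[of "power _"] prod.delta cong: if_cong)
  show ?thesis using gauss_monomial[OF h, of "\<lambda>j. if j = i then 1 else 0"] by (simp only: a b)
qed

lemma gauss_even_moment:
  assumes h: "0 < h"
  shows "has_bochner_integral (gauss h) (\<lambda>y::real^'n. (y $ i)\<^sup>2) h"
    and "has_bochner_integral (gauss h) (\<lambda>y::real^'n. (y $ i) ^ 4) (3 * h\<^sup>2)"
proof -
  have *: "has_bochner_integral (gauss h) (\<lambda>y::real^'n. (y $ i) ^ n)
      (LINT t|lborel. normal_density 0 (sqrt h) t * t ^ n)" for n
  proof -
    have "(\<Prod>j\<in>UNIV. LINT t|lborel. normal_density 0 (sqrt h) t * t ^ (if j = i then n else 0))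
        = (\<Prod>j\<in>UNIV. if j = i then LINT t|lborel. normal_density 0 (sqrt h) t * t ^ n else 1)"
      using h by (intro prod.cong) auto
    also have "\<dots> = (LINT t|lborel. normal_density 0 (sqrt h) t * t ^ n)" by (simp add: prod.delta)
    finally have "(\<Prod>j\<in>UNIV. LINT t|lborel. normal_density 0 (sqrt h) t * t ^ (if j = i then n else 0))
        = (LINT t|lborel. normal_density 0 (sqrt h) t * t ^ n)" .
    moreover have "(\<Prod>j\<in>UNIV. (y $ j) ^ (if j = i then n else 0)) = (y $ i) ^ n" for y :: "real^'n"
      by (simp add: if_distrib[of "power _"] prod.delta cong: if_cong)
    ultimately show ?thesis using gauss_monomial[OF h, of "\<lambda>j. if j = i then n else 0"] by simp
  qed
  show "has_bochner_integral (gauss h) (\<lambda>y::real^'n. (y $ i)\<^sup>2) h"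
    using *[of 2] h integral_normal_moment_even[of "sqrt h" 0 1] by (simp add: fact_numeral)
  show "has_bochner_integral (gauss h) (\<lambda>y::real^'n. (y $ i) ^ 4) (3 * h\<^sup>2)"
    using *[of 4] h integral_normal_moment_even[of "sqrt h" 0 2]
    by (simp add: fact_numeral power2_eq_square field_simps)
qed

lemma gauss_mixed_moment:
  assumes h: "0 < h" and ij: "i \<noteq> j"
  shows "has_bochner_integral (gauss h) (\<lambda>y::real^'n. y $ i * y $ j) 0"
proof -
  let ?k = "\<lambda>l. (if l = i then 1 else 0) + (if l = j then 1 else 0) :: nat"
  have a: "(\<Prod>l\<in>UNIV. LINT t|lborel. normal_density 0 (sqrt h) t * t ^ ?k l) = 0"
    using h ij integral_normal_moment_odd[of "sqrt h" 0 0] by (intro prod_zero bexI[of _ i]) auto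
  have b: "(\<Prod>l\<in>UNIV. (y $ l) ^ ?k l) = y $ i * y $ j" for y :: "real^'n"
    by (simp add: power_add prod.distrib if_distrib[of "power _"] prod.delta cong: if_cong)
  show ?thesis using gauss_monomial[OF h, of ?k] by (simp only: a b)
qed

lemma gauss_linear:
  fixes c :: "real^'n"
  assumes h: "0 < h"
  shows "has_bochner_integral (gauss h) (\<lambda>y. c \<bullet> y) 0"
proof -
  have "has_bochner_integral (gauss h) (\<lambda>y. \<Sum>i\<in>UNIV. c $ i * y $ i) (\<Sum>i\<in>(UNIV::'n set). c $ i * 0)"
    by (intro has_bochner_integral_sum has_bochner_integral_mult_right gauss_first_moment[OF h])
  then show ?thesis by (simp add: inner_vec_def)
qed

text \<open>Off-diagonal moments vanish, so only the trace remains; this is where the second-order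
  part of the generator arises in discrete time.\<close>

lemma gauss_quadratic:
  fixes Q :: "real^'n^'n"
  assumes h: "0 < h"
  shows "has_bochner_integral (gauss h) (\<lambda>y. y \<bullet> (Q *v y)) (h * trace Q)"
proof -
  have "has_bochner_integral (gauss h) (\<lambda>y::real^'n. y $ i * y $ j) (if i = j then h else 0)" for i j
    using gauss_mixed_moment[OF h, of i j] gauss_even_moment(1)[OF h, of i]
    by (auto simp: power2_eq_square)
  then have "has_bochner_integral (gauss h) (\<lambda>y. \<Sum>i\<in>UNIV. \<Sum>j\<in>UNIV. Q $ i $ j * (y $ i * y $ j))
      (\<Sum>i\<in>(UNIV::'n set). \<Sum>j\<in>(UNIV::'n set). Q $ i $ j * (if i = j then h else 0))"
    by (intro has_bochner_integral_sum has_bochner_integral_mult_right)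
  moreover have "(\<lambda>y. \<Sum>i\<in>UNIV. \<Sum>j\<in>UNIV. Q $ i $ j * (y $ i * y $ j)) = (\<lambda>y. y \<bullet> (Q *v y))"
    by (simp add: fun_eq_iff inner_vec_def matrix_vector_mult_def sum_distrib_left mult_ac)
  moreover have "(\<Sum>i\<in>(UNIV::'n set). \<Sum>j\<in>(UNIV::'n set). Q $ i $ j * (if i = j then h else 0)) = h * trace Q"
    by (simp add: trace_def sum_distrib_left mult.commute if_distrib[of "(*) _"] cong: if_cong)
  ultimately show ?thesis by simp
qed

text \<open>Cauchy-Schwarz over the coordinates reduces the norm to coordinate moments. Divided by
  \<open>sqrt h\<close>, the order \<open>h\<^sup>2\<close> becomes \<open>h * sqrt h\<close>,
  matching the other error terms.\<close>

lemma gauss_norm_power4: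
  assumes h: "0 < h"
  shows "integrable (gauss h) (\<lambda>y::real^'n. norm y ^ 4)"
    and "(LINT y|gauss h. norm (y::real^'n) ^ 4) \<le> 3 * (real CARD('n))\<^sup>2 * h\<^sup>2"
proof -
  let ?N = "real CARD('n)"
  have s: "has_bochner_integral (gauss h) (\<lambda>y::real^'n. ?N * (\<Sum>i\<in>UNIV. (y $ i) ^ 4)) (?N * (\<Sum>i\<in>(UNIV::'n set). 3 * h\<^sup>2))"
    by (intro has_bochner_integral_sum has_bochner_integral_mult_right gauss_even_moment[OF h])
  have le: "norm y ^ 4 \<le> ?N * (\<Sum>i\<in>UNIV. (y $ i) ^ 4)" for y :: "real^'n"
  proof -
    have "norm y ^ 4 = ((norm y)\<^sup>2)\<^sup>2" by (simp flip: power_mult)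
    also have "\<dots> = (\<Sum>i\<in>UNIV. (y $ i)\<^sup>2)\<^sup>2"
      by (simp add: norm_vec_def L2_set_def sum_nonneg)
    also have "\<dots> \<le> (\<Sum>i\<in>(UNIV::'n set). ((y $ i)\<^sup>2)\<^sup>2) * (\<Sum>i\<in>(UNIV::'n set). 1\<^sup>2)"
      using Cauchy_Schwarz_ineq_sum[of "\<lambda>i. (y $ i)\<^sup>2" "\<lambda>_. 1" UNIV] by simp
    finally show ?thesis by (simp add: mult.commute flip: power_mult)
  qed
  show int: "integrable (gauss h) (\<lambda>y::real^'n. norm y ^ 4)"
    by (rule Bochner_Integration.integrable_bound[OF integrable.intros[OF s]])
      (use le in \<open>auto intro!: AE_I2 simp: abs_of_nonneg sum_nonneg\<close>)
  have "(LINT y|gauss h. norm (y::real^'n) ^ 4) \<le> (LINT y|gauss h. ?N * (\<Sum>i\<in>UNIV. ((y::real^'n) $ i) ^ 4))"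
    by (intro integral_mono int integrable.intros[OF s] le)
  also have "\<dots> = ?N * (\<Sum>i\<in>(UNIV::'n set). 3 * h\<^sup>2)" by (rule has_bochner_integral_integral_eq[OF s])
  finally show "(LINT y|gauss h. norm (y::real^'n) ^ 4) \<le> 3 * ?N\<^sup>2 * h\<^sup>2"
    by (simp add: power2_eq_square mult_ac)
qed

section \<open>The killed Euler chain\<close>

text \<open>Reduces the cubic Taylor remainder to even Gaussian moments, with \<open>k = \<surd>h\<close>.\<close>
lemma cube_le_square_plus_fourth:
  fixes r k :: real
  assumes "0 < k" "0 \<le> r"
  shows "r ^ 3 \<le> k * r\<^sup>2 + r ^ 4 / k"
proof -
  have "0 \<le> r\<^sup>2 * ((k - r)\<^sup>2 + k * r)" using assms by simp
  also have "\<dots> = k * (k * r\<^sup>2 + r ^ 4 / k - r ^ 3)"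
    using assms(1) by (simp add: field_simps power2_eq_square power3_eq_cube power4_eq_xxxx)
  finally show ?thesis using assms(1) by (simp add: zero_le_mult_iff)
qed

text \<open>The Taylor bound at \<open>v = h *\<^sub>R m p + \<sigma> *v y\<close> is integrated
  against the Gaussian law: terms linear in \<open>y\<close> vanish, the drift and trace terms have
  order \<open>h\<close>, and the rest is absorbed into \<open>C * h * sqrt h\<close>.
  \<open>C\<close> depends on \<open>R\<close> but not on \<open>h\<close> or
  \<open>p\<close>.\<close>

lemma killed_step_estimate:
  fixes z :: "real^'n \<Rightarrow> real" and \<sigma> :: "real^'n^'n"
  assumes z: "\<And>x. z differentiable (at x)" and pos: "\<And>x. 0 \<le> z x"
    and der: "\<And>x. (grad z has_derivative (\<lambda>h. H x *v h)) (at x)" and H: "loc_lipschitz H"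
    and m: "continuous_on UNIV m"
  obtains C where "0 \<le> C"
    "\<And>h p. 0 < h \<Longrightarrow> h \<le> 1 \<Longrightarrow> norm p \<le> R \<Longrightarrow>
      (\<integral>\<^sup>+y. ennreal (z (p + h *\<^sub>R m p + \<sigma> *v y) * indicator (ball 0 R) (p + h *\<^sub>R m p + \<sigma> *v y)) \<partial>gauss h)
      \<le> ennreal (z p + h * (grad z p \<bullet> m p + trace (transpose \<sigma> ** H p ** \<sigma>) / 2) + C * h * sqrt h)"
proof -
  obtain C1 where C1: "0 \<le> C1"
    "\<And>p v. norm p \<le> R \<Longrightarrow> z (p + v) * indicator (ball 0 R) (p + v)
      \<le> z p + grad z p \<bullet> v + (v \<bullet> (H p *v v)) / 2 + C1 * norm v ^ 3"
    using C21_Taylor_killed[OF z pos der H, of R] by blast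
  have bdd: "\<exists>b\<ge>0. \<forall>p. norm p \<le> R \<longrightarrow> norm (f p) \<le> b" if "continuous_on UNIV f" for f :: "real^'n \<Rightarrow> 'b::real_normed_vector"
  proof -
    have "compact (f ` cball 0 R)"
      by (intro compact_continuous_image continuous_on_subset[OF that]) auto
    then have "bounded (f ` cball 0 R)" by (rule compact_imp_bounded)
    then obtain b where "b > 0" "\<forall>p\<in>cball 0 R. norm (f p) \<le> b" unfolding bounded_pos by blast
    then show ?thesis by (intro exI[of _ b]) auto
  qed
  obtain bm where bm: "bm \<ge> 0" "\<And>p. norm p \<le> R \<Longrightarrow> norm (m p) \<le> bm" using bdd[OF m] by blast
  define N where "N = real CARD('n)"
  obtain bH where bH: "bH \<ge> 0" "\<And>p. norm p \<le> R \<Longrightarrow> norm (H p) \<le> bH"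
    using bdd[OF loc_lipschitz_continuous_on[OF H]] by blast
  define s where "s = N * norm \<sigma>"
  have N0: "0 \<le> N" and s0: "0 \<le> s" by (auto simp: N_def s_def)
  \<comment> \<open>The summands cover the drift squared in the Hessian term, the drift cubed, and
    the cubic noise remainder with its moment constants \<open>N\<close> and
    \<open>3 * N\<^sup>2\<close>. The 4 comes from
    \<open>(a + b) ^ 3 \<le> 4 * (a ^ 3 + b ^ 3)\<close>.\<close>
  define C where "C = N * bH * bm\<^sup>2 + 4 * C1 * (bm ^ 3 + s ^ 3 * (N + 3 * N\<^sup>2))"
  have C0: "0 \<le> C" using N0 s0 bm bH C1 by (auto simp: C_def intro!: add_nonneg_nonneg mult_nonneg_nonneg)
  have "(\<integral>\<^sup>+y. ennreal (z (p + h *\<^sub>R m p + \<sigma> *v y) * indicator (ball 0 R) (p + h *\<^sub>R m p + \<sigma> *v y)) \<partial>gauss h)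
      \<le> ennreal (z p + h * (grad z p \<bullet> m p + trace (transpose \<sigma> ** H p ** \<sigma>) / 2) + C * h * sqrt h)"
    if h: "0 < h" "h \<le> 1" and p: "norm p \<le> R" for h p
  proof -
    \<comment> \<open>The Taylor bound sorted by powers of \<open>y\<close>: quadratic part
      \<open>Q\<close>, constant \<open>c\<close>, linear part \<open>l\<close>. The two mixed
      Hessian terms in \<open>l\<close> stay separate because symmetry of \<open>H p\<close> is not
      invoked.\<close>
    define Q where "Q = transpose \<sigma> ** H p ** \<sigma>"
    define c where "c = z p + h * (grad z p \<bullet> m p) + h\<^sup>2 * (m p \<bullet> (H p *v m p)) / 2 + 4 * C1 * (h * bm) ^ 3"
    define l where "l = transpose \<sigma> *v grad z p + (h / 2) *\<^sub>R (transpose \<sigma> *v (transpose (H p) *v m p)) + (h / 2) *\<^sub>R (transpose \<sigma> *v (H p *v m p))"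
    define k where "k = 4 * C1 * s ^ 3"
    have k0: "0 \<le> k" using C1(1) s0 by (simp add: k_def)
    \<comment> \<open>The squared norm is written as the quadratic form of \<open>mat 1\<close>, so
      that \<open>gauss_quadratic\<close> evaluates it.\<close>
    define f where "f y = c + l \<bullet> y + (y \<bullet> (Q *v y)) / 2 + k * (sqrt h * (y \<bullet> (mat 1 *v y)) + norm y ^ 4 / sqrt h)" for y
    have tr: "x \<bullet> (B *v y) = (transpose B *v x) \<bullet> y" for B :: "real^'n^'n" and x y
      by (simp add: dot_lmul_matrix[symmetric] vector_transpose_matrix)
    have bound: "z (p + h *\<^sub>R m p + \<sigma> *v y) * indicator (ball 0 R) (p + h *\<^sub>R m p + \<sigma> *v y) \<le> f y" for y
    proof -
      define v where "v = h *\<^sub>R m p + \<sigma> *v y"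
      have "grad z p \<bullet> v + (v \<bullet> (H p *v v)) / 2
        = h * (grad z p \<bullet> m p) + h\<^sup>2 * (m p \<bullet> (H p *v m p)) / 2 + l \<bullet> y + (y \<bullet> (Q *v y)) / 2"
      proof -
        have 1: "grad z p \<bullet> (\<sigma> *v y) = (transpose \<sigma> *v grad z p) \<bullet> y" by (rule tr)
        have 2: "m p \<bullet> (H p *v (\<sigma> *v y)) = (transpose \<sigma> *v (transpose (H p) *v m p)) \<bullet> y"
          unfolding tr by simp
        have 3: "(\<sigma> *v y) \<bullet> (H p *v m p) = (transpose \<sigma> *v (H p *v m p)) \<bullet> y"
          by (subst inner_commute) (rule tr)
        have 4: "(\<sigma> *v y) \<bullet> (H p *v (\<sigma> *v y)) = y \<bullet> (Q *v y)"
        proof -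
          have "y \<bullet> (Q *v y) = y \<bullet> (transpose \<sigma> *v (H p *v (\<sigma> *v y)))"
            by (simp only: Q_def matrix_vector_mul_assoc matrix_mul_assoc)
          also have "\<dots> = (transpose (transpose \<sigma>) *v y) \<bullet> (H p *v (\<sigma> *v y))" by (rule tr)
          finally show ?thesis by (simp only: transpose_transpose)
        qed
        show ?thesis
          unfolding v_def l_def
          by (simp add: inner_add_left inner_add_right matrix_vector_right_distrib matrix_vector_mult_scaleR
              1 2 3 4 power2_eq_square field_simps)
      qed
      moreover have "C1 * norm v ^ 3 \<le> 4 * C1 * (h * bm) ^ 3 + k * (sqrt h * (y \<bullet> (mat 1 *v y)) + norm y ^ 4 / sqrt h)"
      proof -
        have "norm v \<le> h * bm + s * norm y"
        proof -
          have "norm (\<sigma> *v y) \<le> s * norm y"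
            unfolding s_def N_def by (rule norm_matrix_vector_mult_le)
          moreover have "norm (h *\<^sub>R m p) \<le> h * bm" using bm(2)[OF p] h by simp
          ultimately show ?thesis unfolding v_def using norm_triangle_ineq[of "h *\<^sub>R m p" "\<sigma> *v y"] by linarith
        qed
        then have "norm v ^ 3 \<le> (h * bm + s * norm y) ^ 3" by (intro power_mono) auto
        also have "\<dots> \<le> 4 * ((h * bm) ^ 3 + (s * norm y) ^ 3)"
        proof -
          have "(a + b) ^ 3 \<le> 4 * (a ^ 3 + b ^ 3)" if "0 \<le> a" "0 \<le> b" for a b :: real
          proof -
            have "4 * (a ^ 3 + b ^ 3) - (a + b) ^ 3 = 3 * (a + b) * (a - b)\<^sup>2"
              by (simp add: power3_eq_cube power2_eq_square algebra_simps)
            also have "\<dots> \<ge> 0" using that by simp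
            finally show ?thesis by simp
          qed
          then show ?thesis using h bm s0 by simp
        qed
        finally have "C1 * norm v ^ 3 \<le> C1 * (4 * ((h * bm) ^ 3 + (s * norm y) ^ 3))"
          using C1(1) by (rule mult_left_mono)
        also have "\<dots> = 4 * C1 * (h * bm) ^ 3 + k * norm y ^ 3"
          by (simp add: k_def algebra_simps power_mult_distrib)
        also have "k * norm y ^ 3 \<le> k * (sqrt h * (norm y)\<^sup>2 + norm y ^ 4 / sqrt h)"
          using cube_le_square_plus_fourth[of "sqrt h" "norm y"] h k0 by (intro mult_left_mono) auto
        finally show ?thesis by (simp add: power2_norm_eq_inner)
      qed
      ultimately show ?thesis
        using C1(2)[OF p, of v] unfolding f_def c_def v_def by (simp add: add.assoc)
    qed
    interpret prob_space "gauss h :: (real^'n) measure" by (rule prob_space_gauss[OF h(1)])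
    have int4: "has_bochner_integral (gauss h) (\<lambda>y::real^'n. norm y ^ 4) (LINT y|gauss h. norm (y::real^'n) ^ 4)"
      using gauss_norm_power4(1)[OF h(1)] by (rule has_bochner_integral_integrable)
    have int1: "has_bochner_integral (gauss h) (\<lambda>y::real^'n. c) c"
      using has_bochner_integral_integrable[of "gauss h" "\<lambda>y::real^'n. c"] by (simp add: prob_space[simplified])
    define I4 where "I4 = (LINT y|gauss h. norm (y::real^'n) ^ 4)"
    have intf: "has_bochner_integral (gauss h) f
        (c + 0 + (h * trace Q) / 2 + k * (sqrt h * (h * trace (mat 1 :: real^'n^'n)) + I4 / sqrt h))"
      unfolding f_def[abs_def] I4_def
      by (intro has_bochner_integral_add has_bochner_integral_mult_right has_bochner_integral_divide int1 int4
          gauss_linear[OF h(1)] gauss_quadratic[OF h(1)]) 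
    have f0: "0 \<le> f y" for y
      using bound[of y] pos[of "p + h *\<^sub>R m p + \<sigma> *v y"] by (smt (verit) indicator_pos_le mult_nonneg_nonneg)
    have "(\<integral>\<^sup>+y. ennreal (z (p + h *\<^sub>R m p + \<sigma> *v y) * indicator (ball 0 R) (p + h *\<^sub>R m p + \<sigma> *v y)) \<partial>gauss h)
        \<le> (\<integral>\<^sup>+y. ennreal (f y) \<partial>gauss h)"
      by (intro nn_integral_mono ennreal_leI bound)
    also have "\<dots> = ennreal (c + 0 + (h * trace Q) / 2 + k * (sqrt h * (h * trace (mat 1 :: real^'n^'n)) + I4 / sqrt h))"
      using intf f0 by (subst nn_integral_eq_integral) (auto simp: has_bochner_integral_iff)
    also have "\<dots> \<le> ennreal (z p + h * (grad z p \<bullet> m p + trace Q / 2) + C * h * sqrt h)"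
    proof (rule ennreal_leI)
      have sq: "sqrt h * sqrt h = h" "0 < sqrt h" "sqrt h \<le> 1" using h by auto
      have hs: "h\<^sup>2 \<le> h * sqrt h" "h ^ 3 \<le> h * sqrt h"
      proof -
        have "h \<le> sqrt h" using sq mult_left_mono[of "sqrt h" 1 "sqrt h"] by simp
        then show *: "h\<^sup>2 \<le> h * sqrt h" using h by (simp add: power2_eq_square)
        have "h ^ 3 \<le> h\<^sup>2" using h by (intro power_decreasing) auto
        then show "h ^ 3 \<le> h * sqrt h" using * by simp
      qed
      have a: "h\<^sup>2 * (m p \<bullet> (H p *v m p)) / 2 \<le> N * bH * bm\<^sup>2 * (h * sqrt h)"
      proof -
        have "m p \<bullet> (H p *v m p) \<le> norm (m p) * norm (H p *v m p)" by (rule norm_cauchy_schwarz)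
        also have "\<dots> \<le> bm * (N * bH * bm)"
        proof (rule mult_mono)
          have "norm (H p *v m p) \<le> N * norm (H p) * norm (m p)"
            unfolding N_def by (rule norm_matrix_vector_mult_le)
          also have "\<dots> \<le> N * bH * bm" using bm bH p N0 by (intro mult_mono) auto
          finally show "norm (H p *v m p) \<le> N * bH * bm" .
        qed (use bm p in auto)
        finally have "m p \<bullet> (H p *v m p) \<le> N * bH * bm\<^sup>2" by (simp add: power2_eq_square mult_ac)
        then have "h\<^sup>2 * (m p \<bullet> (H p *v m p)) \<le> h\<^sup>2 * (N * bH * bm\<^sup>2)" by (intro mult_left_mono) auto
        also have "\<dots> \<le> (h * sqrt h) * (N * bH * bm\<^sup>2)" using hs(1) N0 bH bm by (intro mult_right_mono) auto
        finally have "h\<^sup>2 * (m p \<bullet> (H p *v m p)) \<le> N * bH * bm\<^sup>2 * (h * sqrt h)" by (simp add: mult_ac)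
        moreover have "0 \<le> N * bH * bm\<^sup>2 * (h * sqrt h)" using N0 bH bm h by simp
        ultimately show ?thesis by simp
      qed
      have b: "4 * C1 * (h * bm) ^ 3 \<le> 4 * C1 * bm ^ 3 * (h * sqrt h)"
        using mult_left_mono[OF hs(2), of "4 * C1 * bm ^ 3"] C1(1) bm by (simp add: power_mult_distrib mult_ac)
      have "I4 \<le> 3 * N\<^sup>2 * h\<^sup>2" unfolding I4_def N_def by (rule gauss_norm_power4(2)[OF h(1)])
      then have "I4 / sqrt h \<le> 3 * N\<^sup>2 * h\<^sup>2 / sqrt h" using sq by (intro divide_right_mono) auto
      also have "\<dots> = 3 * N\<^sup>2 * (h * sqrt h)"
        using sq by (simp add: power2_eq_square field_simps)
      finally have d: "I4 / sqrt h \<le> 3 * N\<^sup>2 * (h * sqrt h)" .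
      have "trace (mat 1 :: real^'n^'n) = N" by (simp add: trace_I N_def)
      then have "sqrt h * (h * trace (mat 1 :: real^'n^'n)) + I4 / sqrt h \<le> (N + 3 * N\<^sup>2) * (h * sqrt h)"
        using d by (simp add: algebra_simps)
      then have "k * (sqrt h * (h * trace (mat 1 :: real^'n^'n)) + I4 / sqrt h) \<le> k * ((N + 3 * N\<^sup>2) * (h * sqrt h))"
        using k0 by (rule mult_left_mono)
      then show "c + 0 + (h * trace Q) / 2 + k * (sqrt h * (h * trace (mat 1 :: real^'n^'n)) + I4 / sqrt h)
          \<le> z p + h * (grad z p \<bullet> m p + trace Q / 2) + C * h * sqrt h"
        using a b unfolding c_def C_def k_def by (simp add: algebra_simps)
    qed
    finally show ?thesis unfolding Q_def .
  qed
  then show ?thesis using that C0 by blast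
qed

section \<open>Expectations along a chain driven by independent increments\<close>

text \<open>In place of conditional expectations: the past increments and \<open>Y k\<close> are
  independent, so their joint law is a product, and the last increment is integrated first with the
  past frozen. \<open>Inv\<close> confines the one-step inequality to reachable states. Values in
  \<open>ennreal\<close> avoid carrying integrability along.\<close>

lemma (in prob_space) chain_nn_integral_le:
  fixes Y :: "nat \<Rightarrow> 'a \<Rightarrow> 'y::{second_countable_topology,t2_space}"
    and S :: "nat \<Rightarrow> (nat \<Rightarrow> 'y) \<Rightarrow> 's::{second_countable_topology,t2_space}"
    and f :: "'s \<times> 'y \<Rightarrow> 's" and G :: "'s \<Rightarrow> ennreal"
  assumes ind: "indep_vars (\<lambda>_. borel) Y {..<N}"
    and law: "\<And>j. j < N \<Longrightarrow> distr M borel (Y j) = \<nu>"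
    and f: "f \<in> borel \<Otimes>\<^sub>M borel \<rightarrow>\<^sub>M borel" and G: "G \<in> borel_measurable borel"
    and S0: "\<And>y. S 0 y = s0" and SS: "\<And>k y. S (Suc k) y = f (S k y, y k)"
    and Inv0: "Inv s0" and Inv: "\<And>s y. Inv s \<Longrightarrow> Inv (f (s, y))"
    and step: "\<And>s. Inv s \<Longrightarrow> (\<integral>\<^sup>+y. G (f (s, y)) \<partial>\<nu>) \<le> G s + c"
    and k: "k \<le> N"
  shows "(\<integral>\<^sup>+\<omega>. G (S k (\<lambda>j. Y j \<omega>)) \<partial>M) \<le> G s0 + of_nat k * c"
  using k
proof (induction k)
  case 0
  then show ?case by (simp add: S0 emeasure_space_1)
next
  case (Suc k)
  \<comment> \<open>The chain takes an infinite sequence but reads only its first \<open>k\<close>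
    entries up to time \<open>k\<close>; this makes it a function on a finite product space.\<close>
  have dep: "S j (restrict y {..<k}) = S j y" if "j \<le> k" for j y
    using that by (induction j) (auto simp: S0 SS)
  have Smeas: "S j \<in> measurable (PiM {..<k} (\<lambda>_. borel)) borel" if "j \<le> k" for j
    using that
  proof (induction j)
    case 0
    have "S 0 = (\<lambda>_. s0)" using S0 by auto
    then show ?case by simp
  next
    case (Suc j)
    have "S (Suc j) = (\<lambda>y. f (S j y, y j))" using SS by auto
    moreover have "(\<lambda>y. (S j y, y j)) \<in> measurable (PiM {..<k} (\<lambda>_. borel)) (borel \<Otimes>\<^sub>M borel)"
      using Suc by (intro measurable_Pair measurable_component_singleton) auto
    ultimately show ?case using measurable_compose[OF _ f] by simp
  qed
  let ?A = "PiM {..<k} (\<lambda>_. borel :: 'y measure)" and ?B = "PiM {k} (\<lambda>_. borel :: 'y measure)"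
  define U where "U \<omega> = restrict (\<lambda>i. Y i \<omega>) {..<k}" for \<omega>
  define V where "V \<omega> = restrict (\<lambda>i. Y i \<omega>) {k}" for \<omega>
  have iv: "indep_var ?A U ?B V"
    unfolding U_def[abs_def] V_def[abs_def] by (rule indep_var_restrict[OF ind]) (use Suc.prems in auto)
  then have Um[measurable]: "U \<in> measurable M ?A" and Vm[measurable]: "V \<in> measurable M ?B"
    by (auto dest: indep_var_rv1 indep_var_rv2)
  have Ym: "Y k \<in> borel_measurable M" using ind Suc.prems by (auto simp: indep_vars_def)
  define X where "X \<omega> = S k (\<lambda>j. Y j \<omega>)" for \<omega>
  have XU: "X \<omega> = S k (U \<omega>)" for \<omega> using dep[OF order_refl] by (simp add: X_def U_def)
  have Xm: "X \<in> borel_measurable M"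
    unfolding XU[abs_def] by (rule measurable_compose[OF Um Smeas]) simp
  have prod: "distr M (?A \<Otimes>\<^sub>M ?B) (\<lambda>\<omega>. (U \<omega>, V \<omega>)) = distr M ?A U \<Otimes>\<^sub>M distr M ?B V"
    using iv by (simp add: indep_var_distribution_eq)
  interpret DV: prob_space "distr M ?B V" by (rule prob_space_distr) simp
  have Gf: "(\<lambda>q. G (f q)) \<in> borel_measurable (borel \<Otimes>\<^sub>M borel)"
    by (rule measurable_compose[OF f G])
  have SV: "(\<lambda>q. (S k (fst q), snd q k)) \<in> ?A \<Otimes>\<^sub>M ?B \<rightarrow>\<^sub>M borel \<Otimes>\<^sub>M borel"
    by (intro measurable_Pair measurable_compose[OF measurable_fst Smeas]
        measurable_compose[OF measurable_snd measurable_component_singleton]) auto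
  have Gf': "(\<lambda>q. G (f (S k (fst q), snd q k))) \<in> borel_measurable (?A \<Otimes>\<^sub>M ?B)"
    using measurable_compose[OF SV Gf] by simp
  have invS: "Inv (S j y)" for j y by (induction j) (auto simp: S0 SS Inv0 Inv)
  have "(\<integral>\<^sup>+\<omega>. G (S (Suc k) (\<lambda>j. Y j \<omega>)) \<partial>M) = (\<integral>\<^sup>+\<omega>. G (f (S k (fst (U \<omega>, V \<omega>)), snd (U \<omega>, V \<omega>) k)) \<partial>M)"
    by (simp add: SS XU[unfolded X_def] V_def)
  also have "\<dots> = (\<integral>\<^sup>+q. G (f (S k (fst q), snd q k)) \<partial>distr M (?A \<Otimes>\<^sub>M ?B) (\<lambda>\<omega>. (U \<omega>, V \<omega>)))"
    by (subst nn_integral_distr) (use Gf' in simp_all)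
  also have "\<dots> = (\<integral>\<^sup>+x. \<integral>\<^sup>+v. G (f (S k x, v k)) \<partial>distr M ?B V \<partial>distr M ?A U)"
    unfolding prod using DV.nn_integral_fst[of "\<lambda>q. G (f (S k (fst q), snd q k))" "distr M ?A U"] Gf'
    by (simp cong: measurable_cong_sets)
  also have "\<dots> = (\<integral>\<^sup>+x. \<integral>\<^sup>+y. G (f (S k x, y)) \<partial>\<nu> \<partial>distr M ?A U)"
  proof (intro nn_integral_cong)
    fix x
    have m1: "(\<lambda>y. G (f (S k x, y))) \<in> borel_measurable borel"
      using measurable_compose[OF measurable_Pair1' Gf] by simp
    have "(\<integral>\<^sup>+v. G (f (S k x, v k)) \<partial>distr M ?B V) = (\<integral>\<^sup>+\<omega>. G (f (S k x, V \<omega> k)) \<partial>M)"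
    proof (intro nn_integral_distr Vm)
      have "(\<lambda>v. v k) \<in> ?B \<rightarrow>\<^sub>M borel" by (rule measurable_component_singleton) simp
      from measurable_compose[OF this m1]
      show "(\<lambda>v. G (f (S k x, v k))) \<in> borel_measurable (distr M ?B V)" by simp
    qed
    also have "\<dots> = (\<integral>\<^sup>+\<omega>. G (f (S k x, Y k \<omega>)) \<partial>M)" by (simp add: V_def)
    also have "\<dots> = (\<integral>\<^sup>+y. G (f (S k x, y)) \<partial>distr M borel (Y k))"
      by (subst nn_integral_distr) (use Ym m1 in simp_all)
    finally show "(\<integral>\<^sup>+v. G (f (S k x, v k)) \<partial>distr M ?B V) = (\<integral>\<^sup>+y. G (f (S k x, y)) \<partial>\<nu>)"
      using law[of k] Suc.prems by simp
  qed
  also have "\<dots> \<le> (\<integral>\<^sup>+x. G (S k x) + c \<partial>distr M ?A U)"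
    by (intro nn_integral_mono step invS)
  also have "\<dots> = (\<integral>\<^sup>+\<omega>. G (S k (U \<omega>)) + c \<partial>M)"
    using measurable_compose[OF Smeas[OF order_refl] G]
    by (intro nn_integral_distr Um borel_measurable_add) auto
  also have "\<dots> = (\<integral>\<^sup>+\<omega>. G (X \<omega>) + c \<partial>M)" by (simp add: XU)
  also have "\<dots> = (\<integral>\<^sup>+\<omega>. G (X \<omega>) \<partial>M) + c"
    using measurable_compose[OF Xm G] by (subst nn_integral_add) (auto simp: emeasure_space_1)
  also have "\<dots> \<le> (G s0 + of_nat k * c) + c"
    using Suc by (intro add_right_mono) (simp add: X_def)
  finally show ?case by (simp add: algebra_simps)
qed

text \<open>State: position of the Euler scheme, logarithm of the weight, indicator of not having left the
  ball, and running maximum of the killed process.\<close>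
definition kstep :: "(real^'n \<Rightarrow> real^'n) \<Rightarrow> (real^'n \<Rightarrow> real) \<Rightarrow> (real^'n \<Rightarrow> real) \<Rightarrow> real^'n^'n \<Rightarrow> real \<Rightarrow> real \<Rightarrow>
    (real^'n) \<times> real \<times> real \<times> real \<Rightarrow> real^'n \<Rightarrow> (real^'n) \<times> real \<times> real \<times> real" where
  "kstep m d z \<sigma> h R = (\<lambda>(p, l, a, K) y.
    (p + h *\<^sub>R m p + \<sigma> *v y, l + h * d p, a * indicator (ball 0 R) (p + h *\<^sub>R m p + \<sigma> *v y),
     max K (z (p + h *\<^sub>R m p + \<sigma> *v y) * exp (l + h * d p) * (a * indicator (ball 0 R) (p + h *\<^sub>R m p + \<sigma> *v y)))))"

text \<open>The running maximum starts at \<open>1 + z x\<close>: this dominates the initial value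
  of the killed process and is at least 1, so that dividing by its root never amplifies
  errors.\<close>

primrec kchain :: "(real^'n \<Rightarrow> real^'n) \<Rightarrow> (real^'n \<Rightarrow> real) \<Rightarrow> (real^'n \<Rightarrow> real) \<Rightarrow> real^'n^'n \<Rightarrow> real \<Rightarrow> real \<Rightarrow>
    real^'n \<Rightarrow> nat \<Rightarrow> (nat \<Rightarrow> real^'n) \<Rightarrow> (real^'n) \<times> real \<times> real \<times> real" where
  "kchain m d z \<sigma> h R x 0 = (\<lambda>y. (x, 0, indicator (ball 0 R) x, 1 + z x))"
| "kchain m d z \<sigma> h R x (Suc k) = (\<lambda>y. kstep m d z \<sigma> h R (kchain m d z \<sigma> h R x k y) (y k))"

definition kpot :: "(real^'n \<Rightarrow> real) \<Rightarrow> (real^'n) \<times> real \<times> real \<times> real \<Rightarrow> real" where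
  "kpot z = (\<lambda>(p, l, a, K). sqrt K + z p * exp l * a / sqrt K)"

text \<open>The bound on \<open>p\<close>, in force while the chain is alive, is what the one-step
  estimate requires. \<open>l \<le> 0\<close> and \<open>1 \<le> K\<close>, together with
  nonpositive \<open>d\<close>, keep the factor in front of the one-step error at most 1.\<close>

definition kinv :: "real \<Rightarrow> (real^'n) \<times> real \<times> real \<times> real \<Rightarrow> bool" where
  "kinv R = (\<lambda>(p, l, a, K). (a = 0 \<or> a = 1 \<and> norm p \<le> R) \<and> l \<le> 0 \<and> 1 \<le> K)"

lemma kstep_measurable:
  assumes m[measurable]: "m \<in> borel_measurable borel" and d[measurable]: "d \<in> borel_measurable borel"
    and z[measurable]: "z \<in> borel_measurable borel"
  shows "(\<lambda>(s, y::real^'n). kstep m d z \<sigma> h R s y) \<in> borel \<Otimes>\<^sub>M borel \<rightarrow>\<^sub>M borel"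
proof -
  have [measurable]: "(\<lambda>y::real^'n. \<sigma> *v y) \<in> borel_measurable borel"
    by (intro borel_measurable_continuous_onI continuous_intros)
  have [measurable]: "ball (0::real^'n) R \<in> sets borel" by simp
  show ?thesis
    unfolding kstep_def case_prod_beta' borel_prod[symmetric] by measurable
qed

lemma kpot_measurable:
  assumes [measurable]: "z \<in> borel_measurable borel"
  shows "kpot z \<in> borel_measurable borel"
  unfolding kpot_def case_prod_beta' borel_prod[symmetric] by measurable

lemma kinv_kstep:
  assumes "\<And>x. d x \<le> 0" "0 \<le> h" "kinv R s"
  shows "kinv R (kstep m d z \<sigma> h R s y)"
proof -
  obtain p l a K where s: "s = (p, l, a, K)" by (cases s)
  have "h * d p \<le> 0" using assms(1)[of p] assms(2) by (rule mult_nonneg_nonpos[rotated])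
  then show ?thesis
    using assms(3) unfolding s kinv_def kstep_def
    by (auto simp: max_def split: split_indicator)
qed

text \<open>The potential \<open>\<surd>K + v/\<surd>K\<close> of a process \<open>v\<close> with running maximum \<open>K\<close> inherits the
  supermartingale property, since \<open>2 \<surd>v \<le> \<surd>K + v/\<surd>K\<close>; it dominates \<open>\<surd>K\<close>.\<close>
lemma sqrt_max_potential:
  fixes K v :: real
  assumes K: "0 < K" and v: "0 \<le> v"
  shows "sqrt (max K v) + v / sqrt (max K v) \<le> sqrt K + v / sqrt K"
proof (cases "v \<le> K")
  case False
  then have v0: "0 < v" using K by linarith
  define a b where "a = sqrt K" and "b = sqrt v"
  have ab: "0 < a" "0 < b" "K = a\<^sup>2" "v = b\<^sup>2" using K v0 by (auto simp: a_def b_def)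
  have "0 \<le> (a - b)\<^sup>2" by simp
  then have "2 * b * a \<le> a\<^sup>2 + b\<^sup>2" by (simp add: power2_diff mult_ac)
  then have "b + b\<^sup>2 / b \<le> a + b\<^sup>2 / a" using ab by (simp add: field_simps power2_eq_square)
  then show ?thesis using False ab(2) by (simp add: a_def[symmetric] b_def[symmetric] ab(4))
qed (simp add: max_def)

text \<open>The discrete counterpart of Ito's formula: the decrease of the weight pays for the
  growth permitted by \<open>super\<close>. By \<open>sqrt_max_potential\<close> the new potential
  is at most the one formed with the old \<open>K\<close>, so \<open>K\<close> can be treated as
  constant during the step.\<close>

lemma kpot_step:
  fixes z :: "real^'n \<Rightarrow> real" and \<sigma> :: "real^'n^'n"
  assumes z: "\<And>x. z differentiable (at x)" and pos: "\<And>x. 0 < z x"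
    and der: "\<And>x. (grad z has_derivative (\<lambda>h. H x *v h)) (at x)" and H: "loc_lipschitz H"
    and m: "continuous_on UNIV m" and d: "\<And>x. d x \<le> 0"
    and super: "\<And>x. trace (transpose \<sigma> ** H x ** \<sigma>) / 2 + grad z x \<bullet> m x + d x * z x \<le> 0"
  obtains C where "0 \<le> C"
    "\<And>h s. 0 < h \<Longrightarrow> h \<le> 1 \<Longrightarrow> kinv R s \<Longrightarrow>
      (\<integral>\<^sup>+y. ennreal (kpot z (kstep m d z \<sigma> h R s y)) \<partial>gauss h) \<le> ennreal (kpot z s) + ennreal (C * h * sqrt h)"
proof -
  obtain C where C: "0 \<le> C"
    "\<And>h p. 0 < h \<Longrightarrow> h \<le> 1 \<Longrightarrow> norm p \<le> R \<Longrightarrow>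
      (\<integral>\<^sup>+y. ennreal (z (p + h *\<^sub>R m p + \<sigma> *v y) * indicator (ball 0 R) (p + h *\<^sub>R m p + \<sigma> *v y)) \<partial>gauss h)
      \<le> ennreal (z p + h * (grad z p \<bullet> m p + trace (transpose \<sigma> ** H p ** \<sigma>) / 2) + C * h * sqrt h)"
    using killed_step_estimate[OF z less_imp_le[OF pos] der H m, of R \<sigma>] by blast
  have mz: "z \<in> borel_measurable borel"
    by (intro borel_measurable_continuous_onI continuous_at_imp_continuous_on ballI
        differentiable_imp_continuous_within z)
  have "(\<integral>\<^sup>+y. ennreal (kpot z (kstep m d z \<sigma> h R s y)) \<partial>gauss h) \<le> ennreal (kpot z s) + ennreal (C * h * sqrt h)"
    if h: "0 < h" "h \<le> 1" and inv: "kinv R s" for h s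
  proof -
    interpret prob_space "gauss h :: (real^'n) measure" by (rule prob_space_gauss[OF h(1)])
    obtain p l a K where s: "s = (p, l, a, K)" by (cases s)
    have l: "l \<le> 0" and K: "1 \<le> K" and a: "a = 0 \<or> a = 1 \<and> norm p \<le> R"
      using inv by (auto simp: s kinv_def)
    have sK: "1 \<le> sqrt K" using K by simp
    define p' where "p' y = p + h *\<^sub>R m p + \<sigma> *v y" for y
    define w where "w = exp (l + h * d p) / sqrt K"
    have w0: "0 \<le> w" using sK by (simp add: w_def)
    have le: "kpot z (kstep m d z \<sigma> h R s y) \<le> sqrt K + w * a * (z (p' y) * indicator (ball 0 R) (p' y))" for y
    proof -
      define v where "v = z (p' y) * exp (l + h * d p) * (a * indicator (ball 0 R) (p' y))"
      have "0 \<le> v" using pos[of "p' y"] a by (auto simp: v_def)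
      then have "sqrt (max K v) + v / sqrt (max K v) \<le> sqrt K + v / sqrt K"
        using K by (intro sqrt_max_potential) auto
      then show ?thesis
        by (simp add: s kstep_def kpot_def v_def w_def p'_def mult_ac)
    qed
    show ?thesis
    proof (cases "a = 0")
      \<comment> \<open>A killed chain stays killed: its value is zero, the maximum is frozen and
        the potential is \<open>sqrt K\<close>.\<close>
      case True
      have "(\<integral>\<^sup>+y. ennreal (kpot z (kstep m d z \<sigma> h R s y)) \<partial>gauss h) \<le> (\<integral>\<^sup>+y. ennreal (kpot z s) \<partial>(gauss h :: (real^'n) measure))"
        using le True by (intro nn_integral_mono ennreal_leI) (simp add: s kpot_def)
      also have "\<dots> = ennreal (kpot z s)" using emeasure_space_1 by simp
      finally show ?thesis by (rule order_trans) simp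
    next
      case False
      then have a1: "a = 1" and p: "norm p \<le> R" using a by auto
      define B where "B = grad z p \<bullet> m p + trace (transpose \<sigma> ** H p ** \<sigma>) / 2"
      have meas: "(\<lambda>y. z (p' y) * indicator (ball 0 R) (p' y)) \<in> borel_measurable (gauss h)"
      proof -
        have [measurable]: "p' \<in> borel_measurable borel"
          unfolding p'_def[abs_def] by (intro borel_measurable_continuous_onI continuous_intros)
        note mz[measurable]
        have [measurable]: "ball (0::real^'n) R \<in> sets borel" by simp
        show ?thesis by measurable
      qed
      have "(\<integral>\<^sup>+y. ennreal (kpot z (kstep m d z \<sigma> h R s y)) \<partial>gauss h)
          \<le> (\<integral>\<^sup>+y. ennreal (sqrt K) + ennreal w * ennreal (z (p' y) * indicator (ball 0 R) (p' y)) \<partial>gauss h)"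
      proof (rule nn_integral_mono)
        fix y
        have "0 \<le> z (p' y) * indicator (ball 0 R) (p' y)" using pos[of "p' y"] by simp
        then show "ennreal (kpot z (kstep m d z \<sigma> h R s y))
            \<le> ennreal (sqrt K) + ennreal w * ennreal (z (p' y) * indicator (ball 0 R) (p' y))"
          using le[of y] w0 sK a1 by (simp add: ennreal_mult[symmetric] ennreal_plus[symmetric] ennreal_leI del: ennreal_plus)
      qed
      also have "\<dots> = ennreal (sqrt K) + ennreal w * (\<integral>\<^sup>+y. ennreal (z (p' y) * indicator (ball 0 R) (p' y)) \<partial>gauss h)"
        using meas by (subst nn_integral_add) (auto simp: nn_integral_cmult emeasure_space_1[simplified])
      also have "\<dots> \<le> ennreal (sqrt K) + ennreal w * ennreal (z p + h * B + C * h * sqrt h)"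
        unfolding p'_def B_def by (intro add_left_mono mult_left_mono C(2) h p) auto
      also have "\<dots> \<le> ennreal (sqrt K) + ennreal w * ennreal (z p * exp (- (h * d p)) + C * h * sqrt h)"
      proof (intro add_left_mono mult_left_mono ennreal_leI add_right_mono)
        \<comment> \<open>By \<open>1 + x \<le> exp x\<close> the weight factor
          \<open>exp (h * d p)\<close> of this step absorbs the growth completely, without an error
          of order \<open>h\<^sup>2\<close>.\<close>
        have "B \<le> z p * (- d p)" using super[of p] by (simp add: B_def algebra_simps)
        then have "h * B \<le> h * (z p * (- d p))" using h by (intro mult_left_mono) auto
        then have "z p + h * B \<le> z p * (1 + (- (h * d p)))" by (simp add: algebra_simps)
        also have "\<dots> \<le> z p * exp (- (h * d p))"
          using pos[of p] by (intro mult_left_mono exp_ge_add_one_self) auto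
        finally show "z p + h * B \<le> z p * exp (- (h * d p))" .
      qed auto
      also have "\<dots> = ennreal (sqrt K + w * (z p * exp (- (h * d p)) + C * h * sqrt h))"
        using w0 sK pos[of p] C(1) h
        by (simp add: ennreal_mult[symmetric] ennreal_plus[symmetric] del: ennreal_plus)
      also have "\<dots> \<le> ennreal (kpot z s + C * h * sqrt h)"
      proof (rule ennreal_leI)
        have "w * (z p * exp (- (h * d p))) = z p * exp l / sqrt K"
          by (simp add: w_def exp_add exp_minus field_simps)
        moreover have "w * (C * h * sqrt h) \<le> 1 * (C * h * sqrt h)"
        proof (rule mult_right_mono)
          have "l + h * d p \<le> 0" using l h d[of p] by (intro add_nonpos_nonpos mult_nonneg_nonpos) auto
          then have "exp (l + h * d p) \<le> 1" by simp
          then have "exp (l + h * d p) \<le> sqrt K" using sK by linarith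
          then show "w \<le> 1" using sK unfolding w_def by (simp add: divide_le_eq)
        qed (use C(1) h in auto)
        ultimately show "sqrt K + w * (z p * exp (- (h * d p)) + C * h * sqrt h) \<le> kpot z s + C * h * sqrt h"
          by (simp add: s kpot_def a1 distrib_left)
      qed
      also have "\<dots> = ennreal (kpot z s) + ennreal (C * h * sqrt h)"
        using sK pos[of p] C(1) h by (intro ennreal_plus) (auto simp: s kpot_def a1)
      finally show ?thesis .
    qed
  qed
  then show ?thesis using that C(1) by blast
qed

text \<open>\<open>C\<close> depends on the ball but not on \<open>h\<close>, \<open>N\<close> or
  \<open>x\<close>, while the main term is independent of the ball; for bounded \<open>N * h\<close>
  the error has order \<open>sqrt h\<close>. The main term bounds the initial potential: the root is
  at most \<open>1 + z x\<close>, the quotient at most \<open>z x\<close>.\<close>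

lemma kchain_max_expectation:
  fixes z :: "real^'n \<Rightarrow> real" and \<sigma> :: "real^'n^'n" and M :: "'w measure"
  assumes z: "\<And>x. z differentiable (at x)" and pos: "\<And>x. 0 < z x"
    and der: "\<And>x. (grad z has_derivative (\<lambda>h. H x *v h)) (at x)" and H: "loc_lipschitz H"
    and m: "continuous_on UNIV m" and d: "\<And>x. d x \<le> 0" "continuous_on UNIV d"
    and super: "\<And>x. trace (transpose \<sigma> ** H x ** \<sigma>) / 2 + grad z x \<bullet> m x + d x * z x \<le> 0"
    and M: "prob_space M"
  obtains C where "0 \<le> C"
    "\<And>h N x Y. 0 < h \<Longrightarrow> h \<le> 1 \<Longrightarrow> prob_space.indep_vars M (\<lambda>_. borel) Y {..<N} \<Longrightarrow>
      (\<And>j. j < N \<Longrightarrow> distr M borel (Y j) = gauss h) \<Longrightarrow>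
      (\<integral>\<^sup>+\<omega>. ennreal (sqrt (snd (snd (snd (kchain m d z \<sigma> h R x N (\<lambda>j. Y j \<omega>)))))) \<partial>M)
      \<le> ennreal (1 + 2 * z x + real N * (C * h * sqrt h))"
proof -
  obtain C where C: "0 \<le> C"
    "\<And>h s. 0 < h \<Longrightarrow> h \<le> 1 \<Longrightarrow> kinv R s \<Longrightarrow>
      (\<integral>\<^sup>+y. ennreal (kpot z (kstep m d z \<sigma> h R s y)) \<partial>gauss h) \<le> ennreal (kpot z s) + ennreal (C * h * sqrt h)"
    using kpot_step[OF z pos der H m d(1) super, of R] by blast
  have mm: "m \<in> borel_measurable borel" and dm: "d \<in> borel_measurable borel"
    using m d(2) by (auto intro: borel_measurable_continuous_onI)
  have zm: "z \<in> borel_measurable borel"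
    by (intro borel_measurable_continuous_onI continuous_at_imp_continuous_on ballI
        differentiable_imp_continuous_within z)
  have "(\<integral>\<^sup>+\<omega>. ennreal (sqrt (snd (snd (snd (kchain m d z \<sigma> h R x N (\<lambda>j. Y j \<omega>)))))) \<partial>M)
      \<le> ennreal (1 + 2 * z x + real N * (C * h * sqrt h))"
    if h: "0 < h" "h \<le> 1" and ind: "prob_space.indep_vars M (\<lambda>_. borel) Y {..<N}"
      and law: "\<And>j. j < N \<Longrightarrow> distr M borel (Y j) = gauss h" for h N x Y
  proof -
    interpret prob_space M by (rule M)
    define s0 where "s0 = (x, 0::real, indicator (ball 0 R) x :: real, 1 + z x)"
    have inv0: "kinv R s0" using pos[of x] by (auto simp: s0_def kinv_def split: split_indicator)
    have pot: "sqrt (snd (snd (snd s))) \<le> kpot z s" if "kinv R s" for s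
    proof -
      obtain p l a K where s: "s = (p, l, a, K)" by (cases s)
      have "0 \<le> z p * exp l * a / sqrt K"
        using that pos[of p] by (auto simp: s kinv_def)
      then show ?thesis by (simp add: s kpot_def)
    qed
    have inv: "kinv R (kchain m d z \<sigma> h R x k y)" for k y
      using inv0 h by (induction k) (auto simp: s0_def intro!: kinv_kstep d(1))
    have "(\<integral>\<^sup>+\<omega>. ennreal (sqrt (snd (snd (snd (kchain m d z \<sigma> h R x N (\<lambda>j. Y j \<omega>)))))) \<partial>M)
        \<le> (\<integral>\<^sup>+\<omega>. ennreal (kpot z (kchain m d z \<sigma> h R x N (\<lambda>j. Y j \<omega>))) \<partial>M)"
      by (intro nn_integral_mono ennreal_leI pot inv)
    also have "\<dots> \<le> ennreal (kpot z s0) + of_nat N * ennreal (C * h * sqrt h)"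
    proof (rule chain_nn_integral_le[where G = "\<lambda>s. ennreal (kpot z s)" and S = "kchain m d z \<sigma> h R x"
          and f = "\<lambda>(s, y). kstep m d z \<sigma> h R s y" and Inv = "kinv R", OF ind law])
      show "(\<lambda>(s, y). kstep m d z \<sigma> h R s y) \<in> borel \<Otimes>\<^sub>M borel \<rightarrow>\<^sub>M borel"
        by (rule kstep_measurable[OF mm dm zm])
      show "(\<lambda>s. ennreal (kpot z s)) \<in> borel_measurable borel"
        using kpot_measurable[OF zm] by simp
    qed (use inv0 h d(1) C in \<open>auto simp: s0_def intro: kinv_kstep\<close>)
    also have "\<dots> = ennreal (kpot z s0 + real N * (C * h * sqrt h))"
    proof -
      have "0 \<le> kpot z s0" using pot[OF inv0] pos[of x] by (auto simp: s0_def elim!: order_trans[rotated])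
      then show ?thesis using C(1) h
        by (simp add: ennreal_of_nat_eq_real_of_nat ennreal_mult[symmetric] ennreal_plus[symmetric] del: ennreal_plus)
    qed
    also have "\<dots> \<le> ennreal (1 + 2 * z x + real N * (C * h * sqrt h))"
    proof (intro ennreal_leI add_right_mono)
      have K1: "1 \<le> sqrt (1 + z x)" using pos[of x] by simp
      then have K: "1 \<le> sqrt (1 + z x)" "sqrt (1 + z x) \<le> 1 + z x"
        using mult_left_mono[OF K1, of "sqrt (1 + z x)"] pos[of x] by auto
      have "z x * indicator (ball 0 R) x / sqrt (1 + z x) \<le> z x / 1"
        using pos[of x] K by (intro frac_le) (auto split: split_indicator)
      then show "kpot z s0 \<le> 1 + 2 * z x" using K by (simp add: s0_def kpot_def)
    qed
    finally show ?thesis .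
  qed
  then show ?thesis using that[of C] C(1) by blast
qed

lemma kchain_measurable:
  assumes m: "m \<in> borel_measurable borel" and d: "d \<in> borel_measurable borel"
    and z: "z \<in> borel_measurable borel" and Y: "\<And>j. Y j \<in> borel_measurable M"
  shows "(\<lambda>(\<omega>, x). kchain m d z \<sigma> h R x k (\<lambda>j. Y j \<omega>)) \<in> M \<Otimes>\<^sub>M borel \<rightarrow>\<^sub>M borel"
proof (induction k)
  case 0
  note z[measurable]
  have [measurable]: "ball (0::real^'a) R \<in> sets borel" by simp
  show ?case unfolding kchain.simps case_prod_beta' borel_prod[symmetric] by measurable
next
  case (Suc k)
  have "(\<lambda>q. (case q of (\<omega>, x) \<Rightarrow> kchain m d z \<sigma> h R x k (\<lambda>j. Y j \<omega>), Y k (fst q)))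
      \<in> M \<Otimes>\<^sub>M borel \<rightarrow>\<^sub>M borel \<Otimes>\<^sub>M borel"
    by (intro measurable_Pair Suc measurable_compose[OF measurable_fst Y])
  from measurable_compose[OF this kstep_measurable[OF m d z, of \<sigma> h R]]
  show ?case by (simp add: case_prod_beta')
qed

text \<open>Killing and maximum are bookkeeping on top of the unkilled scheme. Its two components
  form the Euler scheme of the system extended by the logarithmic weight, so
  \<open>euler_converges\<close> applies.\<close>

lemma kchain_euler:
  "(fst (kchain m d z \<sigma> h R x k y), fst (snd (kchain m d z \<sigma> h R x k y)))
    = euler (\<lambda>(p, l). (m p, d p)) h (x, 0) (\<lambda>j. (\<sigma> *v y j, 0)) k"
proof (induction k)
  case (Suc k)
  obtain p l a K where s: "kchain m d z \<sigma> h R x k y = (p, l, a, K)" by (cases "kchain m d z \<sigma> h R x k y")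
  then have "euler (\<lambda>(p, l). (m p, d p)) h (x, 0) (\<lambda>j. (\<sigma> *v y j, 0)) k = (p, l)" using Suc by simp
  then show ?case by (simp add: s kstep_def)
qed simp

lemma kchain_alive:
  assumes "\<And>i. i \<le> k \<Longrightarrow> norm (fst (kchain m d z \<sigma> h R x i y)) < R"
  shows "fst (snd (snd (kchain m d z \<sigma> h R x k y))) = 1"
  using assms
proof (induction k)
  case (Suc k)
  then show ?case using Suc.prems[of "Suc k"] by (simp add: kstep_def case_prod_beta')
qed auto

lemma kchain_max_ge:
  assumes "\<And>x. 0 \<le> z x"
  shows "(case kchain m d z \<sigma> h R x k y of (p, l, a, K) \<Rightarrow> z p * exp l * a) \<le> snd (snd (snd (kchain m d z \<sigma> h R x k y)))"
  using assms[of x] by (cases k) (auto simp: kstep_def case_prod_beta' split: split_indicator)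

lemma kchain_max_mono:
  assumes "j \<le> k"
  shows "snd (snd (snd (kchain m d z \<sigma> h R x j y))) \<le> snd (snd (snd (kchain m d z \<sigma> h R x k y)))"
  using assms by (induction k rule: dec_induct) (auto simp: kstep_def case_prod_beta')

section \<open>Maximal bound and conclusion\<close>

lemma divg_eq_trace:
  fixes F :: "real^'n \<Rightarrow> real^'n"
  assumes "(F has_derivative (\<lambda>h. B *v h)) (at x)"
  shows "divg F x = trace B"
proof -
  have "frechet_derivative F (at x) = (\<lambda>h. B *v h)"
    using frechet_derivative_at[OF assms] by simp
  then show ?thesis
    by (simp add: divg_def trace_def matrix_vector_mult_basis column_def)
qed

text \<open>The constant matrix commutes with differentiation, and cyclicity of the trace brings the
  second-order term into the form produced by the Gaussian quadratic moment.\<close>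

lemma Lsharp_eq:
  fixes z :: "real^'n \<Rightarrow> real"
  assumes der: "(grad z has_derivative (\<lambda>h. H *v h)) (at x)"
  shows "Lsharp (\<sigma> ** transpose \<sigma>) m z x = trace (transpose \<sigma> ** H ** \<sigma>) / 2 + grad z x \<bullet> m x + divg m x * z x"
proof -
  have "((\<lambda>y. (\<sigma> ** transpose \<sigma>) *v grad z y) has_derivative (\<lambda>h. (\<sigma> ** transpose \<sigma>) *v (H *v h))) (at x)"
    by (rule bounded_linear.has_derivative[OF matrix_vector_mul_bounded_linear der])
  then have "divg (\<lambda>y. (\<sigma> ** transpose \<sigma>) *v grad z y) x = trace ((\<sigma> ** transpose \<sigma>) ** H)"
    by (intro divg_eq_trace) (simp add: matrix_vector_mul_assoc)
  also have "\<dots> = trace (\<sigma> ** (transpose \<sigma> ** H))" by (simp add: matrix_mul_assoc)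
  also have "\<dots> = trace (transpose \<sigma> ** H ** \<sigma>)" by (rule trace_mul_sym)
  finally show ?thesis by (simp add: Lsharp_def inner_commute)
qed

text \<open>The logarithmic weight is adjoined as a coordinate without noise, so that one
  convergence statement covers position and weight together.\<close>

lemma ode_path_augmented:
  fixes m :: "'a::euclidean_space \<Rightarrow> 'a" and d :: "'a \<Rightarrow> real"
  assumes m: "loc_lipschitz m" and d: "continuous_on UNIV d" and \<phi>: "ode_path m \<beta> x \<phi>"
  shows "ode_path (\<lambda>(p, l). (m p, d p)) (\<lambda>t. (\<beta> t, 0)) (x, 0) (\<lambda>t. (\<phi> t, integral {0..t} (\<lambda>s. d (\<phi> s))))"
proof -
  have c\<phi>: "continuous_on {0..t} \<phi>" for t
    using \<phi> by (auto simp: ode_path_def intro: continuous_on_subset)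
  have cm: "continuous_on {0..t} (\<lambda>s. m (\<phi> s))" for t
    by (auto intro!: continuous_on_compose2[OF loc_lipschitz_continuous_on[OF m, of UNIV]] c\<phi>)
  have cd: "continuous_on {0..t} (\<lambda>s. d (\<phi> s))" for t
    by (auto intro!: continuous_on_compose2[OF d] c\<phi>)
  have cI: "continuous_on {0..} (\<lambda>t. integral {0..t} (\<lambda>s. d (\<phi> s)))"
  proof -
    have "continuous (at t within {0..}) (\<lambda>t. integral {0..t} (\<lambda>s. d (\<phi> s)))" if "0 \<le> t" for t
    proof -
      have "continuous_on {0..t+1} (\<lambda>t. integral {0..t} (\<lambda>s. d (\<phi> s)))"
        by (intro indefinite_integral_continuous_1 integrable_continuous_interval cd)
      then have "continuous (at t within {0..t+1}) (\<lambda>t. integral {0..t} (\<lambda>s. d (\<phi> s)))"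
        using that by (simp add: continuous_on_eq_continuous_within)
      moreover have "at t within {0..t+1} = at t within {0..}"
        by (rule at_within_nhd[of t "{..<t+1}"]) auto
      ultimately show ?thesis by simp
    qed
    then show ?thesis by (simp add: continuous_on_eq_continuous_within)
  qed
  have Pair: "integral {0..t} (\<lambda>s. (m (\<phi> s), d (\<phi> s))) = (integral {0..t} (\<lambda>s. m (\<phi> s)), integral {0..t} (\<lambda>s. d (\<phi> s)))" for t
  proof -
    have int: "(\<lambda>s. (m (\<phi> s), d (\<phi> s))) integrable_on {0..t}"
      by (intro integrable_continuous_interval continuous_intros cm cd)
    show ?thesis
      using integral_linear[OF int bounded_linear_fst] integral_linear[OF int bounded_linear_snd]
      by (simp add: prod_eq_iff o_def)
  qed
  show ?thesis
    using \<phi> cI unfolding ode_path_def by (auto simp: Pair intro!: continuous_intros)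
qed

lemma loc_lipschitz_augmented:
  assumes m: "loc_lipschitz m" and d: "loc_lipschitz d"
  shows "loc_lipschitz (\<lambda>(p, l::real). (m p, d p))"
  unfolding loc_lipschitz_def
proof (intro allI impI)
  fix Q :: "('a \<times> real) set" assume "compact Q"
  then have "compact (fst ` Q)" by (intro compact_continuous_image continuous_intros)
  then obtain L1 L2 where L: "L1-lipschitz_on (fst ` Q) m" "L2-lipschitz_on (fst ` Q) d"
    using m d unfolding loc_lipschitz_def by blast
  have "(L1 + L2)-lipschitz_on Q (\<lambda>(p, l). (m p, d p))"
  proof (rule lipschitz_onI)
    fix q q' assume q: "q \<in> Q" "q' \<in> Q"
    have "dist (case q of (p, l) \<Rightarrow> (m p, d p)) (case q' of (p, l) \<Rightarrow> (m p, d p))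
        \<le> dist (m (fst q)) (m (fst q')) + dist (d (fst q)) (d (fst q'))"
      by (auto simp: case_prod_beta' dist_prod_def intro: sqrt_sum_squares_le_sum)
    also have "\<dots> \<le> L1 * dist (fst q) (fst q') + L2 * dist (fst q) (fst q')"
      using q by (intro add_mono lipschitz_onD[OF L(1)] lipschitz_onD[OF L(2)]) auto
    also have "\<dots> \<le> (L1 + L2) * dist q q'"
      unfolding distrib_right[symmetric]
      by (intro mult_left_mono dist_fst_le add_nonneg_nonneg lipschitz_on_nonneg[OF L(1)] lipschitz_on_nonneg[OF L(2)])
    finally show "dist (case q of (p, l) \<Rightarrow> (m p, d p)) (case q' of (p, l) \<Rightarrow> (m p, d p)) \<le> (L1 + L2) * dist q q'" .
  qed (intro add_nonneg_nonneg lipschitz_on_nonneg[OF L(1)] lipschitz_on_nonneg[OF L(2)])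
  then show "\<exists>L. L-lipschitz_on Q (\<lambda>(p, l). (m p, d p))" by blast
qed

section \<open>A measurable substitute for the maximal function\<close>

text \<open>The number \<open>r\<close> is at once the killing radius and the time horizon, reached
  by \<open>r * 2 ^ n\<close> steps of length \<open>1 / 2 ^ n\<close>. Only countably many values
  of \<open>b\<close> enter, which gives measurability without reference to the flow.\<close>

definition maximal_bound :: "(real^'n \<Rightarrow> real^'n) \<Rightarrow> (real^'n \<Rightarrow> real) \<Rightarrow> (real^'n \<Rightarrow> real) \<Rightarrow> real^'n^'n \<Rightarrow>
    (real \<Rightarrow> real^'n) \<Rightarrow> real^'n \<Rightarrow> ennreal" where
  "maximal_bound m d z \<sigma> b x = liminf (\<lambda>r. liminf (\<lambda>n. ennreal (sqrt (snd (snd (snd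
     (kchain m d z \<sigma> (1 / 2 ^ n) (real r) x (r * 2 ^ n)
       (\<lambda>j. b (real (Suc j) * (1 / 2 ^ n)) - b (real j * (1 / 2 ^ n))))))))))"

text \<open>For \<open>r\<close> beyond \<open>t\<close> and the size of the path up to
  \<open>t\<close>, the chain is eventually alive up to the grid point below \<open>t\<close>. Its
  maximum then dominates the value there, which converges to the left-hand side.\<close>

lemma maximal_bound_ge:
  fixes m :: "real^'n \<Rightarrow> real^'n"
  assumes m: "loc_lipschitz m" and d: "loc_lipschitz d" and z: "continuous_on UNIV z" "\<And>x. 0 \<le> z x"
    and \<phi>: "ode_path m (\<lambda>t. \<sigma> *v b t) x \<phi>" and b0: "b 0 = 0" and t: "0 \<le> t"
  shows "ennreal (sqrt (z (\<phi> t) * exp (integral {0..t} (\<lambda>s. d (\<phi> s))))) \<le> maximal_bound m d z \<sigma> b x"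
proof -
  define F where "F = (\<lambda>(p, l::real). (m p, d p))"
  define \<beta> where "\<beta> = (\<lambda>t. (\<sigma> *v b t, 0::real))"
  define \<Phi> where "\<Phi> = (\<lambda>t. (\<phi> t, integral {0..t} (\<lambda>s. d (\<phi> s))))"
  have F: "loc_lipschitz F" unfolding F_def by (rule loc_lipschitz_augmented[OF m d])
  have \<Phi>: "ode_path F \<beta> (x, 0) \<Phi>"
    unfolding F_def \<beta>_def \<Phi>_def
    by (rule ode_path_augmented[OF m loc_lipschitz_continuous_on[OF d] \<phi>])
  have \<beta>0: "\<beta> 0 = 0" by (simp add: \<beta>_def b0 zero_prod_def)
  define h where "h n = (1 / 2 ^ n :: real)" for n :: nat
  have h0: "0 < h n" for n by (simp add: h_def)
  have hlim: "h \<longlonglongrightarrow> 0"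
    unfolding h_def[abs_def] by (intro LIMSEQ_divide_realpow_zero) auto
  define y where "y n j = b (real (Suc j) * h n) - b (real j * h n)" for n j
  define e where "e n = euler F (h n) (x, 0) (\<lambda>j. (\<sigma> *v y n j, 0))" for n
  have e: "e n = euler F (h n) (x, 0) (\<lambda>j. \<beta> (real (Suc j) * h n) - \<beta> (real j * h n))" for n
    unfolding e_def \<beta>_def y_def by (simp add: matrix_vector_mult_diff_distrib)
  \<comment> \<open>Index of the last dyadic grid point not after \<open>t\<close>, hence within one
    step of \<open>t\<close>.\<close>
  define k where "k n = nat \<lfloor>t * 2 ^ n\<rfloor>" for n
  have kreal: "real (k n) = of_int \<lfloor>t * 2 ^ n\<rfloor>" for n using t by (simp add: k_def)
  have kh: "real (k n) * h n \<le> t" "t - h n \<le> real (k n) * h n" for n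
  proof -
    have k: "real (k n) \<le> t * 2 ^ n" "t * 2 ^ n - 1 \<le> real (k n)" unfolding kreal by linarith+
    have th: "t * 2 ^ n * h n = t" by (simp add: h_def)
    show "real (k n) * h n \<le> t" using mult_right_mono[OF k(1), of "h n"] h0[of n] th by simp
    show "t - h n \<le> real (k n) * h n"
      using mult_right_mono[OF k(2), of "h n"] h0[of n] th by (simp add: left_diff_distrib)
  qed
  have khlim: "(\<lambda>n. real (k n) * h n) \<longlonglongrightarrow> t"
  proof (rule tendsto_sandwich[of "\<lambda>n. t - h n" _ _ "\<lambda>_. t"])
    show "(\<lambda>n. t - h n) \<longlonglongrightarrow> t" using tendsto_diff[OF tendsto_const hlim] by simp
  qed (use kh in auto)
  have conv: "\<forall>\<^sub>F n in sequentially. \<forall>i. real i * h n \<le> t \<longrightarrow> dist (e n i) (\<Phi> (real i * h n)) \<le> \<epsilon>" if \<epsilon>: "0 < \<epsilon>" for \<epsilon>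
  proof -
    obtain \<delta> where \<delta>: "\<delta> > 0" "\<And>h k. 0 < h \<Longrightarrow> h \<le> \<delta> \<Longrightarrow> real k * h \<le> t \<Longrightarrow>
       dist (euler F h (x, 0) (\<lambda>j. \<beta> (real (Suc j) * h) - \<beta> (real j * h)) k) (\<Phi> (real k * h)) \<le> \<epsilon>"
      using euler_converges[OF F \<Phi> \<beta>0 t \<epsilon>] by blast
    have "\<forall>\<^sub>F n in sequentially. h n < \<delta>" using hlim \<delta>(1) by (rule order_tendstoD)
    then show ?thesis
      by (rule eventually_mono) (unfold e, intro allI impI \<delta>(2) h0, auto)
  qed
  have ek: "(\<lambda>n. e n (k n)) \<longlonglongrightarrow> \<Phi> t"
  proof -
    have "(\<lambda>n. \<Phi> (real (k n) * h n)) \<longlonglongrightarrow> \<Phi> t"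
    proof (rule continuous_on_tendsto_compose[OF _ khlim])
      show "continuous_on {0..} \<Phi>" using \<Phi> by (simp add: ode_path_def)
    qed (use t less_imp_le[OF h0] in \<open>auto intro!: always_eventually mult_nonneg_nonneg\<close>)
    moreover have "(\<lambda>n. dist (e n (k n)) (\<Phi> (real (k n) * h n))) \<longlonglongrightarrow> 0"
    proof (rule tendstoI)
      fix \<epsilon> :: real assume "0 < \<epsilon>"
      then have "\<forall>\<^sub>F n in sequentially. \<forall>i. real i * h n \<le> t \<longrightarrow> dist (e n i) (\<Phi> (real i * h n)) \<le> \<epsilon> / 2"
        by (intro conv) auto
      then show "\<forall>\<^sub>F n in sequentially. dist (dist (e n (k n)) (\<Phi> (real (k n) * h n))) 0 < \<epsilon>"
      proof eventually_elim
        case (elim n)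
        then have "dist (e n (k n)) (\<Phi> (real (k n) * h n)) \<le> \<epsilon> / 2" using kh(1) by blast
        then show ?case using \<open>0 < \<epsilon>\<close> by simp
      qed
    qed
    ultimately have "(\<lambda>n. \<Phi> (real (k n) * h n) + (e n (k n) - \<Phi> (real (k n) * h n))) \<longlonglongrightarrow> \<Phi> t + 0"
      by (intro tendsto_add tendsto_norm_zero_cancel[where f = "\<lambda>n. e n (k n) - \<Phi> (real (k n) * h n)"])
        (auto simp: dist_norm)
    then show ?thesis by simp
  qed
  define v where "v q = sqrt (z (fst q) * exp (snd q))" for q
  have vlim: "(\<lambda>n. v (e n (k n))) \<longlonglongrightarrow> v (\<Phi> t)"
  proof (rule continuous_on_tendsto_compose[OF _ ek])
    show "continuous_on UNIV v"
      unfolding v_def by (intro continuous_intros continuous_on_compose2[OF z(1)]) auto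
  qed auto
  obtain R0 where R0: "\<And>s. s \<in> {0..t} \<Longrightarrow> norm (\<phi> s) \<le> R0"
    using ode_path_bounded[OF \<phi>, of t] by blast
  \<comment> \<open>The margin 1 in \<open>R0 + 1\<close> absorbs the distance between scheme and
    path, eventually at most 1 on the whole grid up to \<open>t\<close>.\<close>
  have main: "ennreal (v (\<Phi> t)) \<le> liminf (\<lambda>n. ennreal (sqrt (snd (snd (snd
      (kchain m d z \<sigma> (h n) (real r) x (r * 2 ^ n) (y n)))))))" if r: "R0 + 1 < real r" "t \<le> real r" for r
  proof -
    have "\<forall>\<^sub>F n in sequentially. ennreal (v (e n (k n))) \<le> ennreal (sqrt (snd (snd (snd
      (kchain m d z \<sigma> (h n) (real r) x (r * 2 ^ n) (y n))))))"
      using conv[of 1, simplified]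
    proof eventually_elim
      case (elim n)
      let ?s = "kchain m d z \<sigma> (h n) (real r) x"
      have es: "(fst (?s i (y n)), fst (snd (?s i (y n)))) = e n i" for i
        unfolding e_def F_def by (rule kchain_euler)
      have alive: "fst (snd (snd (?s (k n) (y n)))) = 1"
      proof (rule kchain_alive)
        fix i assume "i \<le> k n"
        then have "real i * h n \<le> real (k n) * h n" using h0[of n] by (intro mult_right_mono) auto
        then have ih: "real i * h n \<le> t" using kh(1)[of n] by linarith
        then have "dist (e n i) (\<Phi> (real i * h n)) \<le> 1" using elim by blast
        then have "dist (fst (e n i)) (\<phi> (real i * h n)) \<le> 1"
          using dist_fst_le[of "e n i" "\<Phi> (real i * h n)"] by (simp add: \<Phi>_def)
        moreover have "norm (\<phi> (real i * h n)) \<le> R0" using R0 ih h0[of n] by simp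
        ultimately have "norm (fst (e n i)) \<le> R0 + 1"
          using norm_triangle_sub[of "fst (e n i)" "\<phi> (real i * h n)"] by (simp add: dist_norm)
        then show "norm (fst (?s i (y n))) < real r" using r(1) es[of i] by (metis fst_conv le_less_trans)
      qed
      have "v (e n (k n)) \<le> sqrt (snd (snd (snd (?s (k n) (y n)))))"
      proof -
        obtain p l a K where s: "?s (k n) (y n) = (p, l, a, K)" by (cases "?s (k n) (y n)")
        have "z p * exp l * a \<le> K" using kchain_max_ge[where z = z and m = m and d = d and \<sigma> = \<sigma> and h = "h n" and R = "real r" and x = x and k = "k n" and y = "y n"] z(2) by (simp add: s)
        then show ?thesis using es[of "k n"] alive by (simp add: s v_def flip: es)
      qed
      also have "\<dots> \<le> sqrt (snd (snd (snd (?s (r * 2 ^ n) (y n)))))"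
      proof (intro real_sqrt_le_mono kchain_max_mono)
        have "real (k n) \<le> t * 2 ^ n" unfolding kreal by linarith
        also have "\<dots> \<le> real r * 2 ^ n" using r(2) by (intro mult_right_mono) auto
        finally have "real (k n) \<le> real (r * 2 ^ n)" by simp
        then show "k n \<le> r * 2 ^ n" by (simp only: of_nat_le_iff)
      qed
      finally show ?case by (rule ennreal_leI)
    qed
    then have "liminf (\<lambda>n. ennreal (v (e n (k n)))) \<le> liminf (\<lambda>n. ennreal (sqrt (snd (snd (snd
      (kchain m d z \<sigma> (h n) (real r) x (r * 2 ^ n) (y n)))))))"
      by (rule Liminf_mono)
    moreover have "liminf (\<lambda>n. ennreal (v (e n (k n)))) = ennreal (v (\<Phi> t))"
      by (intro lim_imp_Liminf tendsto_ennrealI vlim) simp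
    ultimately show ?thesis by simp
  qed
  obtain r0 :: nat where r0: "max (R0 + 1) t < real r0" using reals_Archimedean2 by blast
  have "\<forall>\<^sub>F r in sequentially. ennreal (v (\<Phi> t)) \<le> liminf (\<lambda>n. ennreal (sqrt (snd (snd (snd
      (kchain m d z \<sigma> (h n) (real r) x (r * 2 ^ n) (y n)))))))"
    using eventually_ge_at_top[of r0]
  proof eventually_elim
    case (elim r)
    then have "real r0 \<le> real r" by simp
    then show ?case using r0 by (intro main) auto
  qed
  then have "ennreal (v (\<Phi> t)) \<le> maximal_bound m d z \<sigma> b x"
    unfolding maximal_bound_def y_def[abs_def] h_def by (rule Liminf_bounded)
  then show ?thesis by (simp add: v_def \<Phi>_def)
qed

lemma brownian_increment_law:
  fixes b :: "'w \<Rightarrow> real \<Rightarrow> real^'n"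
  assumes BM: "std_brownian M b" and h: "0 < h"
  shows "distr M borel (\<lambda>\<omega>. b \<omega> (real (Suc j) * h) - b \<omega> (real j * h)) = gauss h"
proof -
  have "0 \<le> real j * h" "real j * h < real (Suc j) * h" using h by (auto simp: algebra_simps)
  then have "distributed M lborel (\<lambda>\<omega>. b \<omega> (real (Suc j) * h) - b \<omega> (real j * h))
     (\<lambda>y. ennreal (\<Prod>i\<in>UNIV. normal_density 0 (sqrt (real (Suc j) * h - real j * h)) (y $ i)))"
    using BM unfolding std_brownian_def by blast
  then have "distr M lborel (\<lambda>\<omega>. b \<omega> (real (Suc j) * h) - b \<omega> (real j * h)) = gauss h"
    by (auto simp: distributed_def gauss_def algebra_simps)
  moreover have "distr M lborel (\<lambda>\<omega>. b \<omega> (real (Suc j) * h) - b \<omega> (real j * h))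
      = distr M borel (\<lambda>\<omega>. b \<omega> (real (Suc j) * h) - b \<omega> (real j * h))"
    by (rule distr_cong) auto
  ultimately show ?thesis by simp
qed

lemma brownian_increments_indep:
  fixes b :: "'w \<Rightarrow> real \<Rightarrow> real^'n"
  assumes BM: "std_brownian M b" and h: "0 < h"
  shows "prob_space.indep_vars M (\<lambda>_. borel) (\<lambda>j \<omega>. b \<omega> (real (Suc j) * h) - b \<omega> (real j * h)) {..<N}"
proof -
  have "\<forall>(ts :: nat \<Rightarrow> real) k. 0 \<le> ts 0 \<longrightarrow> (\<forall>j<k. ts j < ts (Suc j)) \<longrightarrow>
         prob_space.indep_vars M (\<lambda>_. borel) (\<lambda>j \<omega>. b \<omega> (ts (Suc j)) - b \<omega> (ts j)) {..<k}"
    using BM unfolding std_brownian_def by blast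
  from this[rule_format, of "\<lambda>j. real j * h" N] show ?thesis using h by (simp add: algebra_simps)
qed

lemma maximal_bound_measurable:
  fixes b :: "'w \<Rightarrow> real \<Rightarrow> real^'n"
  assumes m: "m \<in> borel_measurable borel" and d: "d \<in> borel_measurable borel"
    and z: "z \<in> borel_measurable borel" and b: "\<And>t. 0 \<le> t \<Longrightarrow> (\<lambda>\<omega>. b \<omega> t) \<in> borel_measurable M"
  shows "(\<lambda>(\<omega>, x). maximal_bound m d z \<sigma> (b \<omega>) x) \<in> borel_measurable (M \<Otimes>\<^sub>M borel)"
proof -
  have "(\<lambda>q. ennreal (sqrt (snd (snd (snd (case q of (\<omega>, x) \<Rightarrow> kchain m d z \<sigma> (1 / 2 ^ n) (real r) x (r * 2 ^ n)
       (\<lambda>j. b \<omega> (real (Suc j) * (1 / 2 ^ n)) - b \<omega> (real j * (1 / 2 ^ n)))))))))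
      \<in> borel_measurable (M \<Otimes>\<^sub>M borel)" for r n
  proof -
    have [measurable]: "(\<lambda>(\<omega>, x). kchain m d z \<sigma> (1 / 2 ^ n) (real r) x (r * 2 ^ n)
       (\<lambda>j. b \<omega> (real (Suc j) * (1 / 2 ^ n)) - b \<omega> (real j * (1 / 2 ^ n)))) \<in> M \<Otimes>\<^sub>M borel \<rightarrow>\<^sub>M borel \<Otimes>\<^sub>M (borel \<Otimes>\<^sub>M (borel \<Otimes>\<^sub>M borel))"
      unfolding borel_prod
      by (rule kchain_measurable[OF m d z]) (intro borel_measurable_diff b, auto)
    show ?thesis by measurable
  qed
  then have "(\<lambda>q. liminf (\<lambda>r. liminf (\<lambda>n. ennreal (sqrt (snd (snd (snd (case q of (\<omega>, x) \<Rightarrow> kchain m d z \<sigma> (1 / 2 ^ n) (real r) x (r * 2 ^ n)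
       (\<lambda>j. b \<omega> (real (Suc j) * (1 / 2 ^ n)) - b \<omega> (real j * (1 / 2 ^ n)))))))))))
      \<in> borel_measurable (M \<Otimes>\<^sub>M borel)"
    by (intro borel_measurable_liminf)
  then show ?thesis by (simp add: maximal_bound_def case_prod_beta')
qed

text \<open>With \<open>h = 1 / 2 ^ n\<close> the total error over \<open>r * 2 ^ n\<close> steps is
  \<open>r * C * sqrt h\<close>. It vanishes as \<open>n\<close> grows with \<open>r\<close> fixed,
  although \<open>C\<close> depends on \<open>r\<close>; the bound that remains is free of
  \<open>r\<close>, and Fatou applies a second time.\<close>

lemma maximal_bound_expectation:
  fixes z :: "real^'n \<Rightarrow> real" and \<sigma> :: "real^'n^'n" and b :: "'w \<Rightarrow> real \<Rightarrow> real^'n"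
  assumes BM: "std_brownian M b"
    and z: "\<And>x. z differentiable (at x)" and pos: "\<And>x. 0 < z x"
    and der: "\<And>x. (grad z has_derivative (\<lambda>h. H x *v h)) (at x)" and H: "loc_lipschitz H"
    and m: "continuous_on UNIV m" and d: "\<And>x. d x \<le> 0" "continuous_on UNIV d"
    and super: "\<And>x. trace (transpose \<sigma> ** H x ** \<sigma>) / 2 + grad z x \<bullet> m x + d x * z x \<le> 0"
  shows "(\<integral>\<^sup>+\<omega>. maximal_bound m d z \<sigma> (b \<omega>) x \<partial>M) \<le> ennreal (1 + 2 * z x)"
proof -
  have M: "prob_space M" and b: "\<And>t. 0 \<le> t \<Longrightarrow> (\<lambda>\<omega>. b \<omega> t) \<in> borel_measurable M"
    using BM by (auto simp: std_brownian_def)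
  have mm: "m \<in> borel_measurable borel" and dm: "d \<in> borel_measurable borel"
    using m d(2) by (auto intro: borel_measurable_continuous_onI)
  have zm: "z \<in> borel_measurable borel"
    by (intro borel_measurable_continuous_onI continuous_at_imp_continuous_on ballI
        differentiable_imp_continuous_within z)
  define Y where "Y n j \<omega> = b \<omega> (real (Suc j) * (1 / 2 ^ n)) - b \<omega> (real j * (1 / 2 ^ n))" for n :: nat and j \<omega>
  define f where "f r n \<omega> = ennreal (sqrt (snd (snd (snd (kchain m d z \<sigma> (1 / 2 ^ n) (real r) x (r * 2 ^ n) (\<lambda>j. Y n j \<omega>))))))" for r n \<omega>
  have fm: "f r n \<in> borel_measurable M" for r n
  proof -
    have "(\<lambda>(\<omega>, x). kchain m d z \<sigma> (1 / 2 ^ n) (real r) x (r * 2 ^ n) (\<lambda>j. Y n j \<omega>)) \<in> M \<Otimes>\<^sub>M borel \<rightarrow>\<^sub>M borel"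
      by (rule kchain_measurable[OF mm dm zm]) (unfold Y_def, intro borel_measurable_diff b, auto)
    from measurable_compose[OF measurable_Pair2'[of x borel M] this]
    have [measurable]: "(\<lambda>\<omega>. kchain m d z \<sigma> (1 / 2 ^ n) (real r) x (r * 2 ^ n) (\<lambda>j. Y n j \<omega>)) \<in> M \<rightarrow>\<^sub>M borel \<Otimes>\<^sub>M (borel \<Otimes>\<^sub>M (borel \<Otimes>\<^sub>M borel))"
      unfolding borel_prod by simp
    show ?thesis unfolding f_def[abs_def] by measurable
  qed
  have inner: "(\<integral>\<^sup>+\<omega>. liminf (\<lambda>n. f r n \<omega>) \<partial>M) \<le> ennreal (1 + 2 * z x)" for r
  proof -
    obtain C where C: "0 \<le> C"
      "\<And>h N x Y. 0 < h \<Longrightarrow> h \<le> 1 \<Longrightarrow> prob_space.indep_vars M (\<lambda>_. borel) Y {..<N} \<Longrightarrow>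
        (\<And>j. j < N \<Longrightarrow> distr M borel (Y j) = gauss h) \<Longrightarrow>
        (\<integral>\<^sup>+\<omega>. ennreal (sqrt (snd (snd (snd (kchain m d z \<sigma> h (real r) x N (\<lambda>j. Y j \<omega>)))))) \<partial>M)
        \<le> ennreal (1 + 2 * z x + real N * (C * h * sqrt h))"
      using kchain_max_expectation[OF z pos der H m d super M, of "real r"] by blast
    have le: "(\<integral>\<^sup>+\<omega>. f r n \<omega> \<partial>M) \<le> ennreal (1 + 2 * z x + real r * C * sqrt (1 / 2 ^ n))" for n
    proof -
      have "(\<integral>\<^sup>+\<omega>. f r n \<omega> \<partial>M) \<le> ennreal (1 + 2 * z x + real (r * 2 ^ n) * (C * (1 / 2 ^ n) * sqrt (1 / 2 ^ n)))"
        unfolding f_def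
      proof (rule C(2))
        show "prob_space.indep_vars M (\<lambda>_. borel) (Y n) {..<r * 2 ^ n}"
          unfolding Y_def[abs_def] by (rule brownian_increments_indep[OF BM]) simp
        show "distr M borel (Y n j) = gauss (1 / 2 ^ n)" for j
          unfolding Y_def[abs_def] by (rule brownian_increment_law[OF BM]) simp
      qed auto
      then show ?thesis by (simp add: mult.assoc)
    qed
    have "(\<integral>\<^sup>+\<omega>. liminf (\<lambda>n. f r n \<omega>) \<partial>M) \<le> liminf (\<lambda>n. \<integral>\<^sup>+\<omega>. f r n \<omega> \<partial>M)"
      by (rule nn_integral_liminf[OF fm])
    also have "\<dots> \<le> liminf (\<lambda>n. ennreal (1 + 2 * z x + real r * C * sqrt (1 / 2 ^ n)))"
      by (intro Liminf_mono always_eventually allI le)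
    also have "\<dots> = ennreal (1 + 2 * z x)"
    proof (intro lim_imp_Liminf tendsto_ennrealI)
      have "(\<lambda>n. 1 / 2 ^ n :: real) \<longlonglongrightarrow> 0" by (intro LIMSEQ_divide_realpow_zero) auto
      then have "(\<lambda>n. sqrt (1 / 2 ^ n)) \<longlonglongrightarrow> sqrt 0" by (rule tendsto_real_sqrt)
      then have "(\<lambda>n. 1 + 2 * z x + real r * C * sqrt (1 / 2 ^ n)) \<longlonglongrightarrow> 1 + 2 * z x + real r * C * sqrt 0"
        by (intro tendsto_add tendsto_const tendsto_mult)
      then show "(\<lambda>n. 1 + 2 * z x + real r * C * sqrt (1 / 2 ^ n)) \<longlonglongrightarrow> 1 + 2 * z x" by simp
    qed simp
    finally show ?thesis .
  qed
  have "(\<integral>\<^sup>+\<omega>. maximal_bound m d z \<sigma> (b \<omega>) x \<partial>M) = (\<integral>\<^sup>+\<omega>. liminf (\<lambda>r. liminf (\<lambda>n. f r n \<omega>)) \<partial>M)"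
    by (simp add: maximal_bound_def f_def Y_def)
  also have "\<dots> \<le> liminf (\<lambda>r. \<integral>\<^sup>+\<omega>. liminf (\<lambda>n. f r n \<omega>) \<partial>M)"
    by (intro nn_integral_liminf borel_measurable_liminf fm)
  also have "\<dots> \<le> liminf (\<lambda>r. ennreal (1 + 2 * z x))"
    by (intro Liminf_mono always_eventually allI inner)
  finally show ?thesis by (simp add: Liminf_const)
qed

section \<open>Almost sure decay of the transported integral\<close>

theorem theorem4p3:
  fixes M :: "'w measure"
    and b :: "'w \<Rightarrow> real \<Rightarrow> real^'n"
    and \<sigma> :: "real^'n^'n"
    and m :: "real^'n \<Rightarrow> real^'n"
    and \<psi> :: "real^'n \<Rightarrow> real"
    and g\<psi> :: "real^'n \<Rightarrow> real^'n"
    and lam_c :: real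
    and X :: "real \<Rightarrow> real^'n \<Rightarrow> 'w \<Rightarrow> real^'n"
    and u :: "real^'n \<Rightarrow> real"
    and A :: "(real^'n) set"
  assumes dim: "CARD('n) \<ge> 2"
    and BM: "std_brownian M b"
    and sigma_sym: "transpose \<sigma> = \<sigma>"
    and sigma_pd: "\<forall>x. x \<noteq> 0 \<longrightarrow> x \<bullet> (\<sigma> *v x) > 0"
    and m_C11: "C11_field m"
    and psi_pos: "\<forall>x. \<psi> x > 0"
    and psi_grad: "\<forall>x. ((\<lambda>y. ln (\<psi> y)) has_derivative (\<lambda>h. g\<psi> x \<bullet> h)) (at x)"
    and m_potential: "\<forall>x. m x = - ((\<sigma> ** transpose \<sigma>) *v g\<psi> x)"
    and psi_int: "((\<lambda>x. 1 / (\<psi> x)^2) has_integral 1) UNIV"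
    and lam_pos: "lam_c > 0"
    and div_m: "\<forall>x. divg m x \<le> - lam_c"
    and flow: "AE \<omega> in M. \<forall>x. continuous_on {0..} (\<lambda>t. X t x \<omega>)
                 \<and> (\<forall>t\<ge>0. X t x \<omega> = x + \<sigma> *v b \<omega> t + integral {0..t} (\<lambda>s. m (X s x \<omega>)))"
    and u_W: "u \<in> coneW (\<sigma> ** transpose \<sigma>) m"
    and A_cpt: "compact A"
  shows "AE \<omega> in M. ((\<lambda>t. integral ((\<lambda>x. X t x \<omega>) ` A) u) \<longlongrightarrow> 0) at_top"
proof -
  interpret prob_space M using BM by (simp add: std_brownian_def)
  obtain J :: "real^'n \<Rightarrow> real^'n^'n" where derm: "\<And>x. (m has_derivative (\<lambda>h. J x *v h)) (at x)" and J: "loc_lipschitz J"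
    using m_C11 unfolding C11_field_def by blast
  obtain z where u: "u = (\<lambda>x. sqrt (z x))" and zS: "z \<in> coneS (\<sigma> ** transpose \<sigma>) m"
    using u_W unfolding coneW_def by blast
  have zd: "z differentiable (at x)" and zpos: "0 < z x" and Lz: "Lsharp (\<sigma> ** transpose \<sigma>) m z x \<le> 0" for x
    using zS unfolding coneS_def C21_fun_def by blast+
  obtain H :: "real^'n \<Rightarrow> real^'n^'n" where derz: "\<And>x. (grad z has_derivative (\<lambda>h. H x *v h)) (at x)" and H: "loc_lipschitz H"
    using zS unfolding coneS_def C21_fun_def C11_field_def by blast
  define d where "d = (\<lambda>x. trace (J x))"
  have divm: "divg m x = d x" for x unfolding d_def by (rule divg_eq_trace[OF derm])
  have dle: "d x \<le> - lam_c" for x using div_m divm by simp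
  have d0: "d x \<le> 0" for x using dle[of x] lam_pos by linarith
  have m: "loc_lipschitz m" by (rule C11_loc_lipschitz[OF derm J])
  \<comment> \<open>The Euler scheme of the extended system needs a locally Lipschitz weight rate;
    the trace is linear and inherits the property from \<open>J\<close>.\<close>
  have d: "loc_lipschitz d"
    unfolding loc_lipschitz_def
  proof (intro allI impI)
    fix K :: "(real^'n) set" assume "compact K"
    then obtain L where L: "L-lipschitz_on K J" using J unfolding loc_lipschitz_def by blast
    have "linear (trace :: real^'n^'n \<Rightarrow> real)" by (rule linearI) (simp_all add: trace_def sum.distrib sum_distrib_left)
    then have "bounded_linear (trace :: real^'n^'n \<Rightarrow> real)" by (simp only: linear_conv_bounded_linear)
    then obtain k where "k-lipschitz_on (J ` K) (trace :: real^'n^'n \<Rightarrow> real)"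
      using bounded_linear.lipschitz_boundE by blast
    from lipschitz_on_compose2[OF L this] show "\<exists>L. L-lipschitz_on K d" unfolding d_def by blast
  qed
  have cz: "continuous_on S z" for S
    by (intro continuous_at_imp_continuous_on ballI differentiable_imp_continuous_within zd)
  have cd: "continuous_on S d" and cm: "continuous_on S m" for S
    by (intro loc_lipschitz_continuous_on d m)+
  have super: "trace (transpose \<sigma> ** H x ** \<sigma>) / 2 + grad z x \<bullet> m x + d x * z x \<le> 0" for x
    using Lz[of x] unfolding Lsharp_eq[OF derz] divm .
  have bm: "(\<lambda>\<omega>. b \<omega> t) \<in> borel_measurable M" if "0 \<le> t" for t
    using BM that by (simp add: std_brownian_def)
  have b0: "AE \<omega> in M. b \<omega> 0 = 0" using BM by (auto simp: std_brownian_def)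
  define S where "S \<omega> x = maximal_bound m d z \<sigma> (b \<omega>) x" for \<omega> x
  have Sm: "(\<lambda>(\<omega>, x). S \<omega> x * indicator A x) \<in> borel_measurable (M \<Otimes>\<^sub>M lborel)"
  proof -
    have [measurable]: "(\<lambda>(\<omega>, x). S \<omega> x) \<in> borel_measurable (M \<Otimes>\<^sub>M borel)"
      unfolding S_def
      by (rule maximal_bound_measurable) (auto intro!: borel_measurable_continuous_onI cz cd cm bm)
    have [measurable]: "A \<in> sets borel" using A_cpt by (simp add: compact_imp_closed)
    have "(\<lambda>(\<omega>, x). S \<omega> x * indicator A x) \<in> borel_measurable (M \<Otimes>\<^sub>M borel)" by measurable
    then show ?thesis by (simp cong: measurable_cong_sets sets_pair_measure_cong)
  qed
  \<comment> \<open>Tonelli trades the expectation bounds at the single points \<open>x\<close> for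
    one null set that serves the whole of \<open>A\<close>; the integrated bound is finite because
    \<open>z\<close> is continuous and \<open>A\<close> compact.\<close>
  have fin: "AE \<omega> in M. (\<integral>\<^sup>+x. S \<omega> x * indicator A x \<partial>lborel) \<noteq> \<infinity>"
  proof (rule nn_integral_PInf_AE)
    interpret P: pair_sigma_finite M "lborel :: (real^'n) measure" by standard
    show "(\<lambda>\<omega>. \<integral>\<^sup>+x. S \<omega> x * indicator A x \<partial>lborel) \<in> borel_measurable M"
      using lborel.borel_measurable_nn_integral_fst[OF Sm] by simp
    have "(\<integral>\<^sup>+\<omega>. \<integral>\<^sup>+x. S \<omega> x * indicator A x \<partial>lborel \<partial>M) = (\<integral>\<^sup>+x. \<integral>\<^sup>+\<omega>. S \<omega> x * indicator A x \<partial>M \<partial>lborel)"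
      using P.Fubini[OF Sm] by simp
    also have "\<dots> \<le> (\<integral>\<^sup>+x. ennreal (indicator A x *\<^sub>R (1 + 2 * z x)) \<partial>lborel)"
    proof (rule nn_integral_mono)
      fix x
      have "(\<integral>\<^sup>+\<omega>. S \<omega> x \<partial>M) \<le> ennreal (1 + 2 * z x)"
        unfolding S_def by (rule maximal_bound_expectation[OF BM zd zpos derz H cm d0 cd super])
      then show "(\<integral>\<^sup>+\<omega>. S \<omega> x * indicator A x \<partial>M) \<le> ennreal (indicator A x *\<^sub>R (1 + 2 * z x))"
        by (auto split: split_indicator)
    qed
    also have "\<dots> < \<infinity>"
    proof -
      have "integrable lborel (\<lambda>x. indicator A x *\<^sub>R (1 + 2 * z x))"
        by (intro borel_integrable_compact A_cpt continuous_intros cz)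
      moreover have "AE x in lborel. 0 \<le> indicator A x *\<^sub>R (1 + 2 * z x)"
        using less_imp_le[OF zpos] by (auto intro!: AE_I2 add_nonneg_nonneg split: split_indicator)
      ultimately show ?thesis by (simp add: nn_integral_eq_integral del: real_scaleR_def)
    qed
    finally show "(\<integral>\<^sup>+\<omega>. \<integral>\<^sup>+x. S \<omega> x * indicator A x \<partial>lborel \<partial>M) \<noteq> \<infinity>" by simp
  qed
  show ?thesis using flow b0 fin AE_space
  proof eventually_elim
    case (elim \<omega>)
    define \<phi> where "\<phi> = (\<lambda>t x. X t x \<omega>)"
    have \<phi>: "ode_path m (\<lambda>t. \<sigma> *v b \<omega> t) x (\<lambda>t. \<phi> t x)" for x
      using elim(1) unfolding ode_path_def \<phi>_def by blast
    \<comment> \<open>\<open>C\<close> depends on \<open>\<omega>\<close> but not on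
      \<open>t\<close>, so the exponential factor alone decides the limit.\<close>
    define C where "C = enn2real (\<integral>\<^sup>+x. S \<omega> x * indicator A x \<partial>lborel)"
    have C: "(\<integral>\<^sup>+x. S \<omega> x * indicator A x \<partial>lborel) = ennreal C"
      unfolding C_def using elim(3) by (simp add: less_top)
    have C0: "0 \<le> C" by (simp add: C_def)
    have uc: "continuous_on T u" for T unfolding u by (intro continuous_intros cz)
    have u0: "0 \<le> u x" for x unfolding u using zpos[of x] by simp
    have upper: "integral (\<phi> t ` A) u \<le> exp (- lam_c * t / 2) * C" if t: "0 \<le> t" for t
    proof -
      define I where "I x = integral {0..t} (\<lambda>s. d (\<phi> s x))" for x
      define g where "g = (\<lambda>x. exp (I x) * u (\<phi> t x))"
      have "integral (\<phi> t ` A) u \<le> integral A g"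
        using flow_integral_image_le[OF derm J \<phi> t A_cpt uc u0] by (simp add: g_def I_def d_def)
      moreover have "integral A g \<le> exp (- lam_c * t / 2) * C"
      proof -
        have Ic: "continuous_on A I" unfolding I_def by (rule flow_integral_continuous[OF m \<phi> cd])
        have gc: "continuous_on A g" unfolding g_def
          by (intro continuous_intros Ic continuous_on_compose2[OF uc[of UNIV] flow_continuous_initial[OF m \<phi> t]]) auto
        have le: "ennreal (indicator A x *\<^sub>R g x) \<le> ennreal (exp (- lam_c * t / 2)) * (S \<omega> x * indicator A x)" for x
        proof -
          have "I x \<le> integral {0..t} (\<lambda>s. - lam_c)"
            unfolding I_def
          proof (rule integral_le)
            have "continuous_on {0..t} (\<lambda>s. \<phi> s x)"
              using \<phi>[of x] by (auto simp: ode_path_def intro: continuous_on_subset)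
            then show "(\<lambda>s. d (\<phi> s x)) integrable_on {0..t}"
              by (intro integrable_continuous_interval continuous_on_compose2[OF cd[of UNIV]]) auto
          qed (use dle in auto)
          then have Ix: "I x \<le> - lam_c * t" using t by (simp add: mult.commute)
          have "g x = exp (I x / 2) * sqrt (z (\<phi> t x) * exp (I x))"
          proof -
            have "sqrt (exp (I x)) = exp (I x / 2)"
              by (rule real_sqrt_unique) (auto simp flip: exp_double)
            moreover have "exp (I x) = exp (I x / 2) * exp (I x / 2)" by (simp flip: exp_add)
            ultimately show ?thesis by (simp add: g_def u real_sqrt_mult)
          qed
          also have "\<dots> \<le> exp (- lam_c * t / 2) * sqrt (z (\<phi> t x) * exp (I x))"
            using Ix zpos[of "\<phi> t x"] by (intro mult_right_mono) auto
          finally have "ennreal (g x) \<le> ennreal (exp (- lam_c * t / 2)) * ennreal (sqrt (z (\<phi> t x) * exp (I x)))"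
            using zpos[of "\<phi> t x"] by (simp add: ennreal_mult[symmetric] ennreal_leI)
          also have "\<dots> \<le> ennreal (exp (- lam_c * t / 2)) * S \<omega> x"
            unfolding S_def I_def
            by (intro mult_left_mono maximal_bound_ge[OF m d cz less_imp_le[OF zpos] \<phi> elim(2) t]) auto
          finally show ?thesis by (auto split: split_indicator)
        qed
        have gi: "integrable lborel (\<lambda>x. indicator A x *\<^sub>R g x)" by (rule borel_integrable_compact[OF A_cpt gc])
        have "integral A g = (LINT x|lborel. indicator A x *\<^sub>R g x)"
          by (rule integral_unique[OF compact_continuous_has_integral[OF A_cpt gc]])
        then have "ennreal (integral A g) = (\<integral>\<^sup>+x. ennreal (indicator A x *\<^sub>R g x) \<partial>lborel)"
          using gi u0 by (subst nn_integral_eq_integral) (auto simp: g_def)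
        also have "\<dots> \<le> (\<integral>\<^sup>+x. ennreal (exp (- lam_c * t / 2)) * (S \<omega> x * indicator A x) \<partial>lborel)"
          by (rule nn_integral_mono[OF le])
        also have "\<dots> = ennreal (exp (- lam_c * t / 2)) * ennreal C"
        proof (subst nn_integral_cmult)
          show "(\<lambda>x. S \<omega> x * indicator A x) \<in> borel_measurable lborel"
            using measurable_compose[OF measurable_Pair1'[OF elim(4)] Sm] by simp
        qed (simp add: C)
        finally show ?thesis using C0 by (simp add: ennreal_mult[symmetric])
      qed
      ultimately show ?thesis by linarith
    qed
    have lower: "0 \<le> integral (\<phi> t ` A) u" if t: "0 \<le> t" for t
    proof -
      have "compact (\<phi> t ` A)"
        by (intro compact_continuous_image flow_continuous_initial[OF m \<phi> t] A_cpt)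
      from compact_continuous_has_integral[OF this uc] have "u integrable_on \<phi> t ` A"
        by (auto simp: integrable_on_def)
      then show ?thesis using u0 by (intro integral_nonneg) auto
    qed
    have "((\<lambda>t. integral (\<phi> t ` A) u) \<longlongrightarrow> 0) at_top"
    proof (rule tendsto_sandwich)
      show "\<forall>\<^sub>F t in at_top. 0 \<le> integral (\<phi> t ` A) u"
        using eventually_ge_at_top[of 0] by eventually_elim (rule lower)
      show "\<forall>\<^sub>F t in at_top. integral (\<phi> t ` A) u \<le> exp (- lam_c * t / 2) * C"
        using eventually_ge_at_top[of 0] by eventually_elim (rule upper)
      have "filterlim (\<lambda>t. - lam_c * t / 2) at_bot at_top"
      proof -
        have "filterlim (\<lambda>t. (- lam_c / 2) * t) at_bot at_top"
          using lam_pos by (intro filterlim_tendsto_neg_mult_at_bot[OF tendsto_const] filterlim_ident) auto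
        then show ?thesis by simp
      qed
      then have "((\<lambda>t. exp (- lam_c * t / 2)) \<longlongrightarrow> 0) at_top"
        by (rule filterlim_compose[OF exp_at_bot])
      then show "((\<lambda>t. exp (- lam_c * t / 2) * C) \<longlongrightarrow> 0) at_top"
        by (rule tendsto_mult_left_zero)
    qed simp
    then show ?case unfolding \<phi>_def .
  qed
qed

end
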